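(* Let $T>0$, let $M=(M_t)_{t\in[0,T]}\neq 0$ be a continuous and square integrable martingale vanishing at $0$ whose quadratic variation $\langle M\rangle=(\langle M\rangle_t)_{t\in[0,T]}$ (a nonnegative, increasing and continuous process) is a deterministic function, and let $J_0$ be an unknown function which almost surely belongs to $\mathbb L^2([0,T],d\langle M\rangle_t)$. Let $N\in\mathbb N^*$, let $\varphi_1,\dots,\varphi_N$ be continuous functions from $[0,T]$ into $\mathbb R$ such that $(\varphi_1,\dots,\varphi_N)$ is an orthonormal family in $\mathbb L^2([0,T],dt)$, let $\mathcal S_m={\rm span}\{\varphi_1,\dots,\varphi_m\}$ for $m\in\{1,\dots,N\}$, and assume that for every $m,m'\in\{1,\dots,N\}$, if $m>m'$, then $\mathcal S_{m'}\subset\mathcal S_m$. Let $m_N\in\{1,\dots,N\}$, $\mathcal M_N=\{1,\dots,m_N\}$, and $$\widehat m=\arg\min_{m\in\mathcal M_N}\{\gamma_N(\widehat J_{m,N})+{\rm pen}(m)\}\quad\text{with}\quad{\rm pen}(m)=\mathfrak c_{\rm cal}\frac mN,$$ where $\mathfrak c_{\rm cal}>0$ is a constant to calibrate in practice, and $\gamma_N$ and the projection least squares estimators $\widehat J_{m,N}$ are defined in the context. Then there exists a deterministic constant $\mathfrak c>0$, not depending on $N$, such that $$\mathbb E[\|\widehat J_{\widehat m,N}-J_0\|_{\langle M\rangle}^{2}]\leqslant\mathfrak c\left(\min_{m\in\mathcal M_N}\left\{\mathbb E[\|\widehat J_{m,N}-J_0\|_{\langle M\rangle}^{2}]+{\rm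 pen}(m)\right\}+\frac1N\right).$$ Moreover, if there exists $\mu\in C^0((0,T];\mathbb R_+)$ such that $\mu(\cdot)^{-1}$ is continuous from $[0,T]$ into $\mathbb R_+$ and $\langle M\rangle_t=\int_0^t\mu(s)\,ds$ for every $t\in[0,T]$, then (with the same constant $\mathfrak c$) $$\mathbb E[\|\widehat J_{\widehat m,N}-J_0\|_{2}^{2}]\leqslant\mathfrak c\,\|\mu(\cdot)^{-1}\|_{\infty,T}\left(\min_{m\in\mathcal M_N}\left\{\|p^{\perp}_{\mathcal S_m(\mu)}(\mu^{1/2}J_0)-\mu^{1/2}J_0\|_2^2+(2+\mathfrak c_{\rm cal})\frac mN\right\}+\frac1N\right).$$
   Context: The process $Z$ is $Z_t=\int_0^tJ_0(s)\,d\langle M\rangle_s+M_t$, $t\in[0,T]$. $M^1,\dots,M^N$ (resp. $Z^1,\dots,Z^N$) are $N$ independent copies of $M$ (resp. $Z$), with $Z^i_t=\int_0^tJ_0(s)\,d\langle M\rangle_s+M^i_t$. Norms: $\|\varphi\|_{\langle M\rangle}^2=\int_0^T\varphi(s)^2\,d\langle M\rangle_s$; $\|\cdot\|_2$ is the usual norm of $\mathbb L^2([0,T],dt)$; $\|\varphi\|_{\infty,T}=\sup_{t\in[0,T]}|\varphi(t)|$. Estimator: for $J\in\mathcal S_m$, $$\gamma_N(J)=\frac1N\sum_{i=1}^N\left(\int_0^TJ(s)^2\,d\langle M^i\rangle_s-2\int_0^TJ(s)\,dZ^i_s\right),$$ and $\widehat J_{m,N}=\arg\min_{J\in\mathcal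 S_m}\gamma_N(J)$. Explicitly, $\widehat J_{m,N}=\sum_{j=1}^m\widehat\theta_j\varphi_j$ with $(\widehat\theta_1,\dots,\widehat\theta_m)^*=\Psi_m^{-1}z_{m,N}$, where $\Psi_m=\left(\int_0^T\varphi_j(s)\varphi_k(s)\,d\langle M\rangle_s\right)_{j,k\in\{1,\dots,m\}}$ (symmetric and positive-definite, the $\varphi_j$'s being linearly independent) and $z_{m,N}=\left(\frac1N\sum_{i=1}^N\int_0^T\varphi_j(s)\,dZ^i_s\right)_{j\in\{1,\dots,m\}}$. The adaptive estimator $\widehat J_{\widehat m,N}$ is $\widehat J_{m,N}$ taken at the random index $m=\widehat m$. $\mathcal S_m(\mu)=\{\iota\in\mathbb L^2([0,T],dt):\exists\varphi\in\mathcal S_m,\ \forall t\in(0,T],\ \iota(t)=\mu(t)^{1/2}\varphi(t)\}$, and $p^\perp_{\mathcal S_m(\mu)}$ is the orthogonal projection from $\mathbb L^2([0,T],dt)$ onto $\mathcal S_m(\mu)$.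
   Formalization: The calibration constant is assumed to satisfy c_cal > 1 instead of c_cal > 0; for c_cal ≤ 1 the claim fails (M Brownian motion, J_0 = 0, trigonometric basis, m_N = N: the risk does not tend to 0 while the bound does). *)

theory Defs
  imports "HOL-Probability.Probability"
begin

section \<open>Square integrable functions on \<open>[0,T]\<close>\<close>

definition leb_on :: "real \<Rightarrow> real measure" where
  "leb_on T = restrict_space lborel {0..T}"

text \<open>The Lebesgue--Stieltjes measure \<open>dA\<close> on \<open>[0,T]\<close> of a function \<open>A\<close> that is continuous and
  nondecreasing on \<open>[0,T]\<close>. Since \<^const>\<open>interval_measure\<close> expects a function on the whole line,
  \<open>A\<close> is extended by constants; values of \<open>A\<close> outside \<open>[0,T]\<close> play no role.\<close>

definition stieltjes :: "(real \<Rightarrow> real) \<Rightarrow> real \<Rightarrow> real measure" where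
  "stieltjes A T = restrict_space (interval_measure (\<lambda>t. A (max 0 (min T t)))) {0..T}"

text \<open>The squared norm takes values in \<^typ>\<open>ennreal\<close>, so that it is infinite, rather than zero, for
  functions that are not square integrable.\<close>

definition sq_norm :: "'a measure \<Rightarrow> ('a \<Rightarrow> real) \<Rightarrow> ennreal" where
  "sq_norm R f = (\<integral>\<^sup>+ x. ennreal ((f x)\<^sup>2) \<partial>R)"

definition L2_fun :: "'a measure \<Rightarrow> ('a \<Rightarrow> real) set" where
  "L2_fun R = {f. f \<in> borel_measurable R \<and> sq_norm R f < \<infinity>}"

definition sup_norm :: "real \<Rightarrow> (real \<Rightarrow> real) \<Rightarrow> real" where
  "sup_norm T f = (SUP t\<in>{0..T}. \<bar>f t\<bar>)"

text \<open>Functions are not identified when they agree almost everywhere, so the orthogonal projection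
  onto a subspace \<open>V\<close> is unique up to a null set only; some representative is chosen.\<close>

definition orth_proj :: "'a measure \<Rightarrow> ('a \<Rightarrow> real) set \<Rightarrow> ('a \<Rightarrow> real) \<Rightarrow> 'a \<Rightarrow> real" where
  "orth_proj R V f = (SOME p. p \<in> V \<and> (\<forall>v\<in>V. (\<integral>x. (f x - p x) * v x \<partial>R) = 0))"

section \<open>Martingales and quadratic variation\<close>

definition filtration_on :: "'a measure \<Rightarrow> (real \<Rightarrow> 'a measure) \<Rightarrow> real \<Rightarrow> bool" where
  "filtration_on P F T \<longleftrightarrow>
     (\<forall>t\<in>{0..T}. subalgebra P (F t)) \<and>
     (\<forall>s t. 0 \<le> s \<and> s \<le> t \<and> t \<le> T \<longrightarrow> subalgebra (F t) (F s))"

definition martingale_on ::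
  "'a measure \<Rightarrow> (real \<Rightarrow> 'a measure) \<Rightarrow> real \<Rightarrow> (real \<Rightarrow> 'a \<Rightarrow> real) \<Rightarrow> bool" where
  "martingale_on P F T X \<longleftrightarrow>
     filtration_on P F T \<and>
     (\<forall>t\<in>{0..T}. X t \<in> borel_measurable (F t) \<and> integrable P (X t)) \<and>
     (\<forall>s t. 0 \<le> s \<and> s \<le> t \<and> t \<le> T \<longrightarrow>
        (AE \<omega> in P. real_cond_exp P (F s) (X t) \<omega> = X s \<omega>))"

definition continuous_paths :: "'a measure \<Rightarrow> real \<Rightarrow> (real \<Rightarrow> 'a \<Rightarrow> real) \<Rightarrow> bool" where
  "continuous_paths P T X \<longleftrightarrow> (AE \<omega> in P. continuous_on {0..T} (\<lambda>t. X t \<omega>))"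

definition cont_sq_int_martingale ::
  "'a measure \<Rightarrow> (real \<Rightarrow> 'a measure) \<Rightarrow> real \<Rightarrow> (real \<Rightarrow> 'a \<Rightarrow> real) \<Rightarrow> bool" where
  "cont_sq_int_martingale P F T M \<longleftrightarrow>
     martingale_on P F T M \<and> continuous_paths P T M \<and>
     (\<forall>t\<in>{0..T}. integrable P (\<lambda>\<omega>. (M t \<omega>)\<^sup>2))"

text \<open>The quadratic variation \<open>V\<close> of a continuous square integrable martingale \<open>M\<close> is the continuous
  nondecreasing adapted process starting at \<open>0\<close> for which \<open>M\<^sup>2 - V\<close> is a martingale.\<close>

definition quadratic_variation ::
  "'a measure \<Rightarrow> (real \<Rightarrow> 'a measure) \<Rightarrow> real \<Rightarrow> (real \<Rightarrow> 'a \<Rightarrow> real) \<Rightarrow> (real \<Rightarrow> 'a \<Rightarrow> real) \<Rightarrow> bool"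
  where
  "quadratic_variation P F T M V \<longleftrightarrow>
     (\<forall>t\<in>{0..T}. V t \<in> borel_measurable (F t)) \<and>
     (AE \<omega> in P. V 0 \<omega> = 0) \<and>
     continuous_paths P T V \<and>
     (AE \<omega> in P. mono_on {0..T} (\<lambda>t. V t \<omega>)) \<and>
     martingale_on P F T (\<lambda>t \<omega>. (M t \<omega>)\<^sup>2 - V t \<omega>)"

definition path_on :: "real \<Rightarrow> (real \<Rightarrow> 'a \<Rightarrow> real) \<Rightarrow> 'a \<Rightarrow> real \<Rightarrow> real" where
  "path_on T X \<omega> = (\<lambda>t\<in>{0..T}. X t \<omega>)"

text \<open>\<open>X 1, \<dots>, X N\<close>, defined on \<open>Q\<close>, are independent continuous processes with the law of \<open>M\<close>.\<close>

definition independent_copies ::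
  "'a measure \<Rightarrow> real \<Rightarrow> (real \<Rightarrow> 'a \<Rightarrow> real) \<Rightarrow> nat \<Rightarrow> 'b measure \<Rightarrow> (nat \<Rightarrow> real \<Rightarrow> 'b \<Rightarrow> real) \<Rightarrow> bool"
  where
  "independent_copies P T M N Q X \<longleftrightarrow>
     prob_space.indep_vars Q (\<lambda>_. \<Pi>\<^sub>M t\<in>{0..T}. borel) (\<lambda>i. path_on T (X i)) {1..N} \<and>
     (\<forall>i\<in>{1..N}. continuous_paths Q T (X i) \<and>
        distr Q (\<Pi>\<^sub>M t\<in>{0..T}. borel) (path_on T (X i)) =
        distr P (\<Pi>\<^sub>M t\<in>{0..T}. borel) (path_on T M))"

section \<open>Stochastic integrals of deterministic integrands\<close>

definition step_partition :: "real \<Rightarrow> nat \<Rightarrow> (nat \<Rightarrow> real) \<Rightarrow> bool" where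
  "step_partition T n t \<longleftrightarrow> (\<forall>k\<le>n. t k \<in> {0..T}) \<and> (\<forall>k<n. t k \<le> t (Suc k))"

definition step_fun :: "nat \<Rightarrow> (nat \<Rightarrow> real) \<Rightarrow> (nat \<Rightarrow> real) \<Rightarrow> real \<Rightarrow> real" where
  "step_fun n t c s = (\<Sum>k<n. c k * indicator {t k<..t (Suc k)} s)"

definition step_integral ::
  "(real \<Rightarrow> 'a \<Rightarrow> real) \<Rightarrow> nat \<Rightarrow> (nat \<Rightarrow> real) \<Rightarrow> (nat \<Rightarrow> real) \<Rightarrow> 'a \<Rightarrow> real" where
  "step_integral X n t c \<omega> = (\<Sum>k<n. c k * (X (t (Suc k)) \<omega> - X (t k) \<omega>))"

text \<open>\<open>Y\<close> is a version of the Ito integral over \<open>[0,T]\<close> of the deterministic function \<open>f\<close> against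
  \<open>X\<close>, a martingale with deterministic quadratic variation \<open>A\<close>: it is an \<open>L\<^sup>2\<close>-limit of integrals of
  step functions that converge to \<open>f\<close> in \<open>L\<^sup>2([0,T], dA)\<close>.\<close>

definition has_ito_integral ::
  "'a measure \<Rightarrow> (real \<Rightarrow> 'a \<Rightarrow> real) \<Rightarrow> (real \<Rightarrow> real) \<Rightarrow> real \<Rightarrow> (real \<Rightarrow> real) \<Rightarrow> ('a \<Rightarrow> real) \<Rightarrow> bool"
  where
  "has_ito_integral Q X A T f Y \<longleftrightarrow>
     f \<in> borel_measurable (stieltjes A T) \<and> Y \<in> borel_measurable Q \<and>
     (\<exists>n t c.
        (\<forall>k. step_partition T (n k) (t k)) \<and>
        (\<lambda>k. sq_norm (stieltjes A T) (\<lambda>s. step_fun (n k) (t k) (c k) s - f s)) \<longlonglongrightarrow> 0 \<and>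
        (\<lambda>k. sq_norm Q (\<lambda>\<omega>. step_integral X (n k) (t k) (c k) \<omega> - Y \<omega>)) \<longlonglongrightarrow> 0)"

text \<open>For a single integrand the integral is determined up to a null event only. Least squares
  minimises an expression in these integrals over uncountably many integrands for each fixed outcome,
  and evaluates it at random integrands, so the null events must not depend on the integrand. We
  therefore fix versions that are linear in the integrand for every outcome. Such versions exist: choose
  them on a Hamel basis of the space of continuous functions and extend linearly. On the span of
  finitely many functions, any two such choices agree almost surely for all integrands simultaneously.\<close>

definition ito_integral ::
  "'a measure \<Rightarrow> (real \<Rightarrow> 'a \<Rightarrow> real) \<Rightarrow> (real \<Rightarrow> real) \<Rightarrow> real \<Rightarrow> (real \<Rightarrow> real) \<Rightarrow> 'a \<Rightarrow> real" where
  "ito_integral Q X A T = (SOME I.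
     (\<forall>f. continuous_on {0..T} f \<longrightarrow> has_ito_integral Q X A T f (I f)) \<and>
     (\<forall>f g a b \<omega>. continuous_on {0..T} f \<and> continuous_on {0..T} g \<longrightarrow>
        I (\<lambda>s. a * f s + b * g s) \<omega> = a * I f \<omega> + b * I g \<omega>))"

text \<open>The integral of \<open>f\<close> against the observed process \<open>Z\<^sub>t = \<integral>\<^sub>0\<^sup>t J0 dA + X\<^sub>t\<close>, whose martingale part is \<open>X\<close>.\<close>

definition obs_integral ::
  "'a measure \<Rightarrow> (real \<Rightarrow> 'a \<Rightarrow> real) \<Rightarrow> (real \<Rightarrow> real) \<Rightarrow> real \<Rightarrow> (real \<Rightarrow> real) \<Rightarrow> (real \<Rightarrow> real) \<Rightarrow> 'a \<Rightarrow> real"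
  where
  "obs_integral Q X A T J0 f \<omega> = (\<integral>s. f s * J0 s \<partial>stieltjes A T) + ito_integral Q X A T f \<omega>"

section \<open>Projection least squares and model selection\<close>

definition model :: "(nat \<Rightarrow> real \<Rightarrow> real) \<Rightarrow> nat \<Rightarrow> (real \<Rightarrow> real) set" where
  "model \<phi> m = {J. \<exists>\<theta>. J = (\<lambda>t. \<Sum>j=1..m. \<theta> j * \<phi> j t)}"

text \<open>The independent copies \<open>X i\<close> share the deterministic quadratic variation \<open>A\<close>.\<close>

definition contrast ::
  "'a measure \<Rightarrow> nat \<Rightarrow> (nat \<Rightarrow> real \<Rightarrow> 'a \<Rightarrow> real) \<Rightarrow> (real \<Rightarrow> real) \<Rightarrow> real \<Rightarrow> (real \<Rightarrow> real) \<Rightarrow>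
   (real \<Rightarrow> real) \<Rightarrow> 'a \<Rightarrow> real" where
  "contrast Q N X A T J0 J \<omega> =
     (1 / real N) *
     (\<Sum>i=1..N. (\<integral>s. (J s)\<^sup>2 \<partial>stieltjes A T) - 2 * obs_integral Q (X i) A T J0 J \<omega>)"

definition proj_estimator ::
  "'a measure \<Rightarrow> nat \<Rightarrow> (nat \<Rightarrow> real \<Rightarrow> 'a \<Rightarrow> real) \<Rightarrow> (real \<Rightarrow> real) \<Rightarrow> real \<Rightarrow> (real \<Rightarrow> real) \<Rightarrow>
   (nat \<Rightarrow> real \<Rightarrow> real) \<Rightarrow> nat \<Rightarrow> 'a \<Rightarrow> real \<Rightarrow> real" where
  "proj_estimator Q N X A T J0 \<phi> m \<omega> =
     arg_min (\<lambda>J. contrast Q N X A T J0 J \<omega>) (\<lambda>J. J \<in> model \<phi> m)"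

definition penalty :: "real \<Rightarrow> nat \<Rightarrow> nat \<Rightarrow> real" where
  "penalty ccal N m = ccal * (real m / real N)"

definition selected_dim ::
  "'a measure \<Rightarrow> nat \<Rightarrow> (nat \<Rightarrow> real \<Rightarrow> 'a \<Rightarrow> real) \<Rightarrow> (real \<Rightarrow> real) \<Rightarrow> real \<Rightarrow> (real \<Rightarrow> real) \<Rightarrow>
   (nat \<Rightarrow> real \<Rightarrow> real) \<Rightarrow> real \<Rightarrow> nat \<Rightarrow> 'a \<Rightarrow> nat" where
  "selected_dim Q N X A T J0 \<phi> ccal mN \<omega> =
     arg_min
       (\<lambda>m. contrast Q N X A T J0 (proj_estimator Q N X A T J0 \<phi> m \<omega>) \<omega> + penalty ccal N m)
       (\<lambda>m. m \<in> {1..mN})"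

definition adaptive_estimator ::
  "'a measure \<Rightarrow> nat \<Rightarrow> (nat \<Rightarrow> real \<Rightarrow> 'a \<Rightarrow> real) \<Rightarrow> (real \<Rightarrow> real) \<Rightarrow> real \<Rightarrow> (real \<Rightarrow> real) \<Rightarrow>
   (nat \<Rightarrow> real \<Rightarrow> real) \<Rightarrow> real \<Rightarrow> nat \<Rightarrow> 'a \<Rightarrow> real \<Rightarrow> real" where
  "adaptive_estimator Q N X A T J0 \<phi> ccal mN \<omega> =
     proj_estimator Q N X A T J0 \<phi> (selected_dim Q N X A T J0 \<phi> ccal mN \<omega>) \<omega>"

definition risk ::
  "'a measure \<Rightarrow> real measure \<Rightarrow> ('a \<Rightarrow> real \<Rightarrow> real) \<Rightarrow> (real \<Rightarrow> real) \<Rightarrow> ennreal" where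
  "risk Q R Jhat J0 = (\<integral>\<^sup>+ \<omega>. sq_norm R (\<lambda>t. Jhat \<omega> t - J0 t) \<partial>Q)"

definition weighted_model ::
  "real \<Rightarrow> (real \<Rightarrow> real) \<Rightarrow> (nat \<Rightarrow> real \<Rightarrow> real) \<Rightarrow> nat \<Rightarrow> (real \<Rightarrow> real) set" where
  "weighted_model T \<mu> \<phi> m =
     {\<iota> \<in> L2_fun (leb_on T). \<exists>\<psi>\<in>model \<phi> m. \<forall>t\<in>{0<..T}. \<iota> t = sqrt (\<mu> t) * \<psi> t}"

text \<open>\<open>\<mu>\<close> is continuous on \<open>(0,T]\<close> and may explode at \<open>0\<close>; \<open>\<nu>\<close> is the continuous extension of \<open>1/\<mu>\<close>
  to \<open>[0,T]\<close>.\<close>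

definition is_density ::
  "real \<Rightarrow> (real \<Rightarrow> real) \<Rightarrow> (real \<Rightarrow> real) \<Rightarrow> (real \<Rightarrow> real) \<Rightarrow> bool" where
  "is_density T A \<mu> \<nu> \<longleftrightarrow>
     continuous_on {0<..T} \<mu> \<and> (\<forall>t\<in>{0<..T}. 0 < \<mu> t) \<and>
     continuous_on {0..T} \<nu> \<and> (\<forall>t\<in>{0..T}. 0 \<le> \<nu> t) \<and> (\<forall>t\<in>{0<..T}. \<nu> t = 1 / \<mu> t) \<and>
     (\<forall>t\<in>{0..T}. set_integrable lborel {0<..t} \<mu> \<and> A t = (LINT s:{0<..t}|lborel. \<mu> s))"

end

theory Submission
  imports Defs "HOL-Library.Function_Algebras"
begin

text \<open>For fixed data the contrast of \<open>J\<close> is \<open>\<parallel>J\<parallel>\<^sup>2 - 2 \<langle>J, J0\<rangle> - 2 W J\<close>, with norm and product taken in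
  \<open>L\<^sup>2(dA)\<close> and \<open>W J\<close> the average of the stochastic integrals of \<open>J\<close> against the copies. In a basis
  \<open>e 1, e 2, \<dots>\<close> that is orthonormal in \<open>L\<^sup>2(dA)\<close> and adapted to the nested models, the coordinates of
  the least squares estimator are \<open>a j + w j\<close> with \<open>a j = \<langle>e j, J0\<rangle>\<close> and \<open>w j = W (e j)\<close>. Hence in
  dimension \<open>m\<close> its loss is a deterministic bias plus \<open>var m = \<Sum> (w j)\<^sup>2\<close>, and its contrast is, up to a
  constant, the same bias minus \<open>var m\<close> minus \<open>2 cross m\<close> with \<open>cross m = \<Sum> a j * w j\<close>. The expectation
  of \<open>var m\<close> is at most \<open>m/N\<close> and that of \<open>cross m\<close> is \<open>0\<close>. If both could be replaced by their
  expectations, contrast plus penalty would lie between bias plus \<open>(ccal - 1) * m/N\<close> and bias plus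
  \<open>ccal * m/N\<close>, up to a constant, and its minimiser would have a risk comparable to the best one.

  What remains is to show that the positive parts of the deviations of \<open>var m\<close> and \<open>cross m\<close> beyond a
  fraction of this excess have expectations summing to \<open>O(1/N)\<close> over all dimensions, with a constant
  that depends on \<open>ccal\<close> alone. This is a matter of exponential moments (\<open>nn_exp_W\<close>, \<open>nn_exp_sum_sq\<close>),
  and they are explicit because the noise is Gaussian: \<open>W f\<close> is normal with variance
  \<open>\<parallel>f\<parallel>\<^sup>2 / N\<close> (\<open>law_W\<close>). The comparison of the selected dimension with any other one is then elementary
  (\<open>oracle_pointwise\<close>, \<open>oracle_inequality\<close>).

  Gaussianity is Levy's theorem that a continuous martingale with deterministic quadratic variation
  has Gaussian increments. It is derived from a martingale central limit theorem along finer and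
  finer grids. The conditional variance of an increment is the deterministic increment of \<open>A\<close>
  (\<open>increment_sq\<close>), so the increments behave like independent ones as soon as Lindeberg's condition
  holds, and continuity of the paths gives that condition (\<open>Lindeberg_bound\<close>). The resulting
  characteristic function (\<open>char_incr_sum\<close>) determines the laws of all combinations of increments; it
  passes to the copies, which have the same path law, yields the isometry by which the stochastic
  integrals exist as limits (\<open>linear_ito_integral_exists\<close>), and passes to these limits.

  If \<open>A\<close> has the density \<open>\<mu>\<close>, multiplication by \<open>sqrt \<mu>\<close> maps \<open>L\<^sup>2(dA)\<close> isometrically into \<open>L\<^sup>2(dt)\<close> and the
  models onto the weighted models, so the bias is the distance to the weighted model
  (\<open>bias_le_weighted_projection\<close>), while the \<open>L\<^sup>2(dt)\<close> norm is at most \<open>sup (1/\<mu>)\<close> times the \<open>L\<^sup>2(dA)\<close> norm.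
  The second bound is therefore the same comparison with a larger constant.\<close>

section \<open>The Stieltjes measure of the quadratic variation\<close>

lemma space_stieltjes [simp]: "space (stieltjes A T) = {0..T}"
  by (simp add: stieltjes_def space_restrict_space)

lemma sets_stieltjes [measurable_cong]:
  "sets (stieltjes A T) = sets (restrict_space borel {0..T})"
  unfolding stieltjes_def by (intro sets_restrict_space_cong) simp

lemma continuous_on_imp_measurable_stieltjes:
  "continuous_on {0..T} (f :: real \<Rightarrow> real) \<Longrightarrow> f \<in> borel_measurable (stieltjes A T)"
  using borel_measurable_continuous_on_restrict[of "{0..T}" f]
  by (simp add: measurable_cong_sets[OF sets_stieltjes refl])

lemma borel_imp_measurable_stieltjes:
  "(f :: real \<Rightarrow> real) \<in> borel_measurable borel \<Longrightarrow> f \<in> borel_measurable (stieltjes A T)"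
  by (simp add: measurable_cong_sets[OF sets_stieltjes refl] measurable_restrict_space1)

locale stieltjes_clock =
  fixes A :: "real \<Rightarrow> real" and T :: real
  assumes T_pos: "0 < T"
    and A_cont: "continuous_on {0..T} A"
    and A_mono: "mono_on {0..T} A"
begin

abbreviation "S \<equiv> stieltjes A T"

text \<open>The extension of \<^term>\<open>A\<close> by constants to the whole line that the Stieltjes measure is built from.\<close>

definition "Aext t = A (max 0 (min T t))"

lemma Aext_mono: "x \<le> y \<Longrightarrow> Aext x \<le> Aext y"
  unfolding Aext_def using T_pos by (intro mono_onD[OF A_mono]) auto

lemma Aext_cont: "continuous_on UNIV Aext"
proof -
  have "continuous_on UNIV (A \<circ> (\<lambda>t. max 0 (min T t)))"
    using T_pos
    by (intro continuous_on_compose continuous_intros continuous_on_subset[OF A_cont]) auto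
  then show ?thesis by (simp add: o_def Aext_def[abs_def])
qed

lemma S_eq: "S = restrict_space (interval_measure Aext) {0..T}"
  by (simp add: stieltjes_def Aext_def[abs_def])

lemma emeasure_S_Ioc:
  assumes "0 \<le> a" "a \<le> b" "b \<le> T"
  shows "emeasure S {a<..b} = ennreal (A b - A a)"
proof -
  have "emeasure S {a<..b} = emeasure (interval_measure Aext) {a<..b}"
    unfolding S_eq using assms by (subst emeasure_restrict_space) auto
  also have "\<dots> = ennreal (Aext b - Aext a)"
    using Aext_cont assms
    by (intro emeasure_interval_measure_Ioc Aext_mono)
       (auto simp: continuous_on_eq_continuous_within intro: continuous_within_subset)
  finally show ?thesis using assms by (simp add: Aext_def max_def min_def)
qed

lemma emeasure_S_Icc: "emeasure S {0..T} = ennreal (A T - A 0)"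
proof -
  have "emeasure S {0..T} = emeasure (interval_measure Aext) {0..T}"
    unfolding S_eq by (subst emeasure_restrict_space) auto
  also have "\<dots> = ennreal (Aext T - Aext 0)"
    using T_pos by (intro emeasure_interval_measure_Icc Aext_mono Aext_cont) auto
  finally show ?thesis using T_pos by (simp add: Aext_def)
qed

lemma measure_S_Ioc:
  assumes "0 \<le> a" "a \<le> b" "b \<le> T"
  shows "measure S {a<..b} = A b - A a"
  using assms emeasure_S_Ioc[OF assms] mono_onD[OF A_mono, of a b]
  by (simp add: measure_def)

sublocale S: finite_measure S
  by (rule finite_measureI) (simp add: emeasure_S_Icc)

lemma Ioc_in_sets_S: "0 \<le> a \<Longrightarrow> b \<le> T \<Longrightarrow> {a<..b} \<in> sets S"
  unfolding sets_stieltjes by (subst sets_restrict_space_iff) auto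

lemma continuous_on_bounded:
  assumes "continuous_on {0..T} (f :: real \<Rightarrow> real)"
  obtains K where "\<And>t. t \<in> {0..T} \<Longrightarrow> \<bar>f t\<bar> \<le> K" "0 \<le> K"
proof -
  have "bounded (f ` {0..T})"
    by (intro compact_imp_bounded compact_continuous_image assms) auto
  then obtain K where K: "\<forall>t\<in>{0..T}. \<bar>f t\<bar> \<le> K"
    by (auto simp: bounded_iff simp del: atLeastAtMost_iff)
  moreover have "0 \<le> K" using bspec[OF K, of 0] T_pos by auto
  ultimately show ?thesis using that by blast
qed

lemma integrable_bounded_S:
  assumes "f \<in> borel_measurable S" "\<And>t. t \<in> {0..T} \<Longrightarrow> \<bar>f t\<bar> \<le> K"
  shows "integrable S (f :: real \<Rightarrow> real)"
  by (rule S.integrable_const_bound[of _ K]) (use assms in auto)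

lemma integrable_continuous_S:
  assumes "continuous_on {0..T} (f :: real \<Rightarrow> real)"
  shows "integrable S f"
  using continuous_on_bounded[OF assms] integrable_bounded_S continuous_on_imp_measurable_stieltjes[OF assms]
  by metis

end

section \<open>Square integrable functions\<close>

lemma sq_norm_eq_integral:
  "integrable R (\<lambda>x. (f x)\<^sup>2) \<Longrightarrow> sq_norm R f = ennreal (\<integral>x. (f x)\<^sup>2 \<partial>R)"
  unfolding sq_norm_def by (rule nn_integral_eq_integral) auto

lemma integrable_square_of_sq_norm:
  assumes "f \<in> borel_measurable R" "sq_norm R f < \<infinity>"
  shows "integrable R (\<lambda>x. (f x)\<^sup>2)"
  using assms unfolding sq_norm_def by (intro integrableI_nonneg) auto

lemma sq_norm_add_le:
  assumes [measurable]: "f \<in> borel_measurable R" "g \<in> borel_measurable R"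
  shows "sq_norm R (\<lambda>x. f x + g x) \<le> 2 * sq_norm R f + 2 * sq_norm R g"
proof -
  have "sq_norm R (\<lambda>x. f x + g x) \<le> (\<integral>\<^sup>+x. 2 * ennreal ((f x)\<^sup>2) + 2 * ennreal ((g x)\<^sup>2) \<partial>R)"
    unfolding sq_norm_def
  proof (rule nn_integral_mono)
    fix x
    have "(f x + g x)\<^sup>2 \<le> 2 * (f x)\<^sup>2 + 2 * (g x)\<^sup>2"
      using zero_le_power2[of "f x - g x"] by (simp add: power2_eq_square algebra_simps)
    then have "ennreal ((f x + g x)\<^sup>2) \<le> ennreal (2 * (f x)\<^sup>2 + 2 * (g x)\<^sup>2)"
      by (rule ennreal_leI)
    also have "\<dots> = 2 * ennreal ((f x)\<^sup>2) + 2 * ennreal ((g x)\<^sup>2)"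
      by (simp add: ennreal_mult)
    finally show "ennreal ((f x + g x)\<^sup>2) \<le> 2 * ennreal ((f x)\<^sup>2) + 2 * ennreal ((g x)\<^sup>2)" .
  qed
  also have "\<dots> = 2 * sq_norm R f + 2 * sq_norm R g"
    unfolding sq_norm_def by (subst nn_integral_add) (auto simp: nn_integral_cmult)
  finally show ?thesis .
qed

lemma sq_norm_cmult:
  assumes [measurable]: "f \<in> borel_measurable R"
  shows "sq_norm R (\<lambda>x. c * f x) = ennreal (c\<^sup>2) * sq_norm R f"
  unfolding sq_norm_def by (simp add: power_mult_distrib ennreal_mult nn_integral_cmult)

lemma sq_norm_minus_commute: "sq_norm R (\<lambda>x. f x - g x) = sq_norm R (\<lambda>x. g x - f x)"
  by (simp add: sq_norm_def power2_commute)

lemma integrable_mult_of_squares: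
  assumes "f \<in> borel_measurable R" "g \<in> borel_measurable R"
    and "integrable R (\<lambda>x. (f x)\<^sup>2)" "integrable R (\<lambda>x. (g x)\<^sup>2)"
  shows "integrable R (\<lambda>x. f x * g x :: real)"
proof (rule Bochner_Integration.integrable_bound)
  show "integrable R (\<lambda>x. (f x)\<^sup>2 + (g x)\<^sup>2)" using assms by simp
  show "AE x in R. norm (f x * g x) \<le> norm ((f x)\<^sup>2 + (g x)\<^sup>2)"
  proof (rule AE_I2)
    fix x
    have "0 \<le> (\<bar>f x\<bar> - \<bar>g x\<bar>)\<^sup>2" "0 \<le> \<bar>f x\<bar> * \<bar>g x\<bar>" by simp_all
    then have "\<bar>f x\<bar> * \<bar>g x\<bar> \<le> (f x)\<^sup>2 + (g x)\<^sup>2"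
      unfolding power2_diff power2_abs by linarith
    then show "norm (f x * g x) \<le> norm ((f x)\<^sup>2 + (g x)\<^sup>2)" by (simp add: abs_mult)
  qed
qed (use assms in simp)

text \<open>Completeness of \<open>L\<^sup>2\<close>: a subsequence converges almost everywhere, and Fatou's lemma bounds the
  distance to its limit.\<close>

lemma sq_norm_Cauchy_imp_converges:
  fixes Y :: "nat \<Rightarrow> 'a \<Rightarrow> real"
  assumes "finite_measure Q"
    and [measurable]: "\<And>n. Y n \<in> borel_measurable Q"
    and Cauchy: "\<And>e::real. 0 < e \<Longrightarrow> \<exists>n0. \<forall>n\<ge>n0. \<forall>m\<ge>n0. sq_norm Q (\<lambda>x. Y n x - Y m x) \<le> ennreal e"
  shows "\<exists>Z\<in>borel_measurable Q. (\<lambda>n. sq_norm Q (\<lambda>x. Y n x - Z x)) \<longlonglongrightarrow> 0"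
proof -
  interpret finite_measure Q by fact
  have "\<forall>k. \<exists>n0. \<forall>n\<ge>n0. \<forall>m\<ge>n0. sq_norm Q (\<lambda>x. Y n x - Y m x) \<le> ennreal ((1/4)^k)"
    using Cauchy by simp
  then obtain n0 where n0:
    "\<And>k n m. n \<ge> n0 k \<Longrightarrow> m \<ge> n0 k \<Longrightarrow> sq_norm Q (\<lambda>x. Y n x - Y m x) \<le> ennreal ((1/4)^k)"
    by metis
  define r where "r k = Max (n0 ` {..k})" for k
  have r: "n0 k \<le> r k" "r k \<le> r (Suc k)" for k
    unfolding r_def by (auto intro!: Max_ge Max_mono)
  define d where "d k x = \<bar>Y (r (Suc k)) x - Y (r k) x\<bar>" for k x
  have [measurable]: "d k \<in> borel_measurable Q" for k unfolding d_def[abs_def] by measurable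
  (* |d| <= 2^(-k) + 2^k d^2 turns the L2 bound 4^(-k) into an L1 bound of order 2^(-k) *)
  have d_bound: "(\<integral>\<^sup>+x. ennreal (d k x) \<partial>Q) \<le> ennreal ((measure Q (space Q) + 1) * (1/2)^k)" for k
  proof -
    have "(\<integral>\<^sup>+x. ennreal (d k x) \<partial>Q) \<le> (\<integral>\<^sup>+x. ennreal ((1/2)^k) + ennreal (2^k) * ennreal ((Y (r (Suc k)) x - Y (r k) x)\<^sup>2) \<partial>Q)"
    proof (rule nn_integral_mono)
      fix x
      define z where "z = d k x"
      define p :: real where "p = (1/2)^k"
      define q :: real where "q = 2^k"
      have pq: "p * q = 1" "p > 0" "q > 0" unfolding p_def q_def by (simp_all add: power_one_over)
      have z0: "0 \<le> z" by (simp add: z_def d_def)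
      have "0 \<le> q * (z - p)\<^sup>2" using pq by simp
      also have "q * (z - p)\<^sup>2 = q * z\<^sup>2 - 2 * (p * q) * z + (p * q) * p"
        by (simp add: power2_eq_square algebra_simps)
      finally have "z \<le> p + q * z\<^sup>2" using pq z0 by simp
      then have "ennreal z \<le> ennreal (p + q * z\<^sup>2)" by (rule ennreal_leI)
      also have "\<dots> = ennreal p + ennreal q * ennreal (z\<^sup>2)"
        using pq by (simp add: ennreal_mult)
      finally show "ennreal (d k x) \<le> ennreal ((1/2)^k) + ennreal (2^k) * ennreal ((Y (r (Suc k)) x - Y (r k) x)\<^sup>2)"
        by (simp add: z_def p_def q_def d_def)
    qed
    also have "\<dots> = ennreal ((1/2)^k) * emeasure Q (space Q) + ennreal (2^k) * sq_norm Q (\<lambda>x. Y (r (Suc k)) x - Y (r k) x)"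
      unfolding sq_norm_def by (subst nn_integral_add) (auto simp: nn_integral_cmult)
    also have "\<dots> \<le> ennreal ((1/2)^k) * emeasure Q (space Q) + ennreal (2^k) * ennreal ((1/4)^k)"
      by (intro add_left_mono mult_left_mono n0) (use r[of k] in auto)
    also have "\<dots> = ennreal ((measure Q (space Q) + 1) * (1/2)^k)"
    proof -
      have e: "(2::real)^k * (1/4)^k = (1/2)^k" by (simp flip: power_mult_distrib)
      have "ennreal ((1/2)^k) * emeasure Q (space Q) = ennreal ((1/2)^k * measure Q (space Q))"
        by (simp add: emeasure_eq_measure ennreal_mult)
      moreover have "ennreal (2^k) * ennreal ((1/4)^k) = ennreal ((1/2)^k)"
        by (subst ennreal_mult[symmetric]) (simp_all only: e, simp_all)
      ultimately show ?thesis
        by (simp add: ring_distribs mult.commute flip: ennreal_plus)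
    qed
    finally show ?thesis .
  qed
  have "(\<integral>\<^sup>+x. (\<Sum>k. ennreal (d k x)) \<partial>Q) = (\<Sum>k. \<integral>\<^sup>+x. ennreal (d k x) \<partial>Q)"
    by (rule nn_integral_suminf) simp
  also have "\<dots> \<le> (\<Sum>k. ennreal ((measure Q (space Q) + 1) * (1/2)^k))"
    by (intro suminf_le d_bound) auto
  also have "\<dots> = ennreal (\<Sum>k. (measure Q (space Q) + 1) * (1/2)^k)"
    by (intro suminf_ennreal2 summable_mult) (auto simp: summable_geometric)
  also have "\<dots> < \<infinity>" by simp
  finally have fin: "AE x in Q. (\<Sum>k. ennreal (d k x)) \<noteq> \<infinity>"
    by (intro nn_integral_noteq_infinite) auto
  define Z where "Z x = lim (\<lambda>k. Y (r k) x)" for x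
  have [measurable]: "Z \<in> borel_measurable Q" unfolding Z_def[abs_def] by measurable
  have conv: "AE x in Q. (\<lambda>k. Y (r k) x) \<longlonglongrightarrow> Z x"
    using fin
  proof eventually_elim
    fix x assume "(\<Sum>k. ennreal (d k x)) \<noteq> \<infinity>"
    then have "summable (\<lambda>k. d k x)"
      by (intro summable_suminf_not_top) (auto simp: d_def)
    then have "summable (\<lambda>k. Y (r (Suc k)) x - Y (r k) x)"
      unfolding d_def by (rule summable_rabs_cancel)
    then have "convergent (\<lambda>n. \<Sum>k<n. Y (r (Suc k)) x - Y (r k) x)"
      by (simp add: summable_iff_convergent)
    then have "convergent (\<lambda>n. Y (r n) x - Y (r 0) x)"
      by (simp only: sum_lessThan_telescope[of "\<lambda>k. Y (r k) x"])
    then have "convergent (\<lambda>n. (Y (r n) x - Y (r 0) x) + Y (r 0) x)"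
      by (intro convergent_add convergent_const)
    then show "(\<lambda>k. Y (r k) x) \<longlonglongrightarrow> Z x"
      unfolding Z_def by (simp add: convergent_LIMSEQ_iff)
  qed
  have close: "sq_norm Q (\<lambda>x. Y n x - Z x) \<le> ennreal ((1/4)^k)" if n: "n \<ge> n0 k" for n k
  proof -
    have "sq_norm Q (\<lambda>x. Y n x - Z x) = (\<integral>\<^sup>+x. liminf (\<lambda>l. ennreal ((Y n x - Y (r l) x)\<^sup>2)) \<partial>Q)"
      unfolding sq_norm_def
    proof (rule nn_integral_cong_AE, use conv in eventually_elim)
      fix x assume "(\<lambda>k. Y (r k) x) \<longlonglongrightarrow> Z x"
      then have "(\<lambda>l. ennreal ((Y n x - Y (r l) x)\<^sup>2)) \<longlonglongrightarrow> ennreal ((Y n x - Z x)\<^sup>2)"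
        by (intro tendsto_ennrealI tendsto_intros)
      then show "ennreal ((Y n x - Z x)\<^sup>2) = liminf (\<lambda>l. ennreal ((Y n x - Y (r l) x)\<^sup>2))"
        using lim_imp_Liminf sequentially_bot by metis
    qed
    also have "\<dots> \<le> liminf (\<lambda>l. sq_norm Q (\<lambda>x. Y n x - Y (r l) x))"
      unfolding sq_norm_def by (rule nn_integral_liminf) simp
    also have "\<dots> \<le> liminf (\<lambda>l. ennreal ((1/4)^k))"
    proof (rule Liminf_mono)
      show "\<forall>\<^sub>F l in sequentially. sq_norm Q (\<lambda>x. Y n x - Y (r l) x) \<le> ennreal ((1/4)^k)"
        using eventually_ge_at_top[of k]
      proof eventually_elim
        fix l assume "k \<le> l"
        have "n0 k \<le> r k" by (rule r)
        also have "r k \<le> r l" using r(2) \<open>k \<le> l\<close> by (rule lift_Suc_mono_le)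
        finally show "sq_norm Q (\<lambda>x. Y n x - Y (r l) x) \<le> ennreal ((1/4)^k)" using n by (intro n0)
      qed
    qed
    also have "\<dots> = ennreal ((1/4)^k)" by (simp add: Liminf_const)
    finally show ?thesis .
  qed
  have "(\<lambda>n. sq_norm Q (\<lambda>x. Y n x - Z x)) \<longlonglongrightarrow> 0"
  proof (rule order_tendstoI)
    fix a :: ennreal assume "0 < a"
    have "(\<lambda>k. ennreal ((1/4)^k)) \<longlonglongrightarrow> ennreal 0"
      by (intro tendsto_ennrealI LIMSEQ_realpow_zero) auto
    then have "\<forall>\<^sub>F k in sequentially. ennreal ((1/4)^k) < a"
      by (rule order_tendstoD) (use \<open>0 < a\<close> in simp)
    then obtain k where k: "ennreal ((1/4)^k) < a" by (meson eventually_happens trivial_limit_sequentially)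
    show "\<forall>\<^sub>F n in sequentially. sq_norm Q (\<lambda>x. Y n x - Z x) < a"
      using eventually_ge_at_top[of "n0 k"] by eventually_elim (use close k le_less_trans in blast)
  qed simp
  then show ?thesis by (intro bexI[of _ Z]) auto
qed

section \<open>Martingales with deterministic quadratic variation\<close>

lemma martingale_on_orthogonal:
  assumes "prob_space P" "martingale_on P F T X" "0 \<le> s" "s \<le> t" "t \<le> T"
    and U: "U \<in> borel_measurable (F s)" and int: "integrable P (\<lambda>\<omega>. U \<omega> * X t \<omega>)"
  shows "integrable P (\<lambda>\<omega>. U \<omega> * X s \<omega>)"
    and "(\<integral>\<omega>. U \<omega> * X t \<omega> \<partial>P) = (\<integral>\<omega>. U \<omega> * X s \<omega> \<partial>P)"
proof -
  interpret prob_space P by fact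
  have sub: "subalgebra P (F r)" if "r \<in> {0..T}" for r
    using assms that unfolding martingale_on_def filtration_on_def by auto
  have mX: "X r \<in> borel_measurable P" if "r \<in> {0..T}" for r
    using assms that sub[OF that] unfolding martingale_on_def by (auto intro: measurable_from_subalg)
  have mU: "U \<in> borel_measurable P"
    using assms by (intro measurable_from_subalg[OF sub U]) auto
  interpret finite_measure_subalgebra P "F s"
    using assms by unfold_locales (auto intro: sub)
  have mX': "X t \<in> borel_measurable P" "X s \<in> borel_measurable P" using mX assms by auto
  have AE: "AE \<omega> in P. U \<omega> * real_cond_exp P (F s) (X t) \<omega> = U \<omega> * X s \<omega>"
  proof -
    have "AE \<omega> in P. real_cond_exp P (F s) (X t) \<omega> = X s \<omega>"
      using assms(2-5) unfolding martingale_on_def by auto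
    then show ?thesis by eventually_elim simp
  qed
  have "integrable P (\<lambda>\<omega>. U \<omega> * real_cond_exp P (F s) (X t) \<omega>)"
    by (rule real_cond_exp_intg(1)[OF int U mX'(1)])
  then show "integrable P (\<lambda>\<omega>. U \<omega> * X s \<omega>)"
    by (rule integrable_cong_AE_imp) (use AE mU mX' in auto)
  have "(\<integral>\<omega>. U \<omega> * real_cond_exp P (F s) (X t) \<omega> \<partial>P) = (\<integral>\<omega>. U \<omega> * X t \<omega> \<partial>P)"
    by (rule real_cond_exp_intg(2)[OF int U mX'(1)])
  moreover have "(\<integral>\<omega>. U \<omega> * real_cond_exp P (F s) (X t) \<omega> \<partial>P) = (\<integral>\<omega>. U \<omega> * X s \<omega> \<partial>P)"
    by (rule integral_cong_AE) (use AE mU mX' in auto)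
  ultimately show "(\<integral>\<omega>. U \<omega> * X t \<omega> \<partial>P) = (\<integral>\<omega>. U \<omega> * X s \<omega> \<partial>P)" by simp
qed

definition grid :: "real \<Rightarrow> nat \<Rightarrow> nat \<Rightarrow> real" where
  "grid T n j = real j * T / real (Suc n)"

lemma grid_0 [simp]: "grid T n 0 = 0" by (simp add: grid_def)

lemma grid_last [simp]: "grid T n (Suc n) = T" by (simp add: grid_def)

lemma grid_mono: "0 < T \<Longrightarrow> i \<le> j \<Longrightarrow> grid T n i \<le> grid T n j"
  by (auto simp: grid_def intro!: divide_right_mono mult_right_mono)

lemma grid_in: "0 < T \<Longrightarrow> j \<le> Suc n \<Longrightarrow> grid T n j \<in> {0..T}"
  using grid_mono[of T 0 j n] grid_mono[of T j "Suc n" n] by auto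

text \<open>Uniform continuity in the form in which it is used: path by path for the martingale, and for
  integrands and the quadratic variation.\<close>

lemma grid_oscillation_small:
  assumes T: "0 < T" and "continuous_on {0..T} (f :: real \<Rightarrow> real)" "0 < \<delta>"
  shows "\<forall>\<^sub>F n in sequentially. \<forall>j\<le>n. \<forall>s\<in>{grid T n j..grid T n (Suc j)}. \<bar>f s - f (grid T n j)\<bar> < \<delta>"
proof -
  have "uniformly_continuous_on {0..T} f"
    by (rule compact_uniformly_continuous) (use assms in auto)
  then obtain d where d: "0 < d"
    "\<And>x y. x \<in> {0..T} \<Longrightarrow> y \<in> {0..T} \<Longrightarrow> dist y x < d \<Longrightarrow> dist (f y) (f x) < \<delta>"
    using \<open>0 < \<delta>\<close> unfolding uniformly_continuous_on_def by metis
  have "(\<lambda>n. T / real (Suc n)) \<longlonglongrightarrow> 0"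
    using LIMSEQ_Suc[OF lim_const_over_n[of T]] by simp
  then have "\<forall>\<^sub>F n in sequentially. T / real (Suc n) < d"
    using d(1) by (rule order_tendstoD)
  then show ?thesis
  proof eventually_elim
    fix n assume *: "T / real (Suc n) < d"
    show "\<forall>j\<le>n. \<forall>s\<in>{grid T n j..grid T n (Suc j)}. \<bar>f s - f (grid T n j)\<bar> < \<delta>"
    proof (intro allI impI ballI)
      fix j s assume "j \<le> n" and s: "s \<in> {grid T n j..grid T n (Suc j)}"
      have "grid T n (Suc j) - grid T n j = T / real (Suc n)"
        by (simp add: grid_def diff_divide_distrib[symmetric] algebra_simps)
      then have "dist s (grid T n j) < d" using * s by (simp add: dist_real_def)
      then show "\<bar>f s - f (grid T n j)\<bar> < \<delta>"
        using d(2)[of "grid T n j" s] grid_in[OF T, of j n] grid_in[OF T, of "Suc j" n] \<open>j \<le> n\<close> s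
        by (simp add: dist_real_def)
    qed
  qed
qed

lemma grid_increments_uniformly_small:
  assumes T: "0 < T" and "continuous_on {0..T} (f :: real \<Rightarrow> real)" "0 < \<delta>"
  shows "\<forall>\<^sub>F n in sequentially. \<forall>j\<le>n. \<bar>f (grid T n (Suc j)) - f (grid T n j)\<bar> < \<delta>"
  using grid_oscillation_small[OF assms]
  by eventually_elim (use grid_mono[OF T] in force)

text \<open>At most one index is the first at which the level is exceeded.\<close>

lemma sum_first_exceedance:
  fixes d :: "nat \<Rightarrow> real"
  shows "(\<Sum>j\<le>n. if \<delta> < \<bar>d j\<bar> \<and> (\<forall>i<j. \<bar>d i\<bar> \<le> \<delta>) then 1 else 0 :: real)
    = (if \<exists>j\<le>n. \<delta> < \<bar>d j\<bar> then 1 else 0)"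
proof (induction n)
  case (Suc n)
  have "(\<exists>j\<le>Suc n. \<delta> < \<bar>d j\<bar>) \<longleftrightarrow> (\<exists>j\<le>n. \<delta> < \<bar>d j\<bar>) \<or> \<delta> < \<bar>d (Suc n)\<bar>"
    by (auto simp: le_Suc_eq)
  moreover have "(\<forall>i<Suc n. \<bar>d i\<bar> \<le> \<delta>) \<longleftrightarrow> \<not> (\<exists>j\<le>n. \<delta> < \<bar>d j\<bar>)"
    by (auto simp: less_Suc_eq_le not_less)
  ultimately show ?case using Suc by auto
qed auto

locale det_qv_martingale = prob_space P
  for P :: "'a measure" +
  fixes F :: "real \<Rightarrow> 'a measure" and M :: "real \<Rightarrow> 'a \<Rightarrow> real" and T :: real and A :: "real \<Rightarrow> real"
  assumes T_positive: "0 < T"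
    and martingale: "cont_sq_int_martingale P F T M"
    and M_0: "AE \<omega> in P. M 0 \<omega> = 0"
    and qv: "quadratic_variation P F T M (\<lambda>t \<omega>. A t)"
begin

sublocale stieltjes_clock A T
proof
  show "continuous_on {0..T} A" "mono_on {0..T} A"
    using qv unfolding quadratic_variation_def continuous_paths_def by simp_all
qed (rule T_positive)

lemma A_0: "A 0 = 0"
  using qv unfolding quadratic_variation_def by simp

lemma A_le: "0 \<le> s \<Longrightarrow> s \<le> t \<Longrightarrow> t \<le> T \<Longrightarrow> A s \<le> A t"
  by (intro mono_onD[OF A_mono]) auto

lemma subalg: "t \<in> {0..T} \<Longrightarrow> subalgebra P (F t)"
  using martingale unfolding cont_sq_int_martingale_def martingale_on_def filtration_on_def by auto

lemma subalg_mono: "0 \<le> s \<Longrightarrow> s \<le> t \<Longrightarrow> t \<le> T \<Longrightarrow> subalgebra (F t) (F s)"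
  using martingale unfolding cont_sq_int_martingale_def martingale_on_def filtration_on_def by auto

lemma M_adapted: "t \<in> {0..T} \<Longrightarrow> M t \<in> borel_measurable (F t)"
  using martingale unfolding cont_sq_int_martingale_def martingale_on_def by auto

lemma M_adapted_le: "0 \<le> s \<Longrightarrow> s \<le> t \<Longrightarrow> t \<le> T \<Longrightarrow> M s \<in> borel_measurable (F t)"
  by (rule measurable_from_subalg[OF subalg_mono M_adapted]) auto

lemma M_measurable: "t \<in> {0..T} \<Longrightarrow> M t \<in> borel_measurable P"
  by (rule measurable_from_subalg[OF subalg M_adapted])

lemma M_sq_integrable: "t \<in> {0..T} \<Longrightarrow> integrable P (\<lambda>\<omega>. (M t \<omega>)\<^sup>2)"
  using martingale unfolding cont_sq_int_martingale_def by auto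

lemma M_martingale: "martingale_on P F T M"
  using martingale unfolding cont_sq_int_martingale_def by auto

lemma M_sq_martingale: "martingale_on P F T (\<lambda>t \<omega>. (M t \<omega>)\<^sup>2 - A t)"
  using qv unfolding quadratic_variation_def by auto

lemma M_continuous: "AE \<omega> in P. continuous_on {0..T} (\<lambda>t. M t \<omega>)"
  using martingale unfolding cont_sq_int_martingale_def continuous_paths_def by auto

lemma increment_orthogonal:
  assumes st: "0 \<le> s" "s \<le> t" "t \<le> T" and U: "U \<in> borel_measurable (F s)"
    and U2: "integrable P (\<lambda>\<omega>. (U \<omega>)\<^sup>2)"
  shows "integrable P (\<lambda>\<omega>. U \<omega> * (M t \<omega> - M s \<omega>))" "(\<integral>\<omega>. U \<omega> * (M t \<omega> - M s \<omega>) \<partial>P) = 0"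
proof -
  have mU: "U \<in> borel_measurable P" using st by (intro measurable_from_subalg[OF subalg U]) auto
  have i: "integrable P (\<lambda>\<omega>. U \<omega> * M t \<omega>)"
    using st by (intro integrable_mult_of_squares mU U2 M_measurable M_sq_integrable) auto
  note o = martingale_on_orthogonal[OF prob_space_axioms M_martingale st U i]
  show "integrable P (\<lambda>\<omega>. U \<omega> * (M t \<omega> - M s \<omega>))" "(\<integral>\<omega>. U \<omega> * (M t \<omega> - M s \<omega>) \<partial>P) = 0"
    using o i by (simp_all add: right_diff_distrib)
qed

lemma integrable_bounded_mult:
  assumes "U \<in> borel_measurable P" "\<And>\<omega>. \<bar>U \<omega>\<bar> \<le> (K::real)" "integrable P X"
  shows "integrable P (\<lambda>\<omega>. U \<omega> * X \<omega> :: real)"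
proof (rule Bochner_Integration.integrable_bound)
  show "integrable P (\<lambda>\<omega>. K * X \<omega>)" using assms by simp
  show "AE x in P. norm (U x * X x) \<le> norm (K * X x)"
  proof (rule AE_I2)
    fix x
    have "\<bar>U x\<bar> \<le> \<bar>K\<bar>" using assms(2)[of x] by linarith
    then show "norm (U x * X x) \<le> norm (K * X x)" by (simp add: abs_mult mult_right_mono)
  qed
qed (use assms in auto)

text \<open>The conditional variance of an increment is deterministic; everything about \<^term>\<open>M\<close> that
  matters for its law follows from this identity and the continuity of paths.\<close>

lemma increment_sq:
  assumes st: "0 \<le> s" "s \<le> t" "t \<le> T" and U: "U \<in> borel_measurable (F s)"
    and bdd: "\<And>\<omega>. \<bar>U \<omega>\<bar> \<le> (K::real)"
  shows "integrable P (\<lambda>\<omega>. U \<omega> * (M t \<omega> - M s \<omega>)\<^sup>2)"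
    and "(\<integral>\<omega>. U \<omega> * (M t \<omega> - M s \<omega>)\<^sup>2 \<partial>P) = (A t - A s) * (\<integral>\<omega>. U \<omega> \<partial>P)"
proof -
  have mU: "U \<in> borel_measurable P" using st by (intro measurable_from_subalg[OF subalg U]) auto
  have iU: "integrable P U" by (rule integrable_const_bound[of _ K]) (use bdd mU in auto)
  have iM: "integrable P (\<lambda>\<omega>. U \<omega> * ((M r \<omega>)\<^sup>2 - A r))" if "r \<in> {0..T}" for r
    using that by (intro integrable_bounded_mult[where K = K] mU bdd Bochner_Integration.integrable_diff M_sq_integrable) auto
  have i1: "integrable P (\<lambda>\<omega>. U \<omega> * ((M t \<omega>)\<^sup>2 - A t))" "integrable P (\<lambda>\<omega>. U \<omega> * ((M s \<omega>)\<^sup>2 - A s))"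
    using st by (intro iM; auto)+
  have e1: "(\<integral>\<omega>. U \<omega> * ((M t \<omega>)\<^sup>2 - A t) \<partial>P) = (\<integral>\<omega>. U \<omega> * ((M s \<omega>)\<^sup>2 - A s) \<partial>P)"
    by (rule martingale_on_orthogonal(2)[OF prob_space_axioms M_sq_martingale st U i1(1)])
  have "integrable P (\<lambda>\<omega>. (U \<omega> * M s \<omega>)\<^sup>2)"
  proof -
    have "\<bar>(U \<omega>)\<^sup>2\<bar> \<le> K\<^sup>2" for \<omega>
      using power_mono[OF bdd[of \<omega>], of 2] by simp
    then have "integrable P (\<lambda>\<omega>. (U \<omega>)\<^sup>2 * (M s \<omega>)\<^sup>2)"
      using st mU by (intro integrable_bounded_mult[where K = "K\<^sup>2"] M_sq_integrable) auto
    then show ?thesis by (simp add: power_mult_distrib)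
  qed
  moreover have "(\<lambda>\<omega>. U \<omega> * M s \<omega>) \<in> borel_measurable (F s)"
    using U M_adapted[of s] st by simp
  ultimately have o: "integrable P (\<lambda>\<omega>. U \<omega> * M s \<omega> * (M t \<omega> - M s \<omega>))"
      "(\<integral>\<omega>. U \<omega> * M s \<omega> * (M t \<omega> - M s \<omega>) \<partial>P) = 0"
    using increment_orthogonal[OF st, of "\<lambda>\<omega>. U \<omega> * M s \<omega>"] by auto
  have eq: "U \<omega> * (M t \<omega> - M s \<omega>)\<^sup>2 = U \<omega> * ((M t \<omega>)\<^sup>2 - A t) - U \<omega> * ((M s \<omega>)\<^sup>2 - A s)
      + (A t - A s) * U \<omega> - 2 * (U \<omega> * M s \<omega> * (M t \<omega> - M s \<omega>))" for \<omega>
    by (simp add: power2_eq_square algebra_simps)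
  show "integrable P (\<lambda>\<omega>. U \<omega> * (M t \<omega> - M s \<omega>)\<^sup>2)"
    unfolding eq using o i1 iU by (intro Bochner_Integration.integrable_add Bochner_Integration.integrable_diff integrable_mult_right)
  show "(\<integral>\<omega>. U \<omega> * (M t \<omega> - M s \<omega>)\<^sup>2 \<partial>P) = (A t - A s) * (\<integral>\<omega>. U \<omega> \<partial>P)"
    unfolding eq using o i1 iU e1
    by (simp add: Bochner_Integration.integral_add Bochner_Integration.integral_diff Bochner_Integration.integrable_add Bochner_Integration.integrable_diff)
qed

lemma M_sq_expectation: "t \<in> {0..T} \<Longrightarrow> (\<integral>\<omega>. (M t \<omega>)\<^sup>2 \<partial>P) = A t"
proof -
  assume t: "t \<in> {0..T}"
  have "(\<integral>\<omega>. 1 * (M t \<omega> - M 0 \<omega>)\<^sup>2 \<partial>P) = (A t - A 0) * (\<integral>\<omega>. 1 \<partial>P)"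
    using t by (intro increment_sq(2)[where K = 1]) auto
  moreover have "(\<integral>\<omega>. 1 * (M t \<omega> - M 0 \<omega>)\<^sup>2 \<partial>P) = (\<integral>\<omega>. (M t \<omega>)\<^sup>2 \<partial>P)"
    using M_0 M_measurable[OF t] M_measurable[of 0] T_pos
    by (intro integral_cong_AE) auto
  ultimately show ?thesis by (simp add: A_0 prob_space)
qed

text \<open>Values of \<^term>\<open>M\<close> squared at intermediate times are dominated on events of that time by the single
  integrable variable \<^term>\<open>M T\<close> squared; this replaces a maximal inequality.\<close>

lemma M_sq_submartingale:
  assumes st: "0 \<le> s" "s \<le> t" "t \<le> T" and U: "U \<in> borel_measurable (F s)"
    and bdd: "\<And>\<omega>. 0 \<le> U \<omega>" "\<And>\<omega>. U \<omega> \<le> (K::real)"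
  shows "(\<integral>\<omega>. U \<omega> * (M s \<omega>)\<^sup>2 \<partial>P) \<le> (\<integral>\<omega>. U \<omega> * (M t \<omega>)\<^sup>2 \<partial>P)"
proof -
  have mU: "U \<in> borel_measurable P" using st by (intro measurable_from_subalg[OF subalg U]) auto
  have bdd': "\<bar>U \<omega>\<bar> \<le> K" for \<omega> using bdd[of \<omega>] by simp
  have iU: "integrable P U" by (rule integrable_const_bound[of _ K]) (use bdd' mU in auto)
  have iM: "integrable P (\<lambda>\<omega>. U \<omega> * (M r \<omega>)\<^sup>2)" if "r \<in> {0..T}" for r
    using that by (intro integrable_bounded_mult[where K = K] mU bdd' M_sq_integrable) auto
  have i: "integrable P (\<lambda>\<omega>. U \<omega> * (M s \<omega>)\<^sup>2)" "integrable P (\<lambda>\<omega>. U \<omega> * (M t \<omega>)\<^sup>2)"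
    using st by (intro iM; auto)+
  have "integrable P (\<lambda>\<omega>. U \<omega> * ((M t \<omega>)\<^sup>2 - A t))" using i iU by (simp add: right_diff_distrib)
  from martingale_on_orthogonal(2)[OF prob_space_axioms M_sq_martingale st U this]
  have "(\<integral>\<omega>. U \<omega> * (M t \<omega>)\<^sup>2 \<partial>P) = (\<integral>\<omega>. U \<omega> * (M s \<omega>)\<^sup>2 \<partial>P) + (A t - A s) * (\<integral>\<omega>. U \<omega> \<partial>P)"
    using i iU by (simp add: right_diff_distrib left_diff_distrib mult.commute)
  moreover have "0 \<le> (A t - A s) * (\<integral>\<omega>. U \<omega> \<partial>P)"
    using A_le[OF st] bdd by (intro mult_nonneg_nonneg integral_nonneg) auto
  ultimately show ?thesis by simp
qed

abbreviation "gr \<equiv> grid T"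
definition "D n j \<omega> = M (gr n (Suc j)) \<omega> - M (gr n j) \<omega>"
definition "inc n j = A (gr n (Suc j)) - A (gr n j)"
abbreviation "big_sq \<delta> n j \<equiv> (\<integral>\<omega>. (if \<delta> < \<bar>D n j \<omega>\<bar> then (D n j \<omega>)\<^sup>2 else 0) \<partial>P)"
definition "jump \<delta> n = {\<omega> \<in> space P. \<exists>j\<le>n. \<delta> < \<bar>D n j \<omega>\<bar>}"

lemma gr_in: "j \<le> Suc n \<Longrightarrow> gr n j \<in> {0..T}" by (rule grid_in[OF T_pos])

lemma gr_order: "j \<le> n \<Longrightarrow> 0 \<le> gr n j \<and> gr n j \<le> gr n (Suc j) \<and> gr n (Suc j) \<le> T"
  using gr_in[of j n] gr_in[of "Suc j" n] grid_mono[OF T_pos, of j "Suc j" n] by auto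

lemma D_measurable: "j \<le> n \<Longrightarrow> D n j \<in> borel_measurable P"
  unfolding D_def[abs_def] by (intro borel_measurable_diff M_measurable gr_in) auto

lemma D_adapted: "i < j \<Longrightarrow> j \<le> Suc n \<Longrightarrow> D n i \<in> borel_measurable (F (gr n j))"
  unfolding D_def[abs_def] using gr_in[of j n] gr_in[of i n] gr_in[of "Suc i" n]
  by (intro borel_measurable_diff M_adapted_le) (auto intro!: grid_mono T_pos)

lemma jump_sets: "jump \<delta> n \<in> sets P"
proof -
  have "jump \<delta> n = (\<Union>j\<in>{..n}. {\<omega> \<in> space P. \<delta> < \<bar>D n j \<omega>\<bar>})"
    by (auto simp: jump_def)
  also have "\<dots> \<in> sets P"
  proof (rule sets.finite_UN)
    fix j assume "j \<in> {..n}"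
    then have [measurable]: "D n j \<in> borel_measurable P" by (intro D_measurable) simp
    show "{\<omega> \<in> space P. \<delta> < \<bar>D n j \<omega>\<bar>} \<in> sets P" by measurable
  qed simp
  finally show ?thesis .
qed

lemma inc_nonneg: "j \<le> n \<Longrightarrow> 0 \<le> inc n j"
  unfolding inc_def using gr_order A_le by simp

lemma sum_inc: "(\<Sum>j\<le>n. inc n j) = A T"
proof -
  have "(\<Sum>j<Suc n. A (gr n (Suc j)) - A (gr n j)) = A (gr n (Suc n)) - A (gr n 0)"
    by (rule sum_lessThan_telescope)
  then show ?thesis by (simp add: inc_def A_0 lessThan_Suc_atMost)
qed

lemma indicator_jump_tendsto:
  assumes "0 < \<delta>"
  shows "AE \<omega> in P. (\<lambda>n. indicator (jump \<delta> n) \<omega> :: real) \<longlonglongrightarrow> 0"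
  using M_continuous
proof eventually_elim
  fix \<omega> assume "continuous_on {0..T} (\<lambda>t. M t \<omega>)"
  from grid_increments_uniformly_small[OF T_pos this assms]
  have "\<forall>\<^sub>F n in sequentially. indicator (jump \<delta> n) \<omega> = (0::real)"
  proof eventually_elim
    fix n assume "\<forall>j\<le>n. \<bar>M (gr n (Suc j)) \<omega> - M (gr n j) \<omega>\<bar> < \<delta>"
    then have "\<omega> \<notin> jump \<delta> n" unfolding jump_def D_def by (auto simp: not_less intro: less_imp_le)
    then show "indicator (jump \<delta> n) \<omega> = (0::real)" by simp
  qed
  then show "(\<lambda>n. indicator (jump \<delta> n) \<omega> :: real) \<longlonglongrightarrow> 0"
    by (rule tendsto_eventually)
qed

lemma integral_jump_tendsto:
  assumes "0 < \<delta>" and X: "integrable P (X :: _ \<Rightarrow> real)"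
  shows "(\<lambda>n. \<integral>\<omega>. X \<omega> * indicator (jump \<delta> n) \<omega> \<partial>P) \<longlonglongrightarrow> 0"
proof -
  have "(\<lambda>n. \<integral>\<omega>. X \<omega> * indicator (jump \<delta> n) \<omega> \<partial>P) \<longlonglongrightarrow> (\<integral>\<omega>. 0 \<partial>P)"
  proof (rule integral_dominated_convergence[where w = "\<lambda>\<omega>. \<bar>X \<omega>\<bar>"])
    show "AE \<omega> in P. (\<lambda>n. X \<omega> * indicator (jump \<delta> n) \<omega>) \<longlonglongrightarrow> 0"
      using indicator_jump_tendsto[OF assms(1)]
      by eventually_elim (metis tendsto_mult_right_zero)
    show "AE x in P. norm (X x * indicat_real (jump \<delta> n) x) \<le> \<bar>X x\<bar>" for n
      by (auto simp: indicator_def)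
  qed (use X jump_sets in auto)
  then show ?thesis by simp
qed

text \<open>Each large increment is split according to an event that is known when the increment begins: either
  an earlier increment was large or \<^term>\<open>M\<close> exceeds \<^term>\<open>R\<close>, or neither. The first event is
  unlikely, and there the deterministic conditional variance gives its probability times the
  increment of \<^term>\<open>A\<close>. On the second event the increment is the first large one and starts from a bounded
  value, and the submartingale \<^term>\<open>M\<close> squared is dominated by its terminal value.\<close>

lemma Lindeberg_bound:
  assumes "0 < \<delta>" "0 < R"
  shows "(\<Sum>j\<le>n. big_sq \<delta> n j)
    \<le> (\<integral>\<omega>. (2 * (M T \<omega>)\<^sup>2 + 2 * R\<^sup>2 + A T) * indicator (jump \<delta> n) \<omega> \<partial>P) + (A T)\<^sup>2 / R\<^sup>2"
proof -
  (* u is 1 when neither a large increment nor a value above R precedes; e marks large increments *)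
  define u where "u j \<omega> = (if (\<forall>i<j. \<bar>D n i \<omega>\<bar> \<le> \<delta>) \<and> \<bar>M (gr n j) \<omega>\<bar> \<le> R then 1 else 0 :: real)" for j \<omega>
  define e where "e j \<omega> = (if \<delta> < \<bar>D n j \<omega>\<bar> then 1 else 0 :: real)" for j \<omega>
  have u01: "0 \<le> u j \<omega>" "u j \<omega> \<le> 1" "0 \<le> e j \<omega>" "e j \<omega> \<le> 1" for j \<omega> by (auto simp: u_def e_def)
  have u_adapted: "u j \<in> borel_measurable (F (gr n j))" if "j \<le> n" for j
  proof -
    have [measurable]: "M (gr n j) \<in> borel_measurable (F (gr n j))"
      using that by (intro M_adapted gr_in) auto
    have "Measurable.pred (F (gr n j)) (\<lambda>\<omega>. \<bar>D n i \<omega>\<bar> \<le> \<delta>)" if "i < j" for i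
    proof -
      have [measurable]: "D n i \<in> borel_measurable (F (gr n j))"
        using that \<open>j \<le> n\<close> by (intro D_adapted) auto
      show ?thesis by measurable
    qed
    then have "Measurable.pred (F (gr n j)) (\<lambda>\<omega>. \<forall>i\<in>{..<j}. \<bar>D n i \<omega>\<bar> \<le> \<delta>)"
      by (intro pred_intros_finite) auto
    then have all: "Measurable.pred (F (gr n j)) (\<lambda>\<omega>. \<forall>i<j. \<bar>D n i \<omega>\<bar> \<le> \<delta>)"
      by (simp only: Ball_def lessThan_iff)
    have "(\<lambda>\<omega>. if p \<omega> \<and> \<bar>M (gr n j) \<omega>\<bar> \<le> R then 1 else 0 :: real) \<in> borel_measurable (F (gr n j))"
      if [measurable]: "Measurable.pred (F (gr n j)) p" for p
      by measurable
    from this[OF all] show ?thesis unfolding u_def[abs_def] .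
  qed
  have u_meas: "u j \<in> borel_measurable P" if "j \<le> n" for j
    using that by (intro measurable_from_subalg[OF subalg u_adapted] gr_in) auto
  have e_meas: "e j \<in> borel_measurable P" if "j \<le> n" for j
    using D_measurable[OF that] unfolding e_def[abs_def] by measurable
  have ue_adapted: "(\<lambda>\<omega>. u j \<omega> * e j \<omega>) \<in> borel_measurable (F (gr n (Suc j)))" if "j \<le> n" for j
  proof -
    have [measurable]: "D n j \<in> borel_measurable (F (gr n (Suc j)))"
      using that by (intro D_adapted) auto
    have [measurable]: "u j \<in> borel_measurable (F (gr n (Suc j)))"
      using gr_order[OF that] by (intro measurable_from_subalg[OF subalg_mono u_adapted] that) auto
    show ?thesis unfolding e_def[abs_def] by measurable
  qed
  define p where "p = measure P (jump \<delta> n)"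
  have indep: "(\<integral>\<omega>. (1 - u j \<omega>) \<partial>P) \<le> p + A T / R\<^sup>2" if j: "j \<le> n" for j
  proof -
    have "(\<integral>\<omega>. (1 - u j \<omega>) \<partial>P) \<le> (\<integral>\<omega>. indicator (jump \<delta> n) \<omega> + (M (gr n j) \<omega>)\<^sup>2 / R\<^sup>2 \<partial>P)"
    proof (rule integral_mono)
      show "integrable P (\<lambda>\<omega>. 1 - u j \<omega>)"
        by (rule integrable_const_bound[of _ 1]) (use u_meas[OF j] u01 in auto)
      show "integrable P (\<lambda>\<omega>. indicator (jump \<delta> n) \<omega> + (M (gr n j) \<omega>)\<^sup>2 / R\<^sup>2)"
        using jump_sets M_sq_integrable[OF gr_in[of j n]] j by (auto simp: emeasure_eq_measure)
      fix \<omega> assume "\<omega> \<in> space P"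
      show "1 - u j \<omega> \<le> indicator (jump \<delta> n) \<omega> + (M (gr n j) \<omega>)\<^sup>2 / R\<^sup>2"
      proof (cases "\<bar>M (gr n j) \<omega>\<bar> \<le> R")
        case True
        show ?thesis
        proof (cases "\<exists>i<j. \<delta> < \<bar>D n i \<omega>\<bar>")
          case True
          then have "\<omega> \<in> jump \<delta> n"
            using \<open>\<omega> \<in> space P\<close> j unfolding jump_def by (auto intro: order.trans[OF less_imp_le])
          then show ?thesis using u01[of j \<omega>] by (simp add: add_increasing2)
        next
          case False
          then have "u j \<omega> = 1" using True by (auto simp: u_def not_less)
          then show ?thesis by simp
        qed
      next
        case False
        then have "R\<^sup>2 \<le> \<bar>M (gr n j) \<omega>\<bar>\<^sup>2" using \<open>0 < R\<close> by (intro power_mono) auto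
        then have "1 \<le> (M (gr n j) \<omega>)\<^sup>2 / R\<^sup>2" using \<open>0 < R\<close> by simp
        then show ?thesis using u01[of j \<omega>] by (simp add: indicator_def)
      qed
    qed
    also have "\<dots> = p + A (gr n j) / R\<^sup>2"
      using jump_sets M_sq_integrable[OF gr_in[of j n]] M_sq_expectation[OF gr_in[of j n]] j
      by (subst Bochner_Integration.integral_add) (auto simp: emeasure_eq_measure p_def)
    also have "\<dots> \<le> p + A T / R\<^sup>2"
      using gr_in[of j n] j T_pos A_le[of "gr n j" T] by (intro add_left_mono divide_right_mono) auto
    finally show ?thesis .
  qed
  have summand_le: "big_sq \<delta> n j
      \<le> (\<integral>\<omega>. (u j \<omega> * e j \<omega>) * (2 * (M T \<omega>)\<^sup>2 + 2 * R\<^sup>2) \<partial>P) + inc n j * (p + A T / R\<^sup>2)" if j: "j \<le> n" for j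
  proof -
    note o = gr_order[OF j]
    have ub: "\<bar>1 - u j \<omega>\<bar> \<le> 1" for \<omega> using u01[of j \<omega>] by auto
    have um: "(\<lambda>\<omega>. 1 - u j \<omega>) \<in> borel_measurable (F (gr n j))" using u_adapted[OF j] by simp
    have sq: "integrable P (\<lambda>\<omega>. (1 - u j \<omega>) * (D n j \<omega>)\<^sup>2)"
        "(\<integral>\<omega>. (1 - u j \<omega>) * (D n j \<omega>)\<^sup>2 \<partial>P) = inc n j * (\<integral>\<omega>. 1 - u j \<omega> \<partial>P)"
      unfolding D_def inc_def using increment_sq[OF _ _ _ um ub] o by auto
    have ueb: "0 \<le> u j \<omega> * e j \<omega>" "u j \<omega> * e j \<omega> \<le> 1" "\<bar>u j \<omega> * e j \<omega>\<bar> \<le> 1" for \<omega>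
      using u01[of j \<omega>] by (auto simp: u_def e_def)
    have uem: "(\<lambda>\<omega>. u j \<omega> * e j \<omega>) \<in> borel_measurable P" using u_meas[OF j] e_meas[OF j] by simp
    have i: "integrable P (\<lambda>\<omega>. (u j \<omega> * e j \<omega>) * (2 * (M t \<omega>)\<^sup>2 + 2 * R\<^sup>2))" if "t \<in> {0..T}" for t
      using M_sq_integrable[OF that] by (intro integrable_bounded_mult[where K = 1] uem ueb) auto
    have i': "integrable P (\<lambda>\<omega>. (u j \<omega> * e j \<omega>) * (M t \<omega>)\<^sup>2)" if "t \<in> {0..T}" for t
      using M_sq_integrable[OF that] by (intro integrable_bounded_mult[where K = 1] uem ueb) auto
    have iue: "integrable P (\<lambda>\<omega>. u j \<omega> * e j \<omega>)"
      by (rule integrable_const_bound[of _ 1]) (use ueb uem in auto)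
    have in1: "gr n (Suc j) \<in> {0..T}" "T \<in> {0..T}" using o T_pos by auto
    have "big_sq \<delta> n j
        \<le> (\<integral>\<omega>. (u j \<omega> * e j \<omega>) * (2 * (M (gr n (Suc j)) \<omega>)\<^sup>2 + 2 * R\<^sup>2) + (1 - u j \<omega>) * (D n j \<omega>)\<^sup>2 \<partial>P)"
    proof (rule integral_mono')
      show "integrable P (\<lambda>\<omega>. (u j \<omega> * e j \<omega>) * (2 * (M (gr n (Suc j)) \<omega>)\<^sup>2 + 2 * R\<^sup>2) + (1 - u j \<omega>) * (D n j \<omega>)\<^sup>2)"
        using i in1 sq by (intro Bochner_Integration.integrable_add) auto
      fix \<omega>
      show "(if \<delta> < \<bar>D n j \<omega>\<bar> then (D n j \<omega>)\<^sup>2 else 0) \<le> (u j \<omega> * e j \<omega>) * (2 * (M (gr n (Suc j)) \<omega>)\<^sup>2 + 2 * R\<^sup>2) + (1 - u j \<omega>) * (D n j \<omega>)\<^sup>2"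
      proof (cases "u j \<omega> = 1 \<and> e j \<omega> = 1")
        case True
        then have "\<bar>M (gr n j) \<omega>\<bar> \<le> R" by (auto simp: u_def split: if_splits)
        then have R: "(M (gr n j) \<omega>)\<^sup>2 \<le> R\<^sup>2" by (simp add: abs_le_square_iff[symmetric])
        have "(D n j \<omega>)\<^sup>2 \<le> 2 * (M (gr n (Suc j)) \<omega>)\<^sup>2 + 2 * (M (gr n j) \<omega>)\<^sup>2"
          unfolding D_def using zero_le_power2[of "M (gr n (Suc j)) \<omega> + M (gr n j) \<omega>"]
          by (simp add: power2_eq_square algebra_simps)
        then show ?thesis using True R by auto
      next
        case False
        then show ?thesis by (auto simp: u_def e_def)
      qed
      show "0 \<le> (u j \<omega> * e j \<omega>) * (2 * (M (gr n (Suc j)) \<omega>)\<^sup>2 + 2 * R\<^sup>2) + (1 - u j \<omega>) * (D n j \<omega>)\<^sup>2"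
        using u01[of j \<omega>] ueb[of \<omega>] by (intro add_nonneg_nonneg mult_nonneg_nonneg) auto
    qed
    also have "\<dots> = (\<integral>\<omega>. (u j \<omega> * e j \<omega>) * (2 * (M (gr n (Suc j)) \<omega>)\<^sup>2 + 2 * R\<^sup>2) \<partial>P) + inc n j * (\<integral>\<omega>. 1 - u j \<omega> \<partial>P)"
      using i in1 sq by (subst Bochner_Integration.integral_add) auto
    also have "(\<integral>\<omega>. (u j \<omega> * e j \<omega>) * (2 * (M (gr n (Suc j)) \<omega>)\<^sup>2 + 2 * R\<^sup>2) \<partial>P)
        = 2 * (\<integral>\<omega>. (u j \<omega> * e j \<omega>) * (M (gr n (Suc j)) \<omega>)\<^sup>2 \<partial>P) + 2 * R\<^sup>2 * (\<integral>\<omega>. u j \<omega> * e j \<omega> \<partial>P)"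
      using i'[OF in1(1)] iue by (simp add: distrib_left mult.left_commute[of _ 2] mult.commute)
    also have "\<dots> \<le> 2 * (\<integral>\<omega>. (u j \<omega> * e j \<omega>) * (M T \<omega>)\<^sup>2 \<partial>P) + 2 * R\<^sup>2 * (\<integral>\<omega>. u j \<omega> * e j \<omega> \<partial>P)"
      using o by (intro add_right_mono mult_left_mono M_sq_submartingale[where K = 1] ue_adapted[OF j] ueb) auto
    also have "\<dots> = (\<integral>\<omega>. (u j \<omega> * e j \<omega>) * (2 * (M T \<omega>)\<^sup>2 + 2 * R\<^sup>2) \<partial>P)"
      using i'[OF in1(2)] iue by (simp add: distrib_left mult.left_commute[of _ 2] mult.commute)
    finally show ?thesis
      using mult_left_mono[OF indep[OF j] inc_nonneg[OF j]] by simp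
  qed
  have "(\<Sum>j\<le>n. big_sq \<delta> n j)
      \<le> (\<Sum>j\<le>n. (\<integral>\<omega>. (u j \<omega> * e j \<omega>) * (2 * (M T \<omega>)\<^sup>2 + 2 * R\<^sup>2) \<partial>P) + inc n j * (p + A T / R\<^sup>2))"
    by (intro sum_mono summand_le) auto
  also have "\<dots> = (\<Sum>j\<le>n. (\<integral>\<omega>. (u j \<omega> * e j \<omega>) * (2 * (M T \<omega>)\<^sup>2 + 2 * R\<^sup>2) \<partial>P)) + A T * (p + A T / R\<^sup>2)"
    by (simp add: sum.distrib sum_distrib_right[symmetric] sum_inc)
  also have "(\<Sum>j\<le>n. (\<integral>\<omega>. (u j \<omega> * e j \<omega>) * (2 * (M T \<omega>)\<^sup>2 + 2 * R\<^sup>2) \<partial>P))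
      = (\<integral>\<omega>. (\<Sum>j\<le>n. (u j \<omega> * e j \<omega>) * (2 * (M T \<omega>)\<^sup>2 + 2 * R\<^sup>2)) \<partial>P)"
  proof (rule Bochner_Integration.integral_sum[symmetric])
    fix j assume "j \<in> {..n}"
    then have m: "(\<lambda>\<omega>. u j \<omega> * e j \<omega>) \<in> borel_measurable P"
      using u_meas[of j] e_meas[of j] by simp
    have b: "\<bar>u j \<omega> * e j \<omega>\<bar> \<le> 1" for \<omega> by (simp add: u_def e_def)
    show "integrable P (\<lambda>\<omega>. (u j \<omega> * e j \<omega>) * (2 * (M T \<omega>)\<^sup>2 + 2 * R\<^sup>2))"
      using M_sq_integrable[of T] T_pos by (intro integrable_bounded_mult[where K = 1] m b) auto
  qed
  also have "\<dots> \<le> (\<integral>\<omega>. (2 * (M T \<omega>)\<^sup>2 + 2 * R\<^sup>2) * indicator (jump \<delta> n) \<omega> \<partial>P)"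
  proof (rule integral_mono')
    show "integrable P (\<lambda>\<omega>. (2 * (M T \<omega>)\<^sup>2 + 2 * R\<^sup>2) * indicator (jump \<delta> n) \<omega>)"
      using M_sq_integrable[of T] T_pos jump_sets by (intro integrable_real_mult_indicator) auto
    fix \<omega> assume \<omega>: "\<omega> \<in> space P"
    have "(\<Sum>j\<le>n. u j \<omega> * e j \<omega>) \<le> (\<Sum>j\<le>n. if \<delta> < \<bar>D n j \<omega>\<bar> \<and> (\<forall>i<j. \<bar>D n i \<omega>\<bar> \<le> \<delta>) then 1 else 0)"
      by (intro sum_mono) (auto simp: u_def e_def)
    also have "\<dots> = indicator (jump \<delta> n) \<omega>"
      unfolding sum_first_exceedance using \<omega> by (auto simp: jump_def indicator_def)
    finally have "(\<Sum>j\<le>n. u j \<omega> * e j \<omega>) * (2 * (M T \<omega>)\<^sup>2 + 2 * R\<^sup>2) \<le> indicator (jump \<delta> n) \<omega> * (2 * (M T \<omega>)\<^sup>2 + 2 * R\<^sup>2)"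
      by (rule mult_right_mono) simp
    then show "(\<Sum>j\<le>n. (u j \<omega> * e j \<omega>) * (2 * (M T \<omega>)\<^sup>2 + 2 * R\<^sup>2)) \<le> (2 * (M T \<omega>)\<^sup>2 + 2 * R\<^sup>2) * indicator (jump \<delta> n) \<omega>"
      by (simp only: sum_distrib_right mult.commute)
  qed simp
  also have "\<dots> + A T * (p + A T / R\<^sup>2) = (\<integral>\<omega>. (2 * (M T \<omega>)\<^sup>2 + 2 * R\<^sup>2 + A T) * indicator (jump \<delta> n) \<omega> \<partial>P) + (A T)\<^sup>2 / R\<^sup>2"
  proof -
    have "integrable P (\<lambda>\<omega>. (2 * (M T \<omega>)\<^sup>2 + 2 * R\<^sup>2) * indicator (jump \<delta> n) \<omega>)"
      using M_sq_integrable[of T] T_pos jump_sets by (intro integrable_real_mult_indicator) auto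
    then show ?thesis using jump_sets
      by (simp add: distrib_right[of _ "A T"] emeasure_eq_measure p_def power2_eq_square distrib_left)
  qed
  finally show ?thesis by simp
qed

lemma Lindeberg_condition:
  assumes \<delta>: "0 < \<delta>"
  shows "(\<lambda>n. \<Sum>j\<le>n. big_sq \<delta> n j) \<longlonglongrightarrow> 0"
proof (rule order_tendstoI)
  fix a :: real assume "0 < a"
  (* R makes (A T)^2 / R^2 smaller than a / 2; adding 1 keeps R positive when A T = 0 *)
  define R where "R = sqrt (2 * ((A T)\<^sup>2 + 1) / a)"
  have R2: "R\<^sup>2 = 2 * ((A T)\<^sup>2 + 1) / a" "0 < R" using \<open>0 < a\<close> unfolding R_def by (auto simp: real_sqrt_pow2 add_nonneg_pos)
  have small: "(A T)\<^sup>2 / R\<^sup>2 < a / 2"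
    unfolding R2(1) using \<open>0 < a\<close> by (simp add: field_simps add_pos_nonneg)
  have "integrable P (\<lambda>\<omega>. 2 * (M T \<omega>)\<^sup>2 + 2 * R\<^sup>2 + A T)"
    using M_sq_integrable[of T] T_pos by auto
  from integral_jump_tendsto[OF \<delta> this]
  have "\<forall>\<^sub>F n in sequentially. (\<integral>\<omega>. (2 * (M T \<omega>)\<^sup>2 + 2 * R\<^sup>2 + A T) * indicator (jump \<delta> n) \<omega> \<partial>P) < a / 2"
    by (rule order_tendstoD) (use \<open>0 < a\<close> in simp)
  then show "\<forall>\<^sub>F n in sequentially. (\<Sum>j\<le>n. big_sq \<delta> n j) < a"
    by eventually_elim (use Lindeberg_bound[OF \<delta> R2(2)] small in \<open>smt (verit) field_sum_of_halves\<close>)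
next
  fix a :: real assume "a < 0"
  then show "\<forall>\<^sub>F n in sequentially. a < (\<Sum>j\<le>n. big_sq \<delta> n j)"
    by (intro always_eventually allI less_le_trans[OF _ sum_nonneg] integral_nonneg) auto
qed

end

section \<open>Increments of the martingale are jointly Gaussian\<close>

lemma exp_minus_quadratic_bound:
  fixes x :: real
  assumes "0 \<le> x"
  shows "\<bar>(1 - x) - exp (- x)\<bar> \<le> x\<^sup>2 / 2"
proof -
  have q: "1 + x + x\<^sup>2 / 2 \<le> exp x" by (rule exp_lower_Taylor_quadratic[OF assms])
  have "(1 - x + x\<^sup>2/2) * (1 + x + x\<^sup>2/2) = 1 + x^4/4"
    by (simp add: power2_eq_square power4_eq_xxxx field_simps)
  then have *: "1 \<le> (1 - x + x\<^sup>2/2) * (1 + x + x\<^sup>2/2)" by simp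
  have pos: "0 < 1 + x + x\<^sup>2/2" using assms by (intro add_pos_nonneg) auto
  have "exp (- x) = 1 / exp x" by (simp add: exp_minus field_simps)
  also have "\<dots> \<le> 1 / (1 + x + x\<^sup>2/2)" using q pos by (intro divide_left_mono) auto
  also have "\<dots> \<le> 1 - x + x\<^sup>2/2" using * pos by (simp add: divide_le_eq)
  finally have "exp (- x) \<le> 1 - x + x\<^sup>2/2" .
  moreover have "1 - x \<le> exp (- x)" using exp_ge_add_one_self[of "- x"] by simp
  ultimately show ?thesis by simp
qed

text \<open>Combinations of increments of a path and the corresponding step functions. The intervals may
  overlap and the index set is arbitrary, so that a difference of two such combinations is again one
  and common refinements of partitions are never formed.\<close>

definition incr_sum :: "'k set \<Rightarrow> ('k \<Rightarrow> real) \<Rightarrow> ('k \<Rightarrow> real) \<Rightarrow> ('k \<Rightarrow> real) \<Rightarrow> (real \<Rightarrow> real) \<Rightarrow> real" where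
  "incr_sum K c a b x = (\<Sum>k\<in>K. c k * (x (b k) - x (a k)))"

definition incr_fun :: "'k set \<Rightarrow> ('k \<Rightarrow> real) \<Rightarrow> ('k \<Rightarrow> real) \<Rightarrow> ('k \<Rightarrow> real) \<Rightarrow> real \<Rightarrow> real" where
  "incr_fun K c a b s = (\<Sum>k\<in>K. c k * indicator {a k<..b k} s)"

text \<open>The step function at \<open>s\<close> is the combination of increments of the path that jumps from \<open>0\<close> to \<open>1\<close> at \<open>s\<close>,
  so identities for increments hold for step functions too.\<close>

lemma incr_fun_eq_incr_sum:
  assumes "\<And>k. k \<in> K \<Longrightarrow> a k \<le> b k"
  shows "incr_fun K c a b s = incr_sum K c a b (\<lambda>t. of_bool (s \<le> t))"
  unfolding incr_fun_def incr_sum_def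
  by (intro sum.cong refl arg_cong2[where f = "(*)"]) (auto simp: indicator_def dest: assms)

lemma abs_incr_fun_le: "\<bar>incr_fun K c a b s\<bar> \<le> (\<Sum>k\<in>K. \<bar>c k\<bar>)"
  unfolding incr_fun_def
  by (rule order.trans[OF sum_abs]) (auto intro!: sum_mono simp: abs_mult indicator_def)

lemma incr_fun_measurable [measurable]: "incr_fun K c a b \<in> borel_measurable borel"
  unfolding incr_fun_def[abs_def] by measurable

text \<open>Times are rounded up to the grid: with left-open intervals the rounded step functions then
  converge everywhere, end points included.\<close>

definition idx :: "real \<Rightarrow> nat \<Rightarrow> real \<Rightarrow> nat" where
  "idx T n t = nat \<lceil>t * real (Suc n) / T\<rceil>"

context
  fixes T :: real
  assumes T: "0 < T"
begin

lemma idx_mono: "s \<le> t \<Longrightarrow> idx T n s \<le> idx T n t"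
  unfolding idx_def using T by (intro nat_mono ceiling_mono divide_right_mono mult_right_mono) auto

lemma idx_le: "t \<le> T \<Longrightarrow> idx T n t \<le> Suc n"
proof -
  assume "t \<le> T"
  have "T * real (Suc n) / T = real (Suc n)" using T by simp
  then have "idx T n T = Suc n" unfolding idx_def by (simp only: ceiling_of_nat nat_int)
  then show ?thesis using idx_mono[OF \<open>t \<le> T\<close>, of n] by simp
qed

lemma grid_idx_ge: "t \<le> grid T n (idx T n t)"
proof -
  have "t * real (Suc n) / T \<le> real (idx T n t)" unfolding idx_def by (rule real_nat_ceiling_ge)
  then have "t * real (Suc n) \<le> real (idx T n t) * T" using T by (simp add: divide_le_eq)
  then show ?thesis unfolding grid_def by (simp add: le_divide_eq)
qed

lemma grid_idx_le: "0 \<le> t \<Longrightarrow> grid T n (idx T n t) \<le> t + T / real (Suc n)"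
proof -
  assume "0 \<le> t"
  have "0 \<le> t * real (Suc n) / T" using T \<open>0 \<le> t\<close> by simp
  then have "real (idx T n t) = of_int \<lceil>t * real (Suc n) / T\<rceil>" unfolding idx_def by simp
  also have "\<dots> \<le> t * real (Suc n) / T + 1" by linarith
  finally have "real (idx T n t) * T \<le> t * real (Suc n) + T"
    using T by (simp add: field_simps)
  then have "grid T n (idx T n t) \<le> (t * real (Suc n) + T) / real (Suc n)"
    unfolding grid_def by (intro divide_right_mono) auto
  then show ?thesis by (simp add: add_divide_distrib)
qed

lemma grid_idx_tendsto: "0 \<le> t \<Longrightarrow> (\<lambda>n. grid T n (idx T n t)) \<longlonglongrightarrow> t"
proof (rule tendsto_sandwich[where f = "\<lambda>_. t" and h = "\<lambda>n. t + T / real (Suc n)"])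
  assume "0 \<le> t"
  have "(\<lambda>n. t + T / real (Suc n)) \<longlonglongrightarrow> t + 0"
    using LIMSEQ_Suc[OF lim_const_over_n[of T]] by (intro tendsto_intros)
  then show "(\<lambda>n. t + T / real (Suc n)) \<longlonglongrightarrow> t" by simp
  show "\<forall>\<^sub>F n in sequentially. grid T n (idx T n t) \<le> t + T / real (Suc n)"
    using \<open>0 \<le> t\<close> by (intro always_eventually allI grid_idx_le)
  show "\<forall>\<^sub>F n in sequentially. t \<le> grid T n (idx T n t)"
    by (intro always_eventually allI grid_idx_ge)
qed simp

text \<open>Rounding the end points to the grid turns a combination of increments into a combination of
  grid increments.\<close>

definition grid_coeff :: "'k set \<Rightarrow> ('k \<Rightarrow> real) \<Rightarrow> ('k \<Rightarrow> real) \<Rightarrow> ('k \<Rightarrow> real) \<Rightarrow> nat \<Rightarrow> nat \<Rightarrow> real" where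
  "grid_coeff K c a b n j = (\<Sum>k\<in>K. c k * of_bool (idx T n (a k) \<le> j \<and> j < idx T n (b k)))"

lemma abs_grid_coeff_le: "\<bar>grid_coeff K c a b n j\<bar> \<le> (\<Sum>k\<in>K. \<bar>c k\<bar>)"
  unfolding grid_coeff_def
  by (rule order.trans[OF sum_abs]) (auto intro!: sum_mono simp: abs_mult)

lemma incr_sum_grid:
  assumes ab: "\<And>k. k \<in> K \<Longrightarrow> a k \<le> b k \<and> b k \<le> T"
  shows "incr_sum K c (\<lambda>k. grid T n (idx T n (a k))) (\<lambda>k. grid T n (idx T n (b k))) x
    = (\<Sum>j\<le>n. grid_coeff K c a b n j * (x (grid T n (Suc j)) - x (grid T n j)))"
proof -
  have tel: "x (grid T n (idx T n (b k))) - x (grid T n (idx T n (a k)))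
      = (\<Sum>j\<le>n. of_bool (idx T n (a k) \<le> j \<and> j < idx T n (b k)) * (x (grid T n (Suc j)) - x (grid T n j)))"
    if "k \<in> K" for k
  proof -
    have "(\<Sum>j\<le>n. of_bool (idx T n (a k) \<le> j \<and> j < idx T n (b k)) * (x (grid T n (Suc j)) - x (grid T n j)))
       = (\<Sum>j\<in>{idx T n (a k)..<idx T n (b k)}. x (grid T n (Suc j)) - x (grid T n j))"
      using idx_le[of "b k" n] ab[OF that]
      by (intro sum.mono_neutral_cong_right) auto
    also have "\<dots> = x (grid T n (idx T n (b k))) - x (grid T n (idx T n (a k)))"
      using idx_mono[of "a k" "b k" n] ab[OF that]
      by (intro sum_Suc_diff'[of _ _ "\<lambda>j. x (grid T n j)"]) auto
    finally show ?thesis by simp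
  qed
  have "incr_sum K c (\<lambda>k. grid T n (idx T n (a k))) (\<lambda>k. grid T n (idx T n (b k))) x
     = (\<Sum>k\<in>K. \<Sum>j\<le>n. c k * of_bool (idx T n (a k) \<le> j \<and> j < idx T n (b k)) * (x (grid T n (Suc j)) - x (grid T n j)))"
    unfolding incr_sum_def by (intro sum.cong refl) (simp only: tel sum_distrib_left mult.assoc)
  also have "\<dots> = (\<Sum>j\<le>n. grid_coeff K c a b n j * (x (grid T n (Suc j)) - x (grid T n j)))"
    unfolding grid_coeff_def by (subst sum.swap) (simp only: sum_distrib_right)
  finally show ?thesis .
qed

end

context stieltjes_clock
begin

lemma integral_grid_step_sq:
  "(\<integral>s. (\<Sum>j\<le>n. h j * indicator {grid T n j<..grid T n (Suc j)} s)\<^sup>2 \<partial>S)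
    = (\<Sum>j\<le>n. (h j)\<^sup>2 * (A (grid T n (Suc j)) - A (grid T n j)))"
proof -
  let ?I = "\<lambda>j. {grid T n j<..grid T n (Suc j)}"
  have disj: "?I i \<inter> ?I j = {}" if "i \<noteq> j" for i j
  proof -
    have "?I i \<inter> ?I j = {}" if "i < j" for i j
      using grid_mono[OF T_pos, of "Suc i" j n] that by (auto simp: Suc_le_eq)
    then show ?thesis using that by (metis Int_commute linorder_neqE_nat)
  qed
  have sq: "(\<Sum>j\<le>n. h j * indicator (?I j) s)\<^sup>2 = (\<Sum>j\<le>n. (h j)\<^sup>2 * indicator (?I j) s)" for s :: real
  proof (cases "\<exists>j\<le>n. s \<in> ?I j")
    case True
    then obtain j where j: "j \<le> n" "s \<in> ?I j" by blast
    then have ind: "indicator (?I i) s = (if i = j then 1 else 0 :: real)" for i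
      using disj[of i j] by (auto simp: indicator_def)
    show ?thesis using j by (simp add: ind if_distrib sum.delta cong: if_cong)
  next
    case False
    then have "indicator (?I i) s = (0::real)" if "i \<le> n" for i
      using that by (simp add: indicator_def)
    then show ?thesis by simp
  qed
  have m: "?I j \<in> sets S \<and> 0 \<le> grid T n j \<and> grid T n j \<le> grid T n (Suc j) \<and> grid T n (Suc j) \<le> T" if "j \<le> n" for j
    using that grid_in[OF T_pos, of j n] grid_in[OF T_pos, of "Suc j" n] grid_mono[OF T_pos, of j "Suc j" n]
    by (auto intro!: Ioc_in_sets_S)
  have "(\<integral>s. (\<Sum>j\<le>n. (h j)\<^sup>2 * indicator (?I j) s) \<partial>S) = (\<Sum>j\<le>n. \<integral>s. (h j)\<^sup>2 * indicator (?I j) s \<partial>S)"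
    using m by (intro Bochner_Integration.integral_sum integrable_mult_right integrable_real_indicator) (auto simp: S.emeasure_eq_measure)
  also have "\<dots> = (\<Sum>j\<le>n. (h j)\<^sup>2 * (A (grid T n (Suc j)) - A (grid T n j)))"
  proof (rule sum.cong)
    fix j assume "j \<in> {..n}"
    then have j: "?I j \<in> sets S" "0 \<le> grid T n j" "grid T n j \<le> grid T n (Suc j)" "grid T n (Suc j) \<le> T"
      using m by auto
    then have "?I j \<inter> {0..T} = ?I j" by auto
    then show "(\<integral>s. (h j)\<^sup>2 * indicator (?I j) s \<partial>S) = (h j)\<^sup>2 * (A (grid T n (Suc j)) - A (grid T n j))"
      using j by (simp add: measure_S_Ioc)
  qed simp
  finally show ?thesis by (simp only: sq)
qed

lemma integrable_incr_fun_sq: "integrable S (\<lambda>s. (incr_fun K c a b s)\<^sup>2)"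
proof (rule integrable_bounded_S)
  show "(\<lambda>s. (incr_fun K c a b s)\<^sup>2) \<in> borel_measurable S"
    by (intro borel_imp_measurable_stieltjes) measurable
  show "\<bar>(incr_fun K c a b t)\<^sup>2\<bar> \<le> (\<Sum>k\<in>K. \<bar>c k\<bar>)\<^sup>2" for t
    using power_mono[OF abs_incr_fun_le, of K c a b t 2] by simp
qed

lemma incr_fun_sq_grid_tendsto:
  assumes "\<And>k. k \<in> K \<Longrightarrow> 0 \<le> a k \<and> a k \<le> b k \<and> b k \<le> T"
  shows "(\<lambda>n. \<Sum>j\<le>n. (grid_coeff T K c a b n j)\<^sup>2 * (A (grid T n (Suc j)) - A (grid T n j)))
    \<longlonglongrightarrow> (\<integral>s. (incr_fun K c a b s)\<^sup>2 \<partial>S)"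
proof -
  let ?up = "\<lambda>n t. grid T n (idx T n t)"
  let ?g = "\<lambda>n. incr_fun K c (\<lambda>k. ?up n (a k)) (\<lambda>k. ?up n (b k))"
  have eq: "?g n s = (\<Sum>j\<le>n. grid_coeff T K c a b n j * indicator {grid T n j<..grid T n (Suc j)} s)" for n s
  proof -
    have "?g n s = incr_sum K c (\<lambda>k. ?up n (a k)) (\<lambda>k. ?up n (b k)) (\<lambda>t. of_bool (s \<le> t))"
      using assms by (intro incr_fun_eq_incr_sum grid_mono[OF T_pos] idx_mono[OF T_pos]) auto
    also have "\<dots> = (\<Sum>j\<le>n. grid_coeff T K c a b n j * (of_bool (s \<le> grid T n (Suc j)) - of_bool (s \<le> grid T n j)))"
      using assms by (intro incr_sum_grid[OF T_pos]) auto
    also have "\<dots> = (\<Sum>j\<le>n. grid_coeff T K c a b n j * indicator {grid T n j<..grid T n (Suc j)} s)"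
      using grid_mono[OF T_pos, of _ "Suc _" n]
      by (intro sum.cong refl arg_cong2[where f = "(*)"]) (auto simp: indicator_def intro: order.trans)
    finally show ?thesis .
  qed
  have "(\<lambda>n. \<integral>s. (?g n s)\<^sup>2 \<partial>S) \<longlonglongrightarrow> (\<integral>s. (incr_fun K c a b s)\<^sup>2 \<partial>S)"
  proof (rule integral_dominated_convergence[where w = "\<lambda>_. (\<Sum>k\<in>K. \<bar>c k\<bar>)\<^sup>2"])
    show "(\<lambda>s. (incr_fun K c a b s)\<^sup>2) \<in> borel_measurable S"
      by (intro borel_imp_measurable_stieltjes) measurable
    show "(\<lambda>s. (?g n s)\<^sup>2) \<in> borel_measurable S" for n
      by (intro borel_imp_measurable_stieltjes) measurable
    show "AE s in S. (\<lambda>n. (?g n s)\<^sup>2) \<longlonglongrightarrow> (incr_fun K c a b s)\<^sup>2"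
    proof (rule AE_I2)
      fix s
      have bool: "(\<lambda>n. of_bool (s \<le> ?up n t) :: real) \<longlonglongrightarrow> of_bool (s \<le> t)" if t: "0 \<le> t" for t
      proof (rule tendsto_eventually, cases "s \<le> t")
        case True
        then show "\<forall>\<^sub>F n in sequentially. of_bool (s \<le> ?up n t) = (of_bool (s \<le> t) :: real)"
          using order.trans[OF True grid_idx_ge[OF T_pos]] by auto
      next
        case False
        then have "\<forall>\<^sub>F n in sequentially. ?up n t < s"
          using grid_idx_tendsto[OF T_pos t] by (intro order_tendstoD) auto
        then show "\<forall>\<^sub>F n in sequentially. of_bool (s \<le> ?up n t) = (of_bool (s \<le> t) :: real)"
          by eventually_elim (use False in auto)
      qed
      have "(\<lambda>n. incr_sum K c (\<lambda>k. ?up n (a k)) (\<lambda>k. ?up n (b k)) (\<lambda>t. of_bool (s \<le> t)))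
          \<longlonglongrightarrow> incr_sum K c a b (\<lambda>t. of_bool (s \<le> t))"
        unfolding incr_sum_def using assms
        by (intro tendsto_sum tendsto_mult_left tendsto_diff bool) force+
      moreover have "incr_sum K c (\<lambda>k. ?up n (a k)) (\<lambda>k. ?up n (b k)) (\<lambda>t. of_bool (s \<le> t)) = ?g n s" for n
        using assms by (intro incr_fun_eq_incr_sum[symmetric] grid_mono[OF T_pos] idx_mono[OF T_pos]) auto
      moreover have "incr_sum K c a b (\<lambda>t. of_bool (s \<le> t)) = incr_fun K c a b s"
        using assms by (intro incr_fun_eq_incr_sum[symmetric]) auto
      ultimately have "(\<lambda>n. ?g n s) \<longlonglongrightarrow> incr_fun K c a b s" by simp
      then show "(\<lambda>n. (?g n s)\<^sup>2) \<longlonglongrightarrow> (incr_fun K c a b s)\<^sup>2" by (rule tendsto_power)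
    qed
    show "AE s in S. norm ((?g n s)\<^sup>2) \<le> (\<Sum>k\<in>K. \<bar>c k\<bar>)\<^sup>2" for n
      using power_mono[OF abs_incr_fun_le, of K c _ _ _ 2] by (intro AE_I2) simp
  qed simp
  then show ?thesis unfolding eq integral_grid_step_sq .
qed

end

context det_qv_martingale
begin

lemma increment_complex:
  fixes U :: "'a \<Rightarrow> complex"
  assumes st: "0 \<le> s" "s \<le> t" "t \<le> T" and U: "U \<in> borel_measurable (F s)" and bdd: "\<And>\<omega>. cmod (U \<omega>) \<le> 1"
  shows "integrable P (\<lambda>\<omega>. U \<omega> * of_real (M t \<omega> - M s \<omega>))"
    and "(\<integral>\<omega>. U \<omega> * of_real (M t \<omega> - M s \<omega>) \<partial>P) = 0"
    and "integrable P (\<lambda>\<omega>. U \<omega> * of_real ((M t \<omega> - M s \<omega>)\<^sup>2))"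
    and "(\<integral>\<omega>. U \<omega> * of_real ((M t \<omega> - M s \<omega>)\<^sup>2) \<partial>P) = of_real (A t - A s) * (\<integral>\<omega>. U \<omega> \<partial>P)"
proof -
  have sub: "subalgebra P (F s)" using st by (intro subalg) auto
  have split: "U \<omega> * of_real x = of_real (Re (U \<omega>) * x) + \<i> * of_real (Im (U \<omega>) * x)" for \<omega> x
    by (simp add: complex_eq_iff)
  have m: "(\<lambda>\<omega>. Re (U \<omega>)) \<in> borel_measurable (F s)" "(\<lambda>\<omega>. Im (U \<omega>)) \<in> borel_measurable (F s)"
    using U by measurable
  have b: "\<bar>Re (U \<omega>)\<bar> \<le> 1" "\<bar>Im (U \<omega>)\<bar> \<le> 1" for \<omega>
    using bdd[of \<omega>] abs_Re_le_cmod[of "U \<omega>"] abs_Im_le_cmod[of "U \<omega>"] by linarith+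
  have m': "(\<lambda>\<omega>. Re (U \<omega>)) \<in> borel_measurable P" "(\<lambda>\<omega>. Im (U \<omega>)) \<in> borel_measurable P"
    by (rule measurable_from_subalg[OF sub], rule m)+
  have sq: "integrable P (\<lambda>\<omega>. (Re (U \<omega>))\<^sup>2)" "integrable P (\<lambda>\<omega>. (Im (U \<omega>))\<^sup>2)"
    by (rule integrable_const_bound[of _ 1]; use b m' in \<open>auto simp: abs_square_le_1\<close>)+
  note o = increment_orthogonal[OF st m(1) sq(1)] increment_orthogonal[OF st m(2) sq(2)]
  note q = increment_sq[OF st m(1) b(1)] increment_sq[OF st m(2) b(2)]
  have U1: "U \<omega> = of_real (Re (U \<omega>)) + \<i> * of_real (Im (U \<omega>))" for \<omega> by (simp add: complex_eq_iff)
  have i: "integrable P (\<lambda>\<omega>. Re (U \<omega>))" "integrable P (\<lambda>\<omega>. Im (U \<omega>))"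
    by (rule integrable_const_bound[of _ 1]; use b m' in auto)+
  have iU: "(\<integral>\<omega>. U \<omega> \<partial>P) = of_real (\<integral>\<omega>. Re (U \<omega>) \<partial>P) + \<i> * of_real (\<integral>\<omega>. Im (U \<omega>) \<partial>P)"
  proof -
    have "(\<integral>\<omega>. U \<omega> \<partial>P) = (\<integral>\<omega>. of_real (Re (U \<omega>)) + \<i> * of_real (Im (U \<omega>)) \<partial>P)"
      by (subst U1) simp
    also have "\<dots> = (\<integral>\<omega>. of_real (Re (U \<omega>)) \<partial>P) + (\<integral>\<omega>. \<i> * of_real (Im (U \<omega>)) \<partial>P)"
      using i by (intro Bochner_Integration.integral_add integrable_mult_right) auto
    finally show ?thesis by simp
  qed
  show "integrable P (\<lambda>\<omega>. U \<omega> * of_real (M t \<omega> - M s \<omega>))"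
    unfolding split using o by (intro Bochner_Integration.integrable_add integrable_mult_right integrable_of_real)
  show "integrable P (\<lambda>\<omega>. U \<omega> * of_real ((M t \<omega> - M s \<omega>)\<^sup>2))"
    unfolding split using q by (intro Bochner_Integration.integrable_add integrable_mult_right integrable_of_real)
  show "(\<integral>\<omega>. U \<omega> * of_real (M t \<omega> - M s \<omega>) \<partial>P) = 0"
    unfolding split using o
    by (subst Bochner_Integration.integral_add) (simp_all only: integrable_mult_right integrable_of_real integral_mult_right integral_mult_right_zero integral_complex_of_real, simp)
  show "(\<integral>\<omega>. U \<omega> * of_real ((M t \<omega> - M s \<omega>)\<^sup>2) \<partial>P) = of_real (A t - A s) * (\<integral>\<omega>. U \<omega> \<partial>P)"
    unfolding split iU using q
    by (subst Bochner_Integration.integral_add) (simp_all only: integrable_mult_right integrable_of_real integral_mult_right_zero integral_complex_of_real, simp add: distrib_left mult.left_commute)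
qed

text \<open>One step of the central limit theorem: the second order expansion of the exponential, whose linear
  term vanishes and whose quadratic term is deterministic. The remainder is quadratic for increments
  larger than \<^term>\<open>\<delta>\<close> and cubic for the others.\<close>

lemma char_step_bound:
  fixes U :: "'a \<Rightarrow> complex"
  assumes j: "j \<le> n" and U: "U \<in> borel_measurable (F (gr n j))" and bdd: "\<And>\<omega>. cmod (U \<omega>) \<le> 1"
    and c: "\<bar>c\<bar> \<le> H" and \<delta>: "0 < \<delta>"
  shows "cmod ((\<integral>\<omega>. U \<omega> * iexp (c * D n j \<omega>) \<partial>P) - exp (- (c\<^sup>2 * inc n j / 2)) * (\<integral>\<omega>. U \<omega> \<partial>P))
    \<le> H\<^sup>2 * big_sq \<delta> n j + H^3 * \<delta> * inc n j + H^4 * (inc n j)\<^sup>2"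
proof -
  note o = gr_order[OF j]
  have [measurable]: "D n j \<in> borel_measurable P" by (rule D_measurable[OF j])
  have sub: "subalgebra P (F (gr n j))" using o by (intro subalg) auto
  have [measurable]: "U \<in> borel_measurable P" by (rule measurable_from_subalg[OF sub U])
  have H: "0 \<le> H" using c by linarith
  note ic = increment_complex[of "gr n j" "gr n (Suc j)" U, folded D_def inc_def]
  have i: "integrable P (\<lambda>\<omega>. U \<omega> * of_real (D n j \<omega>))" "(\<integral>\<omega>. U \<omega> * of_real (D n j \<omega>) \<partial>P) = 0"
      "integrable P (\<lambda>\<omega>. U \<omega> * of_real ((D n j \<omega>)\<^sup>2))"
      "(\<integral>\<omega>. U \<omega> * of_real ((D n j \<omega>)\<^sup>2) \<partial>P) = of_real (inc n j) * (\<integral>\<omega>. U \<omega> \<partial>P)"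
    using ic o U bdd by auto
  have iU: "integrable P U" by (rule integrable_const_bound[of _ 1]) (use bdd in auto)
  have iE: "integrable P (\<lambda>\<omega>. U \<omega> * iexp (c * D n j \<omega>))"
    by (rule integrable_const_bound[of _ 1]) (use bdd in \<open>auto simp: norm_mult\<close>)
  define r where "r x = iexp x - (\<Sum>k\<le>2. (\<i> * x)^k / fact k)" for x :: real
  have r_eq: "r x = iexp x - (1 + \<i> * x - x\<^sup>2 / 2)" for x
    unfolding r_def by (simp add: numeral_2_eq_2 power2_eq_square algebra_simps)
  have r2: "cmod (r x) \<le> x\<^sup>2" for x
    using iexp_approx2[of x 2] unfolding r_def by (simp add: fact_numeral)
  have r3: "cmod (r x) \<le> \<bar>x\<bar>^3" for x
  proof -
    have "cmod (r x) \<le> \<bar>x\<bar>^3 / 6"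
      using iexp_approx1[of x 2] unfolding r_def by (simp add: fact_numeral numeral_3_eq_3 numeral_2_eq_2)
    also have "\<dots> \<le> \<bar>x\<bar>^3" by simp
    finally show ?thesis .
  qed
  have exp_split: "U \<omega> * iexp (c * D n j \<omega>) = U \<omega> + (\<i> * c) * (U \<omega> * of_real (D n j \<omega>))
      - of_real (c\<^sup>2 / 2) * (U \<omega> * of_real ((D n j \<omega>)\<^sup>2)) + U \<omega> * r (c * D n j \<omega>)" for \<omega>
    unfolding r_eq by (simp add: power_mult_distrib algebra_simps power2_eq_square)
  have r_alt: "U \<omega> * r (c * D n j \<omega>) = U \<omega> * iexp (c * D n j \<omega>) - (U \<omega> + (\<i> * c) * (U \<omega> * of_real (D n j \<omega>))
      - of_real (c\<^sup>2 / 2) * (U \<omega> * of_real ((D n j \<omega>)\<^sup>2)))" for \<omega>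
    using exp_split[of \<omega>] by simp
  have ir: "integrable P (\<lambda>\<omega>. U \<omega> * r (c * D n j \<omega>))"
    unfolding r_alt using i iU iE
    by (intro Bochner_Integration.integrable_diff Bochner_Integration.integrable_add integrable_mult_right)
  have "(\<integral>\<omega>. U \<omega> * r (c * D n j \<omega>) \<partial>P) = (\<integral>\<omega>. U \<omega> * iexp (c * D n j \<omega>) \<partial>P) - ((\<integral>\<omega>. U \<omega> \<partial>P)
      - of_real (c\<^sup>2 / 2) * (of_real (inc n j) * (\<integral>\<omega>. U \<omega> \<partial>P)))"
    unfolding r_alt using i iU iE
    by (simp only: Bochner_Integration.integral_diff Bochner_Integration.integral_add
        Bochner_Integration.integrable_diff Bochner_Integration.integrable_add
        integrable_mult_right integral_mult_right_zero, simp)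
  then have main: "(\<integral>\<omega>. U \<omega> * iexp (c * D n j \<omega>) \<partial>P) - exp (- (c\<^sup>2 * inc n j / 2)) * (\<integral>\<omega>. U \<omega> \<partial>P)
      = (\<integral>\<omega>. U \<omega> * r (c * D n j \<omega>) \<partial>P) + of_real ((1 - c\<^sup>2 * inc n j / 2) - exp (- (c\<^sup>2 * inc n j / 2))) * (\<integral>\<omega>. U \<omega> \<partial>P)"
    by (simp add: algebra_simps)
  have c2: "c\<^sup>2 \<le> H\<^sup>2" using power_mono[OF c, of 2] by simp
  have c3: "\<bar>c\<bar>^3 \<le> H^3" using power_mono[OF c, of 3] by simp
  have c4: "c^4 \<le> H^4" using power_mono[OF c, of 4] by simp
  have one: "cmod (\<integral>\<omega>. U \<omega> \<partial>P) \<le> 1"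
  proof -
    have "cmod (\<integral>\<omega>. U \<omega> \<partial>P) \<le> (\<integral>\<omega>. cmod (U \<omega>) \<partial>P)" by (rule integral_norm_bound)
    also have "\<dots> \<le> (\<integral>\<omega>. 1 \<partial>P)" using bdd iU by (intro integral_mono) auto
    finally show ?thesis by (simp add: prob_space)
  qed
  have "cmod (of_real ((1 - c\<^sup>2 * inc n j / 2) - exp (- (c\<^sup>2 * inc n j / 2))) * (\<integral>\<omega>. U \<omega> \<partial>P))
      \<le> (c\<^sup>2 * inc n j / 2)\<^sup>2 / 2 * 1"
    unfolding norm_mult norm_of_real
    using inc_nonneg[OF j] by (intro mult_mono exp_minus_quadratic_bound one) auto
  also have "\<dots> = c^4 * (inc n j)\<^sup>2 / 8"
    by (simp add: power_mult_distrib power_divide power2_eq_square power4_eq_xxxx)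
  also have "\<dots> \<le> c^4 * (inc n j)\<^sup>2" by simp
  also have "\<dots> \<le> H^4 * (inc n j)\<^sup>2" by (intro mult_right_mono c4) simp
  finally have part2: "cmod (of_real ((1 - c\<^sup>2 * inc n j / 2) - exp (- (c\<^sup>2 * inc n j / 2))) * (\<integral>\<omega>. U \<omega> \<partial>P)) \<le> H^4 * (inc n j)\<^sup>2" .
  have Dsq: "integrable P (\<lambda>\<omega>. (D n j \<omega>)\<^sup>2)" "(\<integral>\<omega>. (D n j \<omega>)\<^sup>2 \<partial>P) = inc n j"
    using increment_sq[of "gr n j" "gr n (Suc j)" "\<lambda>_. 1" 1] o unfolding D_def inc_def by (simp_all add: prob_space)
  have Dbig: "integrable P (\<lambda>\<omega>. if \<delta> < \<bar>D n j \<omega>\<bar> then (D n j \<omega>)\<^sup>2 else 0)"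
    by (rule Bochner_Integration.integrable_bound[OF Dsq(1)]) auto
  have "cmod (\<integral>\<omega>. U \<omega> * r (c * D n j \<omega>) \<partial>P) \<le> (\<integral>\<omega>. cmod (U \<omega> * r (c * D n j \<omega>)) \<partial>P)"
    by (rule integral_norm_bound)
  also have "\<dots> \<le> (\<integral>\<omega>. H\<^sup>2 * (if \<delta> < \<bar>D n j \<omega>\<bar> then (D n j \<omega>)\<^sup>2 else 0) + H^3 * \<delta> * (D n j \<omega>)\<^sup>2 \<partial>P)"
  proof (rule integral_mono)
    show "integrable P (\<lambda>\<omega>. cmod (U \<omega> * r (c * D n j \<omega>)))" using ir by (rule integrable_norm)
    show "integrable P (\<lambda>\<omega>. H\<^sup>2 * (if \<delta> < \<bar>D n j \<omega>\<bar> then (D n j \<omega>)\<^sup>2 else 0) + H^3 * \<delta> * (D n j \<omega>)\<^sup>2)"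
      using Dsq(1) Dbig by (intro Bochner_Integration.integrable_add integrable_mult_right)
    fix \<omega>
    define d where "d = D n j \<omega>"
    have "cmod (U \<omega> * r (c * d)) \<le> 1 * cmod (r (c * d))"
      unfolding norm_mult by (intro mult_right_mono bdd) simp
    also have "\<dots> \<le> H\<^sup>2 * (if \<delta> < \<bar>d\<bar> then d\<^sup>2 else 0) + H^3 * \<delta> * d\<^sup>2"
    proof (cases "\<delta> < \<bar>d\<bar>")
      case True
      have "cmod (r (c * d)) \<le> c\<^sup>2 * d\<^sup>2" using r2[of "c * d"] by (simp add: power_mult_distrib)
      also have "\<dots> \<le> H\<^sup>2 * d\<^sup>2" by (intro mult_right_mono c2) simp
      finally show ?thesis using True H \<delta> by (simp add: add_increasing2)
    next
      case False
      have "cmod (r (c * d)) \<le> \<bar>c\<bar>^3 * \<bar>d\<bar>^3" using r3[of "c * d"] by (simp add: abs_mult power_mult_distrib)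
      also have "\<dots> \<le> H^3 * (\<delta> * d\<^sup>2)"
      proof (intro mult_mono c3)
        have "\<bar>d\<bar>^3 = \<bar>d\<bar> * d\<^sup>2" by (simp add: power3_eq_cube power2_eq_square)
        also have "\<dots> \<le> \<delta> * d\<^sup>2" using False by (intro mult_right_mono) auto
        finally show "\<bar>d\<bar>^3 \<le> \<delta> * d\<^sup>2" .
      qed (use H in auto)
      finally show ?thesis using False by simp
    qed
    finally show "cmod (U \<omega> * r (c * D n j \<omega>)) \<le> H\<^sup>2 * (if \<delta> < \<bar>D n j \<omega>\<bar> then (D n j \<omega>)\<^sup>2 else 0) + H^3 * \<delta> * (D n j \<omega>)\<^sup>2"
      unfolding d_def .
  qed
  also have "\<dots> = H\<^sup>2 * big_sq \<delta> n j + H^3 * \<delta> * inc n j"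
    using Dsq Dbig by (subst Bochner_Integration.integral_add) auto
  finally have part1: "cmod (\<integral>\<omega>. U \<omega> * r (c * D n j \<omega>) \<partial>P) \<le> H\<^sup>2 * big_sq \<delta> n j + H^3 * \<delta> * inc n j" .
  show ?thesis unfolding main by (rule order.trans[OF norm_triangle_ineq add_mono[OF part1 part2]])
qed

lemma char_grid_bound:
  assumes h: "\<And>j. j \<le> n \<Longrightarrow> \<bar>h j\<bar> \<le> H" and \<delta>: "0 < \<delta>"
  shows "cmod ((\<integral>\<omega>. iexp (\<Sum>j\<le>n. h j * D n j \<omega>) \<partial>P) - of_real (exp (- (\<Sum>j\<le>n. (h j)\<^sup>2 * inc n j) / 2)))
    \<le> H\<^sup>2 * (\<Sum>j\<le>n. big_sq \<delta> n j) + H^3 * \<delta> * A T + H^4 * (\<Sum>j\<le>n. (inc n j)\<^sup>2)"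
proof -
  define err where "err j = H\<^sup>2 * big_sq \<delta> n j + H^3 * \<delta> * inc n j + H^4 * (inc n j)\<^sup>2" for j
  define U where "U k \<omega> = iexp (\<Sum>j<k. h j * D n j \<omega>)" for k \<omega>
  define V where "V k = exp (- (\<Sum>j<k. (h j)\<^sup>2 * inc n j) / 2)" for k
  have "cmod ((\<integral>\<omega>. U k \<omega> \<partial>P) - of_real (V k)) \<le> (\<Sum>j<k. err j)" if "k \<le> Suc n" for k
    using that
  proof (induction k)
    case 0
    show ?case by (simp add: U_def V_def prob_space)
  next
    case (Suc k)
    then have k: "k \<le> n" by simp
    let ?q = "exp (- ((h k)\<^sup>2 * inc n k / 2))"
    have U_Suc: "U (Suc k) \<omega> = U k \<omega> * iexp (h k * D n k \<omega>)" for \<omega>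
      unfolding U_def by (simp add: distrib_left exp_add)
    have V_Suc: "V (Suc k) = ?q * V k"
      unfolding V_def by (simp add: exp_add[symmetric] field_simps)
    have "(\<lambda>\<omega>. \<Sum>j<k. h j * D n j \<omega>) \<in> borel_measurable (F (gr n k))"
      using k by (intro borel_measurable_sum borel_measurable_times borel_measurable_const D_adapted) auto
    then have Um: "U k \<in> borel_measurable (F (gr n k))"
      unfolding U_def[abs_def] by measurable
    have "(\<integral>\<omega>. U (Suc k) \<omega> \<partial>P) - of_real (V (Suc k))
        = ((\<integral>\<omega>. U k \<omega> * iexp (h k * D n k \<omega>) \<partial>P) - ?q * (\<integral>\<omega>. U k \<omega> \<partial>P)) + ?q * ((\<integral>\<omega>. U k \<omega> \<partial>P) - of_real (V k))"
      unfolding U_Suc V_Suc by (simp add: algebra_simps)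
    also have "cmod \<dots> \<le> err k + 1 * (\<Sum>j<k. err j)"
    proof (rule order.trans[OF norm_triangle_ineq add_mono])
      show "cmod ((\<integral>\<omega>. U k \<omega> * iexp (h k * D n k \<omega>) \<partial>P) - ?q * (\<integral>\<omega>. U k \<omega> \<partial>P)) \<le> err k"
        unfolding err_def by (rule char_step_bound[OF k Um _ h[OF k] \<delta>]) (simp add: U_def)
      have "cmod (of_real ?q) \<le> 1" using inc_nonneg[OF k] by simp
      then show "cmod (?q * ((\<integral>\<omega>. U k \<omega> \<partial>P) - of_real (V k))) \<le> 1 * (\<Sum>j<k. err j)"
        unfolding norm_mult using Suc by (intro mult_mono) auto
    qed
    finally show ?case by simp
  qed
  from this[of "Suc n"] have "cmod ((\<integral>\<omega>. U (Suc n) \<omega> \<partial>P) - of_real (V (Suc n))) \<le> (\<Sum>j\<le>n. err j)"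
    by (simp add: lessThan_Suc_atMost)
  also have "(\<Sum>j\<le>n. err j) = H\<^sup>2 * (\<Sum>j\<le>n. big_sq \<delta> n j) + H^3 * \<delta> * A T + H^4 * (\<Sum>j\<le>n. (inc n j)\<^sup>2)"
    by (simp add: err_def sum.distrib sum_distrib_left[symmetric] sum_inc)
  finally show ?thesis by (simp add: U_def V_def lessThan_Suc_atMost)
qed

lemma sum_inc_sq_tendsto: "(\<lambda>n. \<Sum>j\<le>n. (inc n j)\<^sup>2) \<longlonglongrightarrow> 0"
proof (rule order_tendstoI)
  fix a :: real assume "0 < a"
  have AT: "0 \<le> A T" using A_le[of 0 T] A_0 T_pos by simp
  define d where "d = a / (A T + 1)"
  have "0 < d" using \<open>0 < a\<close> AT by (simp add: d_def)
  from grid_increments_uniformly_small[OF T_pos A_cont this]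
  show "\<forall>\<^sub>F n in sequentially. (\<Sum>j\<le>n. (inc n j)\<^sup>2) < a"
  proof eventually_elim
    fix n assume *: "\<forall>j\<le>n. \<bar>A (gr n (Suc j)) - A (gr n j)\<bar> < d"
    have "(\<Sum>j\<le>n. (inc n j)\<^sup>2) \<le> (\<Sum>j\<le>n. d * inc n j)"
      unfolding power2_eq_square
      using * inc_nonneg by (intro sum_mono mult_right_mono) (auto simp: inc_def intro: less_imp_le order.strict_trans1[OF abs_ge_self])
    also have "\<dots> = d * A T" by (simp add: sum_distrib_left[symmetric] sum_inc)
    also have "\<dots> < a" using \<open>0 < a\<close> AT by (simp add: d_def field_simps)
    finally show "(\<Sum>j\<le>n. (inc n j)\<^sup>2) < a" .
  qed
next
  fix a :: real assume "a < 0"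
  then show "\<forall>\<^sub>F n in sequentially. a < (\<Sum>j\<le>n. (inc n j)\<^sup>2)"
    by (intro always_eventually allI less_le_trans[OF _ sum_nonneg]) auto
qed

lemma char_grid_tendsto:
  assumes h: "\<And>n j. j \<le> n \<Longrightarrow> \<bar>h n j\<bar> \<le> H"
  shows "(\<lambda>n. (\<integral>\<omega>. iexp (\<Sum>j\<le>n. h n j * D n j \<omega>) \<partial>P) - of_real (exp (- (\<Sum>j\<le>n. (h n j)\<^sup>2 * inc n j) / 2))) \<longlonglongrightarrow> 0"
proof (rule tendstoI)
  fix e :: real assume "0 < e"
  have AT: "0 \<le> A T" using A_le[of 0 T] A_0 T_pos by simp
  have H: "0 \<le> H" using h[of 0 0] by simp
  define \<delta> where "\<delta> = e / (2 * (H^3 * A T + 1))"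
  have "0 < H^3 * A T + 1" using H AT by (simp add: add_nonneg_pos)
  then have \<delta>: "0 < \<delta>" and \<delta>e: "H^3 * \<delta> * A T < e / 2 + 0"
    using \<open>0 < e\<close> by (simp_all add: \<delta>_def field_simps)
  have "(\<lambda>n. H\<^sup>2 * (\<Sum>j\<le>n. big_sq \<delta> n j) + H^3 * \<delta> * A T + H^4 * (\<Sum>j\<le>n. (inc n j)\<^sup>2))
    \<longlonglongrightarrow> H\<^sup>2 * 0 + H^3 * \<delta> * A T + H^4 * 0"
    by (intro tendsto_intros Lindeberg_condition \<delta> sum_inc_sq_tendsto)
  then have "\<forall>\<^sub>F n in sequentially. H\<^sup>2 * (\<Sum>j\<le>n. big_sq \<delta> n j) + H^3 * \<delta> * A T + H^4 * (\<Sum>j\<le>n. (inc n j)\<^sup>2) < e"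
    by (rule order_tendstoD) (use \<delta>e \<open>0 < e\<close> in simp)
  then show "\<forall>\<^sub>F n in sequentially. dist ((\<integral>\<omega>. iexp (\<Sum>j\<le>n. h n j * D n j \<omega>) \<partial>P) - of_real (exp (- (\<Sum>j\<le>n. (h n j)\<^sup>2 * inc n j) / 2))) 0 < e"
  proof eventually_elim
    fix n
    assume "H\<^sup>2 * (\<Sum>j\<le>n. big_sq \<delta> n j) + H^3 * \<delta> * A T + H^4 * (\<Sum>j\<le>n. (inc n j)\<^sup>2) < e"
    with char_grid_bound[of n "h n" H \<delta>, OF h \<delta>]
    show "dist ((\<integral>\<omega>. iexp (\<Sum>j\<le>n. h n j * D n j \<omega>) \<partial>P) - of_real (exp (- (\<Sum>j\<le>n. (h n j)\<^sup>2 * inc n j) / 2))) 0 < e"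
      unfolding dist_norm diff_zero by (rule le_less_trans) 
  qed
qed

text \<open>The characteristic function of a combination of increments: the central limit theorem along
  finer and finer grids, to which the end points are rounded.\<close>

lemma char_incr_sum:
  assumes K: "finite K" and ab: "\<And>k. k \<in> K \<Longrightarrow> 0 \<le> a k \<and> a k \<le> b k \<and> b k \<le> T"
  shows "(\<integral>\<omega>. iexp (incr_sum K c a b (\<lambda>t. M t \<omega>)) \<partial>P) = of_real (exp (- (\<integral>s. (incr_fun K c a b s)\<^sup>2 \<partial>S) / 2))"
proof -
  let ?up = "\<lambda>n t. gr n (idx T n t)"
  let ?h = "grid_coeff T K c a b"
  have ab': "a k \<in> {0..T}" "b k \<in> {0..T}" "0 \<le> a k" "0 \<le> b k" if "k \<in> K" for k
    using ab[OF that] by auto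
  have up_in: "?up n t \<in> {0..T}" if "t \<in> {0..T}" for n t
    using that idx_le[OF T_pos, of t n] by (intro gr_in) auto
  have eq: "(\<Sum>j\<le>n. ?h n j * D n j \<omega>) = incr_sum K c (\<lambda>k. ?up n (a k)) (\<lambda>k. ?up n (b k)) (\<lambda>t. M t \<omega>)" for n \<omega>
    unfolding D_def using ab by (subst incr_sum_grid[OF T_pos]) auto
  have meas: "(\<lambda>\<omega>. incr_sum K c u v (\<lambda>t. M t \<omega>)) \<in> borel_measurable P"
    if "\<And>k. k \<in> K \<Longrightarrow> u k \<in> {0..T} \<and> v k \<in> {0..T}" for u v
    unfolding incr_sum_def using that
    by (intro borel_measurable_sum borel_measurable_times borel_measurable_const borel_measurable_diff M_measurable) auto
  have lim1: "(\<lambda>n. \<integral>\<omega>. iexp (\<Sum>j\<le>n. ?h n j * D n j \<omega>) \<partial>P) \<longlonglongrightarrow> (\<integral>\<omega>. iexp (incr_sum K c a b (\<lambda>t. M t \<omega>)) \<partial>P)"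
    unfolding eq
  proof (rule integral_dominated_convergence[where w = "\<lambda>_. 1"])
    have [measurable]: "(\<lambda>\<omega>. incr_sum K c a b (\<lambda>t. M t \<omega>)) \<in> borel_measurable P" using ab' by (intro meas) auto
    show "(\<lambda>\<omega>. iexp (incr_sum K c a b (\<lambda>t. M t \<omega>))) \<in> borel_measurable P" by measurable
    show "(\<lambda>\<omega>. iexp (incr_sum K c (\<lambda>k. ?up n (a k)) (\<lambda>k. ?up n (b k)) (\<lambda>t. M t \<omega>))) \<in> borel_measurable P" for n
    proof -
      have [measurable]: "(\<lambda>\<omega>. incr_sum K c (\<lambda>k. ?up n (a k)) (\<lambda>k. ?up n (b k)) (\<lambda>t. M t \<omega>)) \<in> borel_measurable P"
        using ab' by (intro meas conjI up_in)
      show ?thesis by measurable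
    qed
    show "AE \<omega> in P. (\<lambda>n. iexp (incr_sum K c (\<lambda>k. ?up n (a k)) (\<lambda>k. ?up n (b k)) (\<lambda>t. M t \<omega>))) \<longlonglongrightarrow> iexp (incr_sum K c a b (\<lambda>t. M t \<omega>))"
      using M_continuous
    proof eventually_elim
      fix \<omega> assume cont: "continuous_on {0..T} (\<lambda>t. M t \<omega>)"
      have conv: "(\<lambda>n. M (?up n t) \<omega>) \<longlonglongrightarrow> M t \<omega>" if "t \<in> {0..T}" for t
      proof (rule continuous_on_tendsto_compose[OF cont grid_idx_tendsto[OF T_pos] that])
        show "0 \<le> t" using that by simp
        show "\<forall>\<^sub>F n in sequentially. ?up n t \<in> {0..T}" using that by (intro always_eventually allI up_in)
      qed
      then show "(\<lambda>n. iexp (incr_sum K c (\<lambda>k. ?up n (a k)) (\<lambda>k. ?up n (b k)) (\<lambda>t. M t \<omega>))) \<longlonglongrightarrow> iexp (incr_sum K c a b (\<lambda>t. M t \<omega>))"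
        unfolding incr_sum_def by (intro tendsto_intros conv ab')
    qed
  qed (auto simp: prob_space)
  have "(\<lambda>n. of_real (exp (- (\<Sum>j\<le>n. (?h n j)\<^sup>2 * inc n j) / 2))) \<longlonglongrightarrow> (of_real (exp (- (\<integral>s. (incr_fun K c a b s)\<^sup>2 \<partial>S) / 2)) :: complex)"
    unfolding inc_def using ab by (intro tendsto_intros incr_fun_sq_grid_tendsto) auto
  from tendsto_add[OF char_grid_tendsto[of ?h, OF abs_grid_coeff_le[OF T_pos]] this]
  have "(\<lambda>n. \<integral>\<omega>. iexp (\<Sum>j\<le>n. ?h n j * D n j \<omega>) \<partial>P) \<longlonglongrightarrow> of_real (exp (- (\<integral>s. (incr_fun K c a b s)\<^sup>2 \<partial>S) / 2))"
    by simp
  with lim1 show ?thesis by (rule LIMSEQ_unique)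
qed

end

section \<open>Centred Gaussian laws\<close>

text \<open>A scaled standard normal variable, so that the degenerate case \<open>\<sigma> = 0\<close> is included.\<close>

definition gauss :: "real \<Rightarrow> real measure" where
  "gauss \<sigma> = distr std_normal_distribution borel (\<lambda>x. \<sigma> * x)"

lemma prob_space_std_normal: "prob_space std_normal_distribution"
  by (rule prob_space_normal_density) simp

lemma distr_eq_gaussI:
  assumes "prob_space Q" and [measurable]: "Y \<in> borel_measurable Q"
    and char: "\<And>u. (\<integral>\<omega>. iexp (u * Y \<omega>) \<partial>Q) = of_real (exp (- (\<sigma> * u)\<^sup>2 / 2))"
  shows "distr Q borel Y = gauss \<sigma>"
proof (rule Levy_uniqueness)
  interpret Q: prob_space Q by fact
  interpret std: real_distribution std_normal_distribution by (rule real_dist_normal_dist)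
  show "real_distribution (distr Q borel Y)" by (rule Q.real_distribution_distr) simp
  show "real_distribution (gauss \<sigma>)" unfolding gauss_def by (rule std.real_distribution_distr) simp
  show "char (distr Q borel Y) = char (gauss \<sigma>)"
  proof
    fix u
    have "char (gauss \<sigma>) u = char std_normal_distribution (u * \<sigma>)"
      unfolding gauss_def char_def by (subst integral_distr) (auto simp: mult.assoc)
    then show "char (distr Q borel Y) u = char (gauss \<sigma>) u"
      unfolding char_std_normal_distribution using char[of u]
      by (simp add: char_def integral_distr mult.commute)
  qed
qed

lemma nn_integral_gauss:
  assumes "distr Q borel Y = gauss \<sigma>" and [measurable]: "Y \<in> borel_measurable Q" "h \<in> borel_measurable borel"
  shows "(\<integral>\<^sup>+\<omega>. h (Y \<omega>) \<partial>Q) = (\<integral>\<^sup>+x. h (\<sigma> * x) \<partial>std_normal_distribution)"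
proof -
  have "(\<integral>\<^sup>+\<omega>. h (Y \<omega>) \<partial>Q) = (\<integral>\<^sup>+x. h x \<partial>distr Q borel Y)" by (simp add: nn_integral_distr)
  also have "\<dots> = (\<integral>\<^sup>+x. h (\<sigma> * x) \<partial>std_normal_distribution)"
    unfolding assms(1) gauss_def by (simp add: nn_integral_distr)
  finally show ?thesis .
qed

lemma sq_norm_gauss:
  assumes "distr Q borel Y = gauss \<sigma>" "Y \<in> borel_measurable Q"
  shows "sq_norm Q Y = ennreal (\<sigma>\<^sup>2)"
proof -
  have "sq_norm Q Y = (\<integral>\<^sup>+x. ennreal ((\<sigma> * x)\<^sup>2) \<partial>std_normal_distribution)"
    unfolding sq_norm_def by (rule nn_integral_gauss[OF assms, of "\<lambda>x. ennreal (x\<^sup>2)"]) simp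
  also have "\<dots> = ennreal (\<integral>x. (\<sigma> * x)\<^sup>2 \<partial>std_normal_distribution)"
    using std_normal_distribution_even_moments(2)[of 1]
    by (intro nn_integral_eq_integral) (auto simp: power_mult_distrib)
  also have "(\<integral>x. (\<sigma> * x)\<^sup>2 \<partial>std_normal_distribution) = \<sigma>\<^sup>2"
    using std_normal_distribution_even_moments(1)[of 1] by (simp add: power_mult_distrib)
  finally show ?thesis .
qed

lemma nn_integral_normal_density: "0 < \<sigma> \<Longrightarrow> (\<integral>\<^sup>+x. ennreal (normal_density \<mu> \<sigma> x) \<partial>lborel) = 1"
  by (subst nn_integral_eq_integral) (auto simp: normal_density_nonneg)

lemma std_normal_exp_linear:
  "(\<integral>\<^sup>+x. ennreal (exp (u * x)) \<partial>std_normal_distribution) = ennreal (exp (u\<^sup>2 / 2))"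
proof -
  have "(\<integral>\<^sup>+x. ennreal (exp (u * x)) \<partial>std_normal_distribution)
      = (\<integral>\<^sup>+x. ennreal (exp (u\<^sup>2 / 2)) * ennreal (normal_density u 1 x) \<partial>lborel)"
  proof (subst nn_integral_density, simp, simp, rule nn_integral_cong)
    fix x :: real
    have "std_normal_density x * exp (u * x) = exp (u\<^sup>2 / 2) * normal_density u 1 x"
      unfolding normal_density_def by (simp add: exp_add[symmetric] power2_eq_square field_simps)
    then show "ennreal (std_normal_density x) * ennreal (exp (u * x)) = ennreal (exp (u\<^sup>2 / 2)) * ennreal (normal_density u 1 x)"
      by (simp add: ennreal_mult[symmetric])
  qed
  also have "\<dots> = ennreal (exp (u\<^sup>2 / 2))" by (simp add: nn_integral_cmult nn_integral_normal_density)
  finally show ?thesis .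
qed

lemma std_normal_exp_square:
  assumes "\<theta> < 1/2"
  shows "(\<integral>\<^sup>+x. ennreal (exp (\<theta> * x\<^sup>2)) \<partial>std_normal_distribution) = ennreal (1 / sqrt (1 - 2 * \<theta>))"
proof -
  define \<sigma> where "\<sigma> = 1 / sqrt (1 - 2 * \<theta>)"
  have pos: "0 < 1 - 2 * \<theta>" "0 < \<sigma>" using assms by (auto simp: \<sigma>_def)
  have \<sigma>2: "\<sigma>\<^sup>2 = 1 / (1 - 2 * \<theta>)" using pos by (simp add: \<sigma>_def power_divide)
  have "(\<integral>\<^sup>+x. ennreal (exp (\<theta> * x\<^sup>2)) \<partial>std_normal_distribution)
      = (\<integral>\<^sup>+x. ennreal \<sigma> * ennreal (normal_density 0 \<sigma> x) \<partial>lborel)"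
  proof (subst nn_integral_density, simp, simp, rule nn_integral_cong)
    fix x :: real
    have 1: "sqrt (2 * pi * \<sigma>\<^sup>2) = sqrt (2 * pi) * \<sigma>" using pos by (simp add: real_sqrt_mult)
    have "- (x - 0)\<^sup>2 / (2 * \<sigma>\<^sup>2) = - x\<^sup>2 / 2 + \<theta> * x\<^sup>2"
      unfolding \<sigma>2 using pos by (simp add: field_simps)
    then have 2: "exp (- (x - 0)\<^sup>2 / (2 * \<sigma>\<^sup>2)) = exp (- x\<^sup>2 / 2) * exp (\<theta> * x\<^sup>2)"
      by (simp only: exp_add)
    have "std_normal_density x * exp (\<theta> * x\<^sup>2) = \<sigma> * normal_density 0 \<sigma> x"
      unfolding std_normal_density_def unfolding normal_density_def 1 2 using pos(2) by simp
    then show "ennreal (std_normal_density x) * ennreal (exp (\<theta> * x\<^sup>2)) = ennreal \<sigma> * ennreal (normal_density 0 \<sigma> x)"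
      using pos by (simp add: ennreal_mult[symmetric])
  qed
  also have "\<dots> = ennreal \<sigma>" using pos by (simp add: nn_integral_cmult nn_integral_normal_density)
  finally show ?thesis by (simp add: \<sigma>_def)
qed

section \<open>Limits in mean square\<close>

lemma norm_iexp_diff_le: "cmod (iexp a - iexp b) \<le> \<bar>a - b\<bar>"
proof -
  have "iexp a - iexp b = iexp b * (iexp (a - b) - 1)"
    by (simp add: right_diff_distrib exp_add[symmetric])
  then have "cmod (iexp a - iexp b) = cmod (iexp (a - b) - 1)" by (simp add: norm_mult)
  also have "\<dots> \<le> \<bar>a - b\<bar>" using iexp_approx1[of "a - b" 0] by simp
  finally show ?thesis .
qed

lemma abs_le_weighted_square:
  fixes x e :: real assumes "0 < e" shows "\<bar>x\<bar> \<le> e + x\<^sup>2 / e"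
proof -
  have "0 \<le> (\<bar>x\<bar> - e)\<^sup>2 + \<bar>x\<bar> * e" using assms by simp
  also have "\<dots> = x\<^sup>2 + e\<^sup>2 - e * \<bar>x\<bar>" by (simp add: power2_eq_square algebra_simps)
  finally have "\<bar>x\<bar> \<le> (e\<^sup>2 + x\<^sup>2) / e" using assms by (simp add: le_divide_eq mult.commute)
  then show ?thesis using assms by (simp add: add_divide_distrib power2_eq_square)
qed

lemma sq_norm_tendsto_imp_char_tendsto:
  fixes J :: "nat \<Rightarrow> 'a \<Rightarrow> real"
  assumes "prob_space Q" and [measurable]: "\<And>k. J k \<in> borel_measurable Q" "Y \<in> borel_measurable Q"
    and lim: "(\<lambda>k. sq_norm Q (\<lambda>\<omega>. J k \<omega> - Y \<omega>)) \<longlonglongrightarrow> 0"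
  shows "(\<lambda>k. \<integral>\<omega>. iexp (J k \<omega>) \<partial>Q) \<longlonglongrightarrow> (\<integral>\<omega>. iexp (Y \<omega>) \<partial>Q)"
proof (rule tendstoI)
  interpret prob_space Q by fact
  fix e :: real assume "0 < e"
  have "\<forall>\<^sub>F k in sequentially. sq_norm Q (\<lambda>\<omega>. J k \<omega> - Y \<omega>) < ennreal (e\<^sup>2 / 4)"
    using lim by (rule order_tendstoD) (use \<open>0 < e\<close> in simp)
  then show "\<forall>\<^sub>F k in sequentially. dist (\<integral>\<omega>. iexp (J k \<omega>) \<partial>Q) (\<integral>\<omega>. iexp (Y \<omega>) \<partial>Q) < e"
  proof eventually_elim
    fix k assume k: "sq_norm Q (\<lambda>\<omega>. J k \<omega> - Y \<omega>) < ennreal (e\<^sup>2 / 4)"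
    have i: "integrable Q (\<lambda>\<omega>. (J k \<omega> - Y \<omega>)\<^sup>2)"
      using k by (intro integrable_square_of_sq_norm) (auto intro: less_trans)
    then have small: "(\<integral>\<omega>. (J k \<omega> - Y \<omega>)\<^sup>2 \<partial>Q) < e\<^sup>2 / 4"
      using k by (simp add: sq_norm_eq_integral ennreal_less_iff integral_nonneg)
    have int: "integrable Q (\<lambda>\<omega>. iexp (J k \<omega>))" "integrable Q (\<lambda>\<omega>. iexp (Y \<omega>))"
      by (rule integrable_const_bound[of _ 1]; simp)+
    have "dist (\<integral>\<omega>. iexp (J k \<omega>) \<partial>Q) (\<integral>\<omega>. iexp (Y \<omega>) \<partial>Q) = cmod (\<integral>\<omega>. iexp (J k \<omega>) - iexp (Y \<omega>) \<partial>Q)"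
      using int by (simp add: dist_norm)
    also have "\<dots> \<le> (\<integral>\<omega>. cmod (iexp (J k \<omega>) - iexp (Y \<omega>)) \<partial>Q)" by (rule integral_norm_bound)
    also have "\<dots> \<le> (\<integral>\<omega>. e / 2 + (J k \<omega> - Y \<omega>)\<^sup>2 / (e / 2) \<partial>Q)"
    proof (rule integral_mono)
      fix \<omega>
      show "cmod (iexp (J k \<omega>) - iexp (Y \<omega>)) \<le> e / 2 + (J k \<omega> - Y \<omega>)\<^sup>2 / (e / 2)"
        by (rule order.trans[OF norm_iexp_diff_le abs_le_weighted_square]) (use \<open>0 < e\<close> in simp)
    qed (use i int in auto)
    also have "\<dots> = e / 2 + (\<integral>\<omega>. (J k \<omega> - Y \<omega>)\<^sup>2 \<partial>Q) / (e / 2)"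
      using i by (subst Bochner_Integration.integral_add) (auto simp: prob_space)
    also have "\<dots> < e / 2 + (e\<^sup>2 / 4) / (e / 2)"
      using small \<open>0 < e\<close> by (intro add_strict_left_mono divide_strict_right_mono) auto
    also have "\<dots> = e" using \<open>0 < e\<close> by (simp add: power2_eq_square)
    finally show "dist (\<integral>\<omega>. iexp (J k \<omega>) \<partial>Q) (\<integral>\<omega>. iexp (Y \<omega>) \<partial>Q) < e" .
  qed
qed

lemma abs_diff_squares_le:
  fixes x y a :: real
  assumes a: "0 < a"
  shows "\<bar>x\<^sup>2 - y\<^sup>2\<bar> \<le> (1 + 1 / a) * (x - y)\<^sup>2 + a * y\<^sup>2"
proof -
  define z where "z = x - y"
  have id: "(a * p - z)\<^sup>2 / a = a * p\<^sup>2 + z\<^sup>2 / a - 2 * p * z" for p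
    using a by (simp add: field_simps power2_eq_square)
  have "0 \<le> (a * p - z)\<^sup>2 / a" for p using a by simp
  from this[of y] this[of "- y"]
  have 1: "2 * y * z \<le> a * y\<^sup>2 + z\<^sup>2 / a" "- (2 * y * z) \<le> a * y\<^sup>2 + z\<^sup>2 / a"
    unfolding id by simp_all
  have 2: "x\<^sup>2 - y\<^sup>2 = 2 * y * z + z\<^sup>2" by (simp add: z_def power2_eq_square algebra_simps)
  have 3: "(1 + 1 / a) * (x - y)\<^sup>2 + a * y\<^sup>2 = z\<^sup>2 + (a * y\<^sup>2 + z\<^sup>2 / a)"
    by (simp add: z_def distrib_right)
  show ?thesis unfolding 2 3 using 1 zero_le_power2[of z] by linarith
qed

lemma sq_norm_tendsto_imp_integral_sq_tendsto:
  fixes g :: "nat \<Rightarrow> 'a \<Rightarrow> real"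
  assumes [measurable]: "\<And>k. g k \<in> borel_measurable R" "f \<in> borel_measurable R"
    and ig: "\<And>k. integrable R (\<lambda>x. (g k x)\<^sup>2)" and if2: "integrable R (\<lambda>x. (f x)\<^sup>2)"
    and lim: "(\<lambda>k. sq_norm R (\<lambda>x. g k x - f x)) \<longlonglongrightarrow> 0"
  shows "(\<lambda>k. \<integral>x. (g k x)\<^sup>2 \<partial>R) \<longlonglongrightarrow> (\<integral>x. (f x)\<^sup>2 \<partial>R)"
proof (rule tendstoI)
  fix e :: real assume "0 < e"
  define B where "B = (\<integral>x. (f x)\<^sup>2 \<partial>R)"
  have B: "0 \<le> B" by (simp add: B_def integral_nonneg)
  define a where "a = e / (2 * (B + 1))"
  have a: "0 < a" "a * B < e / 2" using \<open>0 < e\<close> B by (auto simp: a_def field_simps)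
  define d where "d = (e / 2) / (1 + 1 / a)"
  have d: "0 < d" using \<open>0 < e\<close> a by (auto simp: d_def intro!: divide_pos_pos add_pos_pos)
  have "\<forall>\<^sub>F k in sequentially. sq_norm R (\<lambda>x. g k x - f x) < ennreal d"
    using lim by (rule order_tendstoD) (use d in simp)
  then show "\<forall>\<^sub>F k in sequentially. dist (\<integral>x. (g k x)\<^sup>2 \<partial>R) (\<integral>x. (f x)\<^sup>2 \<partial>R) < e"
  proof eventually_elim
    fix k assume k: "sq_norm R (\<lambda>x. g k x - f x) < ennreal d"
    have i: "integrable R (\<lambda>x. (g k x - f x)\<^sup>2)"
      using k by (intro integrable_square_of_sq_norm) (auto intro: less_trans)
    then have small: "(\<integral>x. (g k x - f x)\<^sup>2 \<partial>R) < d"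
      using k by (simp add: sq_norm_eq_integral ennreal_less_iff integral_nonneg)
    have "dist (\<integral>x. (g k x)\<^sup>2 \<partial>R) (\<integral>x. (f x)\<^sup>2 \<partial>R) = \<bar>\<integral>x. (g k x)\<^sup>2 - (f x)\<^sup>2 \<partial>R\<bar>"
      using ig if2 by (simp add: dist_real_def)
    also have "\<dots> \<le> (\<integral>x. \<bar>(g k x)\<^sup>2 - (f x)\<^sup>2\<bar> \<partial>R)" by (rule integral_abs_bound)
    also have "\<dots> \<le> (\<integral>x. (1 + 1 / a) * (g k x - f x)\<^sup>2 + a * (f x)\<^sup>2 \<partial>R)"
    proof (rule integral_mono)
      fix x
      show "\<bar>(g k x)\<^sup>2 - (f x)\<^sup>2\<bar> \<le> (1 + 1 / a) * (g k x - f x)\<^sup>2 + a * (f x)\<^sup>2"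
        by (rule abs_diff_squares_le[OF a(1)])
    qed (use i ig if2 in auto)
    also have "\<dots> = (1 + 1 / a) * (\<integral>x. (g k x - f x)\<^sup>2 \<partial>R) + a * B"
      using i if2 unfolding B_def by (subst Bochner_Integration.integral_add) auto
    also have "\<dots> < (1 + 1 / a) * d + e / 2"
      using small a by (intro add_strict_mono mult_strict_left_mono) (auto intro: add_pos_pos)
    also have "(1 + 1 / a) * d = e / 2"
    proof -
      have "1 + 1 / a \<noteq> 0" using a(1) by (intro less_imp_neq[symmetric] add_pos_pos) auto
      moreover have "q * ((e / 2) / q) = e / 2" if "q \<noteq> 0" for q using that by simp
      ultimately show ?thesis unfolding d_def by blast
    qed
    finally show "dist (\<integral>x. (g k x)\<^sup>2 \<partial>R) (\<integral>x. (f x)\<^sup>2 \<partial>R) < e" by simp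
  qed
qed

lemma sq_norm_lincomb_tendsto:
  assumes [measurable]: "\<And>k. J k \<in> borel_measurable R" "\<And>k. L k \<in> borel_measurable R"
    and "(\<lambda>k. sq_norm R (J k)) \<longlonglongrightarrow> 0" "(\<lambda>k. sq_norm R (L k)) \<longlonglongrightarrow> 0"
  shows "(\<lambda>k. sq_norm R (\<lambda>x. a * J k x + b * L k x)) \<longlonglongrightarrow> 0"
proof (rule tendsto_sandwich[OF _ _ tendsto_const])
  have t: "(\<lambda>k. ennreal (2 * c\<^sup>2) * sq_norm R (H k)) \<longlonglongrightarrow> 0" if "(\<lambda>k. sq_norm R (H k)) \<longlonglongrightarrow> 0" for c :: real and H
    using ennreal_tendsto_cmult[OF _ that, of "ennreal (2 * c\<^sup>2)"] by simp
  show "(\<lambda>k. ennreal (2 * a\<^sup>2) * sq_norm R (J k) + ennreal (2 * b\<^sup>2) * sq_norm R (L k)) \<longlonglongrightarrow> 0"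
    using tendsto_add[OF t[OF assms(3)] t[OF assms(4)]] by simp
  show "\<forall>\<^sub>F k in sequentially. sq_norm R (\<lambda>x. a * J k x + b * L k x)
      \<le> ennreal (2 * a\<^sup>2) * sq_norm R (J k) + ennreal (2 * b\<^sup>2) * sq_norm R (L k)"
  proof (rule always_eventually, rule allI)
    fix k
    have "sq_norm R (\<lambda>x. a * J k x + b * L k x) \<le> 2 * sq_norm R (\<lambda>x. a * J k x) + 2 * sq_norm R (\<lambda>x. b * L k x)"
      by (intro sq_norm_add_le) measurable
    then show "sq_norm R (\<lambda>x. a * J k x + b * L k x)
      \<le> ennreal (2 * a\<^sup>2) * sq_norm R (J k) + ennreal (2 * b\<^sup>2) * sq_norm R (L k)"
      by (simp add: sq_norm_cmult ennreal_mult mult.assoc)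
  qed
qed simp

section \<open>The Ito integral of deterministic integrands\<close>

lemma incr_sum_cmult: "incr_sum K (\<lambda>k. u * c k) a b x = u * incr_sum K c a b x"
  by (simp add: incr_sum_def sum_distrib_left mult.assoc)

lemma incr_fun_cmult: "incr_fun K (\<lambda>k. u * c k) a b x = u * incr_fun K c a b x"
  by (simp add: incr_fun_def sum_distrib_left mult.assoc)

lemma incr_sum_diff_Plus:
  assumes "finite K" "finite L"
  shows "incr_sum (K <+> L) (case_sum c (\<lambda>l. - d l)) (case_sum a a') (case_sum b b') x
    = incr_sum K c a b x - incr_sum L d a' b' x"
  using assms by (simp add: incr_sum_def sum.Plus sum_negf)

lemma incr_fun_diff_Plus:
  assumes "finite K" "finite L"
  shows "incr_fun (K <+> L) (case_sum c (\<lambda>l. - d l)) (case_sum a a') (case_sum b b')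
    = (\<lambda>x. incr_fun K c a b x - incr_fun L d a' b' x)"
  unfolding incr_fun_def sum.Plus[OF assms] fun_eq_iff
  by (simp only: o_def sum.case mult_minus_left sum_negf add_uminus_conv_diff simp_thms)

lemma step_fun_eq_incr_fun: "step_fun n t c = incr_fun {..<n} c t (\<lambda>k. t (Suc k))"
  by (rule ext) (simp add: step_fun_def incr_fun_def)

lemma step_integral_eq_incr_sum:
  "step_integral X n t c \<omega> = incr_sum {..<n} c t (\<lambda>k. t (Suc k)) (\<lambda>s. X s \<omega>)"
  by (simp add: step_integral_def incr_sum_def)

text \<open>What the construction of the integral needs to know about the integrator. The sum type as index set
  leaves room for the difference of two step integrals on unrelated partitions.\<close>

locale gaussian_increments = stieltjes_clock A T + prob_space Q
  for A :: "real \<Rightarrow> real" and T :: real and Q :: "'b measure" +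
  fixes X :: "real \<Rightarrow> 'b \<Rightarrow> real"
  assumes X_measurable: "t \<in> {0..T} \<Longrightarrow> X t \<in> borel_measurable Q"
    and char_X: "finite (K :: (nat + nat) set) \<Longrightarrow> (\<And>k. k \<in> K \<Longrightarrow> 0 \<le> a k \<and> a k \<le> b k \<and> b k \<le> T) \<Longrightarrow>
      (\<integral>\<omega>. iexp (incr_sum K c a b (\<lambda>t. X t \<omega>)) \<partial>Q) = of_real (exp (- (\<integral>s. (incr_fun K c a b s)\<^sup>2 \<partial>S) / 2))"
begin

lemma incr_sum_measurable:
  assumes "\<And>k. k \<in> K \<Longrightarrow> 0 \<le> a k \<and> a k \<le> b k \<and> b k \<le> T"
  shows "(\<lambda>\<omega>. incr_sum K c a b (\<lambda>t. X t \<omega>)) \<in> borel_measurable Q"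
proof -
  have "a k \<in> {0..T}" "b k \<in> {0..T}" if "k \<in> K" for k using assms[OF that] by auto
  then show ?thesis unfolding incr_sum_def
    by (intro borel_measurable_sum borel_measurable_times borel_measurable_const borel_measurable_diff X_measurable)
qed

text \<open>The second moment is read off from the Gaussian law.\<close>

lemma Ito_isometry:
  assumes "finite (K :: (nat + nat) set)" "\<And>k. k \<in> K \<Longrightarrow> 0 \<le> a k \<and> a k \<le> b k \<and> b k \<le> T"
  shows "sq_norm Q (\<lambda>\<omega>. incr_sum K c a b (\<lambda>t. X t \<omega>)) = sq_norm S (incr_fun K c a b)"
proof -
  define v where "v = (\<integral>s. (incr_fun K c a b s)\<^sup>2 \<partial>S)"
  have v: "0 \<le> v" by (simp add: v_def integral_nonneg)
  have "distr Q borel (\<lambda>\<omega>. incr_sum K c a b (\<lambda>t. X t \<omega>)) = gauss (sqrt v)"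
  proof (rule distr_eq_gaussI[OF prob_space_axioms incr_sum_measurable[OF assms(2)]])
    fix u
    have "(\<integral>\<omega>. iexp (u * incr_sum K c a b (\<lambda>t. X t \<omega>)) \<partial>Q) = (\<integral>\<omega>. iexp (incr_sum K (\<lambda>k. u * c k) a b (\<lambda>t. X t \<omega>)) \<partial>Q)"
      by (simp only: incr_sum_cmult)
    also have "\<dots> = of_real (exp (- (\<integral>s. (incr_fun K (\<lambda>k. u * c k) a b s)\<^sup>2 \<partial>S) / 2))"
      using assms by (rule char_X)
    also have "(\<integral>s. (incr_fun K (\<lambda>k. u * c k) a b s)\<^sup>2 \<partial>S) = (sqrt v * u)\<^sup>2"
      using v by (simp add: incr_fun_cmult power_mult_distrib v_def)
    finally show "(\<integral>\<omega>. iexp (u * incr_sum K c a b (\<lambda>t. X t \<omega>)) \<partial>Q) = of_real (exp (- (sqrt v * u)\<^sup>2 / 2))" .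
  qed
  then have "sq_norm Q (\<lambda>\<omega>. incr_sum K c a b (\<lambda>t. X t \<omega>)) = ennreal ((sqrt v)\<^sup>2)"
    using incr_sum_measurable[OF assms(2)] by (rule sq_norm_gauss)
  also have "\<dots> = sq_norm S (incr_fun K c a b)"
    using v by (simp add: sq_norm_eq_integral[OF integrable_incr_fun_sq] v_def)
  finally show ?thesis .
qed

text \<open>The approximations along the common grids are linear in the integrand, and so are their
  limits.\<close>

definition Ito_approx :: "(real \<Rightarrow> real) \<Rightarrow> nat \<Rightarrow> 'b \<Rightarrow> real" where
  "Ito_approx f n \<omega> = step_integral X (Suc n) (grid T n) (\<lambda>k. f (grid T n k)) \<omega>"

definition Ito_limit :: "(real \<Rightarrow> real) \<Rightarrow> ('b \<Rightarrow> real) \<Rightarrow> bool" where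
  "Ito_limit f Y \<longleftrightarrow> Y \<in> borel_measurable Q \<and> (\<lambda>n. sq_norm Q (\<lambda>\<omega>. Ito_approx f n \<omega> - Y \<omega>)) \<longlonglongrightarrow> 0"

definition step_approx :: "(real \<Rightarrow> real) \<Rightarrow> nat \<Rightarrow> real \<Rightarrow> real" where
  "step_approx f n = step_fun (Suc n) (grid T n) (\<lambda>k. f (grid T n k))"

lemma grid_partition: "step_partition T (Suc n) (grid T n)"
  unfolding step_partition_def using grid_in[OF T_pos, of _ n] grid_mono[OF T_pos] by auto

lemma partition_bounds:
  assumes "step_partition T n t" "k < n"
  shows "0 \<le> t k \<and> t k \<le> t (Suc k) \<and> t (Suc k) \<le> T"
  using assms less_imp_le[OF assms(2)] Suc_leI[OF assms(2)] unfolding step_partition_def by auto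

lemma step_integral_measurable:
  "step_partition T n t \<Longrightarrow> (\<lambda>\<omega>. step_integral X n t c \<omega>) \<in> borel_measurable Q"
  unfolding step_integral_eq_incr_sum by (intro incr_sum_measurable partition_bounds) auto

lemma Ito_approx_measurable [measurable]: "Ito_approx f n \<in> borel_measurable Q"
  unfolding Ito_approx_def[abs_def] by (rule step_integral_measurable[OF grid_partition])

lemma step_fun_measurable [measurable]: "step_fun n t c \<in> borel_measurable borel"
  unfolding step_fun_eq_incr_fun by measurable

lemma step_approx_measurable: "step_approx f n \<in> borel_measurable S"
  unfolding step_approx_def by (intro borel_imp_measurable_stieltjes) measurable

lemma char_step_integral:
  assumes "step_partition T n t"
  shows "(\<integral>\<omega>. iexp (u * step_integral X n t c \<omega>) \<partial>Q) = of_real (exp (- (u\<^sup>2 * (\<integral>s. (step_fun n t c s)\<^sup>2 \<partial>S)) / 2))"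
proof -
  let ?K = "{..<n} <+> ({} :: nat set)" and ?c = "case_sum (\<lambda>k. u * c k) (\<lambda>l. - 0)"
    and ?a = "case_sum t (\<lambda>_. 0)" and ?b = "case_sum (\<lambda>k. t (Suc k)) (\<lambda>_. 0)"
  have z: "incr_sum ({} :: nat set) d a b x = 0" "incr_fun ({} :: nat set) d a b s = 0" for d a b x s
    by (simp_all add: incr_sum_def incr_fun_def)
  have "(\<integral>\<omega>. iexp (incr_sum ?K ?c ?a ?b (\<lambda>t. X t \<omega>)) \<partial>Q) = of_real (exp (- (\<integral>s. (incr_fun ?K ?c ?a ?b s)\<^sup>2 \<partial>S) / 2))"
    using partition_bounds[OF assms] by (intro char_X) (auto simp: Plus_def)
  then show ?thesis
    unfolding step_integral_eq_incr_sum step_fun_eq_incr_fun incr_sum_diff_Plus[OF finite_lessThan finite.emptyI]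
      incr_fun_diff_Plus[OF finite_lessThan finite.emptyI]
    by (simp only: z diff_0_right incr_sum_cmult incr_fun_cmult power_mult_distrib integral_mult_right_zero)
qed

lemma step_integral_diff_isometry:
  assumes "step_partition T n t" "step_partition T m u"
  shows "sq_norm Q (\<lambda>\<omega>. step_integral X n t c \<omega> - step_integral X m u d \<omega>)
    = sq_norm S (\<lambda>s. step_fun n t c s - step_fun m u d s)"
proof -
  have "sq_norm Q (\<lambda>\<omega>. incr_sum ({..<n} <+> {..<m}) (case_sum c (\<lambda>l. - d l)) (case_sum t u)
      (case_sum (\<lambda>k. t (Suc k)) (\<lambda>k. u (Suc k))) (\<lambda>t. X t \<omega>))
    = sq_norm S (incr_fun ({..<n} <+> {..<m}) (case_sum c (\<lambda>l. - d l)) (case_sum t u)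
      (case_sum (\<lambda>k. t (Suc k)) (\<lambda>k. u (Suc k))))"
    using partition_bounds[OF assms(1)] partition_bounds[OF assms(2)]
    by (intro Ito_isometry) (auto simp: Plus_def)
  then show ?thesis
    unfolding step_integral_eq_incr_sum step_fun_eq_incr_fun
    by (simp add: incr_sum_diff_Plus incr_fun_diff_Plus)
qed

text \<open>Step functions built from left-open intervals vanish at \<open>0\<close>, which is immaterial because a continuous
  \<^term>\<open>A\<close> gives no mass to points.\<close>

lemma AE_S_pos: "AE s in S. s \<in> {0<..T}"
proof (rule AE_I)
  show "{s \<in> space S. \<not> s \<in> {0<..T}} \<subseteq> {0}" by auto
  have 0: "{0} \<in> sets S" unfolding sets_stieltjes using T_pos by (subst sets_restrict_space_iff) auto
  have "{0..T} = {0} \<union> {0<..T}" using T_pos by auto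
  moreover have "measure S ({0} \<union> {0<..T}) = measure S {0} + measure S {0<..T}"
    by (rule S.finite_measure_Union) (use 0 in \<open>auto intro: Ioc_in_sets_S\<close>)
  ultimately have "measure S {0..T} = measure S {0} + measure S {0<..T}" by simp
  moreover have "measure S {0..T} = A T - A 0" "measure S {0<..T} = A T - A 0"
    using emeasure_S_Icc measure_S_Ioc[of 0 T] T_pos mono_onD[OF A_mono, of 0 T] by (auto simp: measure_def)
  ultimately have "measure S {0} = 0" by simp
  then show "emeasure S {0} = 0" by (simp add: S.emeasure_eq_measure)
  show "{0} \<in> sets S" by (rule 0)
qed

lemma step_approx_tendsto:
  assumes f: "continuous_on {0..T} f"
  shows "(\<lambda>n. sq_norm S (\<lambda>s. step_approx f n s - f s)) \<longlonglongrightarrow> 0"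
proof (rule order_tendstoI)
  fix a :: ennreal assume "0 < a"
  define B where "B = measure S (space S) + 1"
  have B: "0 < B" by (simp add: B_def add_nonneg_pos)
  obtain e :: real where e: "0 < e" "ennreal e < a"
  proof (cases a)
    case (real r)
    then show ?thesis using \<open>0 < a\<close> that[of "r / 2"] by (simp add: ennreal_less_iff)
  next
    case top
    then show ?thesis using that[of 1] by simp
  qed
  define \<delta> where "\<delta> = sqrt (e / B)"
  have \<delta>: "0 < \<delta>" "\<delta>\<^sup>2 = e / B" using e B by (auto simp: \<delta>_def)
  from grid_oscillation_small[OF T_pos f \<delta>(1)]
  show "\<forall>\<^sub>F n in sequentially. sq_norm S (\<lambda>s. step_approx f n s - f s) < a"
  proof eventually_elim
    fix n assume osc: "\<forall>j\<le>n. \<forall>s\<in>{grid T n j..grid T n (Suc j)}. \<bar>f s - f (grid T n j)\<bar> < \<delta>"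
    have "sq_norm S (\<lambda>s. step_approx f n s - f s) \<le> (\<integral>\<^sup>+s. ennreal (\<delta>\<^sup>2) \<partial>S)"
      unfolding sq_norm_def
    proof (rule nn_integral_mono_AE, use AE_S_pos in eventually_elim)
      fix s assume s: "s \<in> {0<..T}"
      define j where "j = idx T n s - 1"
      have pos: "0 < s * real (Suc n) / T" using s T_pos by simp
      then have idx: "0 < idx T n s" by (simp add: idx_def)
      then have j: "j \<le> n" "Suc j = idx T n s" using idx_le[OF T_pos, of s n] s by (auto simp: j_def)
      have "real (idx T n s) < s * real (Suc n) / T + 1"
        using pos unfolding idx_def by linarith
      then have "real j < s * real (Suc n) / T" using j(2) by linarith
      then have lt: "grid T n j < s" unfolding grid_def using T_pos by (simp add: field_simps)
      have le: "s \<le> grid T n (Suc j)" unfolding j(2) by (rule grid_idx_ge[OF T_pos])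
      have ind: "indicator {grid T n i<..grid T n (Suc i)} s = (if i = j then 1 else 0 :: real)" for i
      proof -
        have "s \<notin> {grid T n i<..grid T n (Suc i)}" if "i < j"
          using grid_mono[OF T_pos, of "Suc i" j n] that lt by auto
        moreover have "s \<notin> {grid T n i<..grid T n (Suc i)}" if "j < i"
          using grid_mono[OF T_pos, of "Suc j" i n] that le by auto
        ultimately show ?thesis using lt le by (cases i j rule: linorder_cases) auto
      qed
      have "step_approx f n s = f (grid T n j)"
        unfolding step_approx_def step_fun_def ind using j(1) by (simp add: if_distrib sum.delta cong: if_cong)
      then have "\<bar>step_approx f n s - f s\<bar> \<le> \<delta>"
        using osc[rule_format, OF j(1), of s] lt le by (simp add: abs_minus_commute)
      then have "(step_approx f n s - f s)\<^sup>2 \<le> \<delta>\<^sup>2" using \<delta>(1) by (simp add: abs_le_square_iff[symmetric])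
      then show "ennreal ((step_approx f n s - f s)\<^sup>2) \<le> ennreal (\<delta>\<^sup>2)" by (rule ennreal_leI)
    qed
    also have "\<dots> = ennreal (\<delta>\<^sup>2 * measure S (space S))" by (simp add: S.emeasure_eq_measure ennreal_mult)
    also have "\<dots> \<le> ennreal e"
      unfolding \<delta>(2) using e B by (intro ennreal_leI) (simp add: B_def field_simps)
    also have "\<dots> < a" by (rule e)
    finally show "sq_norm S (\<lambda>s. step_approx f n s - f s) < a" .
  qed
qed simp

lemma Ito_limit_exists:
  assumes f: "continuous_on {0..T} f"
  shows "\<exists>Y. Ito_limit f Y"
proof -
  have mf: "f \<in> borel_measurable S" by (rule continuous_on_imp_measurable_stieltjes[OF f])
  have "\<exists>Z\<in>borel_measurable Q. (\<lambda>n. sq_norm Q (\<lambda>x. Ito_approx f n x - Z x)) \<longlonglongrightarrow> 0"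
  proof (rule sq_norm_Cauchy_imp_converges)
    show "finite_measure Q" by unfold_locales
    fix e :: real assume "0 < e"
    have "\<forall>\<^sub>F n in sequentially. sq_norm S (\<lambda>s. step_approx f n s - f s) < ennreal (e / 4)"
      using step_approx_tendsto[OF f] by (rule order_tendstoD) (use \<open>0 < e\<close> in simp)
    then obtain n0 where n0: "\<And>n. n \<ge> n0 \<Longrightarrow> sq_norm S (\<lambda>s. step_approx f n s - f s) < ennreal (e / 4)"
      by (auto simp: eventually_sequentially)
    show "\<exists>n0. \<forall>n\<ge>n0. \<forall>m\<ge>n0. sq_norm Q (\<lambda>x. Ito_approx f n x - Ito_approx f m x) \<le> ennreal e"
    proof (intro exI allI impI)
      fix n m assume nm: "n0 \<le> n" "n0 \<le> m"
      have "sq_norm Q (\<lambda>x. Ito_approx f n x - Ito_approx f m x) = sq_norm S (\<lambda>s. step_approx f n s - step_approx f m s)"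
        unfolding Ito_approx_def step_approx_def by (rule step_integral_diff_isometry[OF grid_partition grid_partition])
      also have "\<dots> = sq_norm S (\<lambda>s. (step_approx f n s - f s) + (f s - step_approx f m s))" by simp
      also have "\<dots> \<le> 2 * sq_norm S (\<lambda>s. step_approx f n s - f s) + 2 * sq_norm S (\<lambda>s. f s - step_approx f m s)"
        using mf step_approx_measurable by (intro sq_norm_add_le) auto
      also have "\<dots> \<le> 2 * ennreal (e / 4) + 2 * ennreal (e / 4)"
        using n0[OF nm(1)] n0[OF nm(2)]
        by (intro add_mono mult_left_mono) (auto simp: sq_norm_minus_commute[of S f] less_imp_le)
      also have "\<dots> = ennreal e"
      proof -
        have "2 * ennreal (e / 4) = ennreal (e / 2)"
          using \<open>0 < e\<close> by (subst ennreal_numeral[symmetric], subst ennreal_mult[symmetric]) auto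
        then show ?thesis using \<open>0 < e\<close> by (simp flip: ennreal_plus)
      qed
      finally show "sq_norm Q (\<lambda>x. Ito_approx f n x - Ito_approx f m x) \<le> ennreal e" .
    qed
  qed simp
  then show ?thesis by (auto simp: Ito_limit_def)
qed

lemma Ito_limit_linear:
  assumes "Ito_limit f Y" "Ito_limit g Z"
  shows "Ito_limit (\<lambda>s. a * f s + b * g s) (\<lambda>\<omega>. a * Y \<omega> + b * Z \<omega>)"
proof -
  have [measurable]: "Y \<in> borel_measurable Q" "Z \<in> borel_measurable Q" using assms by (auto simp: Ito_limit_def)
  have eq: "Ito_approx (\<lambda>s. a * f s + b * g s) n \<omega> - (a * Y \<omega> + b * Z \<omega>)
      = a * (Ito_approx f n \<omega> - Y \<omega>) + b * (Ito_approx g n \<omega> - Z \<omega>)" for n \<omega>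
  proof -
    have "Ito_approx (\<lambda>s. a * f s + b * g s) n \<omega> = a * Ito_approx f n \<omega> + b * Ito_approx g n \<omega>"
      unfolding Ito_approx_def step_integral_def
      by (simp only: distrib_right sum.distrib sum_distrib_left mult.assoc)
    then show ?thesis by (simp add: algebra_simps)
  qed
  show ?thesis unfolding Ito_limit_def eq
    using assms by (intro conjI sq_norm_lincomb_tendsto) (auto simp: Ito_limit_def)
qed

lemma Ito_limit_imp_has_ito_integral:
  assumes "continuous_on {0..T} f" "Ito_limit f Y"
  shows "has_ito_integral Q X A T f Y"
  unfolding has_ito_integral_def
proof (intro conjI exI allI)
  show "step_partition T (Suc k) (grid T k)" for k by (rule grid_partition)
  show "(\<lambda>k. sq_norm S (\<lambda>s. step_fun (Suc k) (grid T k) (\<lambda>j. f (grid T k j)) s - f s)) \<longlonglongrightarrow> 0"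
    using step_approx_tendsto[OF assms(1)] by (simp add: step_approx_def)
  show "(\<lambda>k. sq_norm Q (\<lambda>\<omega>. step_integral X (Suc k) (grid T k) (\<lambda>j. f (grid T k j)) \<omega> - Y \<omega>)) \<longlonglongrightarrow> 0"
    using assms(2) by (simp add: Ito_limit_def Ito_approx_def)
qed (use assms continuous_on_imp_measurable_stieltjes in \<open>auto simp: Ito_limit_def\<close>)

text \<open>A version of the integral that is linear for every outcome: limits are chosen on a Hamel basis
  of the continuous functions.\<close>

lemma linear_ito_integral_exists:
  "\<exists>I. (\<forall>f. continuous_on {0..T} f \<longrightarrow> has_ito_integral Q X A T f (I f)) \<and>
     (\<forall>f g a b \<omega>. continuous_on {0..T} f \<and> continuous_on {0..T} g \<longrightarrow>
        I (\<lambda>s. a * f s + b * g s) \<omega> = a * I f \<omega> + b * I g \<omega>)"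
proof -
  interpret vs: vector_space_pair "\<lambda>(a::real) (f::real \<Rightarrow> real) s. a * f s" "\<lambda>(a::real) (Y::'b \<Rightarrow> real) \<omega>. a * Y \<omega>"
    by unfold_locales (auto simp: fun_eq_iff algebra_simps)
  define V where "V = {f :: real \<Rightarrow> real. continuous_on {0..T} f}"
  obtain B where B: "B \<subseteq> V" "vs.vs1.independent B" "V \<subseteq> vs.vs1.span B"
    by (rule vs.vs1.maximal_independent_subset)
  have "\<forall>f\<in>B. \<exists>Y. Ito_limit f Y" using B(1) Ito_limit_exists by (auto simp: V_def)
  then obtain Y where Y: "\<And>f. f \<in> B \<Longrightarrow> Ito_limit f (Y f)" by metis
  define I where "I = vs.construct B Y"
  interpret lin: Vector_Spaces.linear "\<lambda>(a::real) (f::real \<Rightarrow> real) s. a * f s" "\<lambda>(a::real) (Y::'b \<Rightarrow> real) \<omega>. a * Y \<omega>" I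
    unfolding I_def by (rule vs.linear_construct[OF B(2)])
  have I_lin: "I (\<lambda>s. a * f s + b * g s) = (\<lambda>\<omega>. a * I f \<omega> + b * I g \<omega>)" for a b f g
    using lin.add[of "\<lambda>s. a * f s" "\<lambda>s. b * g s"] lin.scale[of a f] lin.scale[of b g]
    by (simp add: plus_fun_def)
  have I_0: "I (\<lambda>s. 0) = (\<lambda>\<omega>. 0)" using lin.zero by (simp add: zero_fun_def)
  have "vs.vs1.span B \<subseteq> {f. Ito_limit f (I f)}"
  proof (rule vs.vs1.span_minimal)
    show "B \<subseteq> {f. Ito_limit f (I f)}" using Y by (auto simp: I_def vs.construct_basis[OF B(2)])
    show "vs.vs1.subspace {f. Ito_limit f (I f)}"
      unfolding vs.vs1.subspace_def
    proof safe
      show "Ito_limit 0 (I 0)"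
        by (simp add: zero_fun_def I_0 Ito_limit_def Ito_approx_def step_integral_def sq_norm_def)
      fix f g assume "Ito_limit f (I f)" "Ito_limit g (I g)"
      from Ito_limit_linear[OF this, of 1 1] I_lin[of 1 f 1 g]
      show "Ito_limit (f + g) (I (f + g))" by (simp add: plus_fun_def)
    next
      fix a f assume "Ito_limit f (I f)"
      from Ito_limit_linear[OF this this, of a 0] I_lin[of a f 0 f]
      show "Ito_limit (\<lambda>s. a * f s) (I (\<lambda>s. a * f s))" by simp
    qed
  qed
  then have "Ito_limit f (I f)" if "continuous_on {0..T} f" for f using B(3) that by (auto simp: V_def)
  then show ?thesis using I_lin by (intro exI[of _ I]) (auto intro: Ito_limit_imp_has_ito_integral)
qed

lemma ito_integral_spec:
  "(\<forall>f. continuous_on {0..T} f \<longrightarrow> has_ito_integral Q X A T f (ito_integral Q X A T f)) \<and>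
     (\<forall>f g a b \<omega>. continuous_on {0..T} f \<and> continuous_on {0..T} g \<longrightarrow>
        ito_integral Q X A T (\<lambda>s. a * f s + b * g s) \<omega> = a * ito_integral Q X A T f \<omega> + b * ito_integral Q X A T g \<omega>)"
  unfolding ito_integral_def by (rule someI_ex[OF linear_ito_integral_exists])

lemma ito_integral_has: "continuous_on {0..T} f \<Longrightarrow> has_ito_integral Q X A T f (ito_integral Q X A T f)"
  by (rule conjunct1[OF ito_integral_spec, rule_format])

lemma ito_integral_linear: "continuous_on {0..T} f \<Longrightarrow> continuous_on {0..T} g \<Longrightarrow>
    ito_integral Q X A T (\<lambda>s. a * f s + b * g s) \<omega> = a * ito_integral Q X A T f \<omega> + b * ito_integral Q X A T g \<omega>"
  by (intro mp[OF conjunct2[OF ito_integral_spec, THEN spec[of _ f], THEN spec[of _ g], THEN spec[of _ a],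
      THEN spec[of _ b], THEN spec[of _ \<omega>]]] conjI)

end

section \<open>The averaged noise\<close>

lemma sq_norm_sum_tendsto:
  assumes "finite I" and [measurable]: "\<And>i k. i \<in> I \<Longrightarrow> J i k \<in> borel_measurable R"
    and "\<And>i. i \<in> I \<Longrightarrow> (\<lambda>k. sq_norm R (J i k)) \<longlonglongrightarrow> 0"
  shows "(\<lambda>k. sq_norm R (\<lambda>x. \<Sum>i\<in>I. J i k x)) \<longlonglongrightarrow> 0"
  using assms
proof (induction I rule: finite_induct)
  case empty
  then show ?case by (simp add: sq_norm_def)
next
  case (insert i I)
  have "(\<lambda>k. sq_norm R (\<lambda>x. 1 * J i k x + 1 * (\<Sum>i\<in>I. J i k x))) \<longlonglongrightarrow> 0"
    using insert by (intro sq_norm_lincomb_tendsto borel_measurable_sum) auto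
  then show ?case using insert(1,2) by simp
qed

definition (in stieltjes_clock) nrm2 :: "(real \<Rightarrow> real) \<Rightarrow> real" where
  "nrm2 f = (\<integral>s. (f s)\<^sup>2 \<partial>S)"

text \<open>The setting of the estimation problem, without the models.\<close>

locale noisy_copies = det_qv_martingale P F M T A + Q: prob_space Q
  for P :: "'a measure" and F M T A and Q :: "'b measure" +
  fixes X :: "nat \<Rightarrow> real \<Rightarrow> 'b \<Rightarrow> real" and N :: nat
  assumes N_pos: "1 \<le> N"
    and copies: "independent_copies P T M N Q X"
begin

abbreviation "paths \<equiv> \<Pi>\<^sub>M t\<in>{0..T}. (borel :: real measure)"

lemma path_on_measurable_P: "path_on T M \<in> measurable P paths"
  unfolding path_on_def[abs_def] by (intro measurable_restrict M_measurable)

lemma path_on_measurable_Q: "i \<in> {1..N} \<Longrightarrow> path_on T (X i) \<in> measurable Q paths"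
  using copies unfolding independent_copies_def Q.indep_vars_def by auto

lemma path_indep: "Q.indep_vars (\<lambda>_. paths) (\<lambda>i. path_on T (X i)) {1..N}"
  using copies unfolding independent_copies_def by auto

lemma path_law: "i \<in> {1..N} \<Longrightarrow> distr Q paths (path_on T (X i)) = distr P paths (path_on T M)"
  using copies unfolding independent_copies_def by auto

lemma incr_sum_paths_measurable:
  assumes "\<And>k. k \<in> K \<Longrightarrow> a k \<in> {0..T} \<and> b k \<in> {0..T}"
  shows "incr_sum K c a b \<in> borel_measurable paths"
proof -
  have "(\<lambda>x. x t) \<in> borel_measurable paths" if "t \<in> {0..T}" for t
    using that by (rule measurable_component_singleton)
  then show ?thesis
    unfolding incr_sum_def[abs_def] using assms
    by (intro borel_measurable_sum borel_measurable_times borel_measurable_const borel_measurable_diff) auto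
qed

lemma incr_sum_path_on:
  assumes "\<And>k. k \<in> K \<Longrightarrow> a k \<in> {0..T} \<and> b k \<in> {0..T}"
  shows "incr_sum K c a b (path_on T Y \<omega>) = incr_sum K c a b (\<lambda>t. Y t \<omega>)"
  unfolding incr_sum_def path_on_def using assms by (intro sum.cong) auto

text \<open>The characteristic function of a combination of increments depends on the path law only.\<close>

lemma copy_gaussian:
  assumes i: "i \<in> {1..N}"
  shows "gaussian_increments A T Q (X i)"
proof (intro gaussian_increments.intro gaussian_increments_axioms.intro)
  show "stieltjes_clock A T" by unfold_locales
  show "prob_space Q" by unfold_locales
  fix t assume t: "t \<in> {0..T}"
  have "(\<lambda>\<omega>. path_on T (X i) \<omega> t) \<in> borel_measurable Q"
    by (rule measurable_compose[OF path_on_measurable_Q[OF i] measurable_component_singleton[OF t]])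
  then show "X i t \<in> borel_measurable Q" using t by (simp add: path_on_def)
next
  fix K :: "(nat + nat) set" and a b c
  assume K: "finite K" and ab: "\<And>k. k \<in> K \<Longrightarrow> 0 \<le> a k \<and> a k \<le> b k \<and> b k \<le> T"
  have in_T: "a k \<in> {0..T} \<and> b k \<in> {0..T}" if "k \<in> K" for k using ab[OF that] by auto
  have [measurable]: "incr_sum K c a b \<in> borel_measurable paths" by (rule incr_sum_paths_measurable[OF in_T])
  have m: "(\<lambda>x. iexp (incr_sum K c a b x)) \<in> borel_measurable paths" by measurable
  have "(\<integral>\<omega>. iexp (incr_sum K c a b (\<lambda>t. X i t \<omega>)) \<partial>Q) = (\<integral>\<omega>. iexp (incr_sum K c a b (path_on T (X i) \<omega>)) \<partial>Q)"
    by (simp only: incr_sum_path_on[OF in_T])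
  also have "\<dots> = (\<integral>x. iexp (incr_sum K c a b x) \<partial>distr Q paths (path_on T (X i)))"
    by (rule integral_distr[OF path_on_measurable_Q[OF i] m, symmetric])
  also have "\<dots> = (\<integral>x. iexp (incr_sum K c a b x) \<partial>distr P paths (path_on T M))"
    by (simp only: path_law[OF i])
  also have "\<dots> = (\<integral>\<omega>. iexp (incr_sum K c a b (path_on T M \<omega>)) \<partial>P)"
    by (rule integral_distr[OF path_on_measurable_P m])
  also have "\<dots> = (\<integral>\<omega>. iexp (incr_sum K c a b (\<lambda>t. M t \<omega>)) \<partial>P)"
    by (simp only: incr_sum_path_on[OF in_T])
  also have "\<dots> = of_real (exp (- (\<integral>s. (incr_fun K c a b s)\<^sup>2 \<partial>S) / 2))"
    by (rule char_incr_sum) (use K ab in auto)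
  finally show "(\<integral>\<omega>. iexp (incr_sum K c a b (\<lambda>t. X i t \<omega>)) \<partial>Q) = of_real (exp (- (\<integral>s. (incr_fun K c a b s)\<^sup>2 \<partial>S) / 2))" .
qed

abbreviation "stint i f \<equiv> ito_integral Q (X i) A T f"

definition W :: "(real \<Rightarrow> real) \<Rightarrow> 'b \<Rightarrow> real" where
  "W f \<omega> = (1 / real N) * (\<Sum>i=1..N. stint i f \<omega>)"

lemma stint_measurable: "i \<in> {1..N} \<Longrightarrow> continuous_on {0..T} f \<Longrightarrow> stint i f \<in> borel_measurable Q"
  using gaussian_increments.ito_integral_has[OF copy_gaussian] unfolding has_ito_integral_def by blast

lemma W_measurable: "continuous_on {0..T} f \<Longrightarrow> W f \<in> borel_measurable Q"
  unfolding W_def[abs_def] by (intro borel_measurable_times borel_measurable_const borel_measurable_sum stint_measurable) auto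

lemma W_linear:
  assumes "continuous_on {0..T} f" "continuous_on {0..T} g"
  shows "W (\<lambda>s. a * f s + b * g s) \<omega> = a * W f \<omega> + b * W g \<omega>"
proof -
  have "(\<Sum>i=1..N. stint i (\<lambda>s. a * f s + b * g s) \<omega>) = (\<Sum>i=1..N. a * stint i f \<omega> + b * stint i g \<omega>)"
    by (intro sum.cong refl gaussian_increments.ito_integral_linear[OF copy_gaussian] assms)
  then show ?thesis
    by (simp add: W_def sum.distrib sum_distrib_left[symmetric] distrib_left mult.left_commute)
qed

lemma W_sum:
  assumes "finite J" "\<And>j. j \<in> J \<Longrightarrow> continuous_on {0..T} (e j)"
  shows "W (\<lambda>s. \<Sum>j\<in>J. x j * e j s) \<omega> = (\<Sum>j\<in>J. x j * W (e j) \<omega>)"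
  using assms
proof (induction J rule: finite_induct)
  case empty
  show ?case using W_linear[of "\<lambda>_. 0" "\<lambda>_. 0" 0 0 \<omega>] by simp
next
  case (insert j J)
  have "continuous_on {0..T} (\<lambda>s. \<Sum>j\<in>J. x j * e j s)"
    using insert by (intro continuous_intros) auto
  then have "W (\<lambda>s. x j * e j s + 1 * (\<Sum>j\<in>J. x j * e j s)) \<omega> = x j * W (e j) \<omega> + 1 * W (\<lambda>s. \<Sum>j\<in>J. x j * e j s) \<omega>"
    using insert by (intro W_linear) auto
  then show ?case using insert by simp
qed

text \<open>The step integrals of different copies are independent as functions of the paths. Independence is used
  for them and carried to the stochastic integrals by the limit of the characteristic functions.\<close>

lemma char_sum_stint:
  assumes f: "continuous_on {0..T} f"
  shows "(\<integral>\<omega>. iexp (u * (\<Sum>i=1..N. stint i f \<omega>)) \<partial>Q) = of_real (exp (- (u\<^sup>2 * (\<integral>s. (f s)\<^sup>2 \<partial>S)) / 2)) ^ N"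
proof -
  have ito: "has_ito_integral Q (X i) A T f (stint i f)" if "i \<in> {1..N}" for i
    using that f by (intro gaussian_increments.ito_integral_has[OF copy_gaussian])
  have "\<forall>i\<in>{1..N}. \<exists>n t c. (\<forall>k. step_partition T (n k) (t k)) \<and>
        (\<lambda>k. sq_norm S (\<lambda>s. step_fun (n k) (t k) (c k) s - f s)) \<longlonglongrightarrow> 0 \<and>
        (\<lambda>k. sq_norm Q (\<lambda>\<omega>. step_integral (X i) (n k) (t k) (c k) \<omega> - stint i f \<omega>)) \<longlonglongrightarrow> 0"
    using ito unfolding has_ito_integral_def by blast
  then obtain n t c where part: "\<And>i k. i \<in> {1..N} \<Longrightarrow> step_partition T (n i k) (t i k)"
    and conv_S: "\<And>i. i \<in> {1..N} \<Longrightarrow> (\<lambda>k. sq_norm S (\<lambda>s. step_fun (n i k) (t i k) (c i k) s - f s)) \<longlonglongrightarrow> 0"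
    and conv_Q: "\<And>i. i \<in> {1..N} \<Longrightarrow> (\<lambda>k. sq_norm Q (\<lambda>\<omega>. step_integral (X i) (n i k) (t i k) (c i k) \<omega> - stint i f \<omega>)) \<longlonglongrightarrow> 0"
    unfolding bchoice_iff by blast
  define J where "J i k \<omega> = step_integral (X i) (n i k) (t i k) (c i k) \<omega>" for i k \<omega>
  define g where "g i k = step_fun (n i k) (t i k) (c i k)" for i k
  have Jm: "J i k \<in> borel_measurable Q" if "i \<in> {1..N}" for i k
    unfolding J_def[abs_def] by (rule gaussian_increments.step_integral_measurable[OF copy_gaussian part]) (rule that)+
  have indep: "Q.indep_vars (\<lambda>i. borel) (\<lambda>i \<omega>. u * J i k \<omega>) {1..N}" for k
  proof -
    define y where "y i x = u * incr_sum {..<n i k} (c i k) (t i k) (\<lambda>l. t i k (Suc l)) x" for i x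
    have in_T: "t i k l \<in> {0..T} \<and> t i k (Suc l) \<in> {0..T}" if "i \<in> {1..N}" "l \<in> {..<n i k}" for i l
      using part[OF that(1), of k] that(2) unfolding step_partition_def by auto
    have "Q.indep_vars (\<lambda>i. borel) (\<lambda>i \<omega>. y i (path_on T (X i) \<omega>)) {1..N}"
    proof (rule Q.indep_vars_compose2[OF path_indep])
      fix i assume "i \<in> {1..N}"
      then show "y i \<in> borel_measurable paths"
        unfolding y_def[abs_def]
        by (intro borel_measurable_times borel_measurable_const incr_sum_paths_measurable in_T)
    qed
    moreover have "y i (path_on T (X i) \<omega>) = u * J i k \<omega>" if "i \<in> {1..N}" for i \<omega>
      unfolding y_def J_def step_integral_eq_incr_sum using in_T[OF that] by (subst incr_sum_path_on) auto
    ultimately show ?thesis by (subst (asm) Q.indep_vars_cong[OF refl _ refl]) auto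
  qed
  have "(\<integral>\<omega>. iexp (\<Sum>i=1..N. u * J i k \<omega>) \<partial>Q) = (\<Prod>i=1..N. of_real (exp (- (u\<^sup>2 * (\<integral>s. (g i k s)\<^sup>2 \<partial>S)) / 2)))" for k
  proof -
    have "(\<integral>\<omega>. iexp (\<Sum>i=1..N. u * J i k \<omega>) \<partial>Q) = char (distr Q borel (\<lambda>\<omega>. \<Sum>i=1..N. u * J i k \<omega>)) 1"
      unfolding char_def by (subst integral_distr) (auto intro!: borel_measurable_sum borel_measurable_times Jm)
    also have "\<dots> = (\<Prod>i=1..N. char (distr Q borel (\<lambda>\<omega>. u * J i k \<omega>)) 1)"
      by (rule Q.char_distr_sum[OF indep])
    also have "\<dots> = (\<Prod>i=1..N. of_real (exp (- (u\<^sup>2 * (\<integral>s. (g i k s)\<^sup>2 \<partial>S)) / 2)))"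
    proof (rule prod.cong)
      fix i assume i: "i \<in> {1..N}"
      have "char (distr Q borel (\<lambda>\<omega>. u * J i k \<omega>)) 1 = (\<integral>\<omega>. iexp (u * J i k \<omega>) \<partial>Q)"
        unfolding char_def using Jm[OF i] by (subst integral_distr) auto
      also have "\<dots> = of_real (exp (- (u\<^sup>2 * (\<integral>s. (g i k s)\<^sup>2 \<partial>S)) / 2))"
        unfolding J_def g_def by (rule gaussian_increments.char_step_integral[OF copy_gaussian[OF i] part[OF i]])
      finally show "char (distr Q borel (\<lambda>\<omega>. u * J i k \<omega>)) 1 = of_real (exp (- (u\<^sup>2 * (\<integral>s. (g i k s)\<^sup>2 \<partial>S)) / 2))" .
    qed simp
    finally show ?thesis .
  qed
  moreover have "(\<lambda>k. \<Prod>i=1..N. of_real (exp (- (u\<^sup>2 * (\<integral>s. (g i k s)\<^sup>2 \<partial>S)) / 2)) :: complex)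
     \<longlonglongrightarrow> (\<Prod>i=1..N. of_real (exp (- (u\<^sup>2 * (\<integral>s. (f s)\<^sup>2 \<partial>S)) / 2)))"
  proof (rule tendsto_prod)
    fix i assume i: "i \<in> {1..N}"
    have "(\<lambda>k. \<integral>s. (g i k s)\<^sup>2 \<partial>S) \<longlonglongrightarrow> (\<integral>s. (f s)\<^sup>2 \<partial>S)"
    proof (rule sq_norm_tendsto_imp_integral_sq_tendsto)
      show "g i k \<in> borel_measurable S" for k unfolding g_def step_fun_eq_incr_fun
        by (intro borel_imp_measurable_stieltjes) measurable
      show "integrable S (\<lambda>s. (g i k s)\<^sup>2)" for k unfolding g_def step_fun_eq_incr_fun by (rule integrable_incr_fun_sq)
      show "f \<in> borel_measurable S" by (rule continuous_on_imp_measurable_stieltjes[OF f])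
      show "integrable S (\<lambda>s. (f s)\<^sup>2)" by (intro integrable_continuous_S continuous_intros f)
      show "(\<lambda>k. sq_norm S (\<lambda>s. g i k s - f s)) \<longlonglongrightarrow> 0" unfolding g_def by (rule conv_S[OF i])
    qed
    then show "(\<lambda>k. of_real (exp (- (u\<^sup>2 * (\<integral>s. (g i k s)\<^sup>2 \<partial>S)) / 2)) :: complex)
      \<longlonglongrightarrow> of_real (exp (- (u\<^sup>2 * (\<integral>s. (f s)\<^sup>2 \<partial>S)) / 2))"
      by (intro tendsto_intros) simp_all
  qed
  moreover have "(\<lambda>k. \<integral>\<omega>. iexp (\<Sum>i=1..N. u * J i k \<omega>) \<partial>Q) \<longlonglongrightarrow> (\<integral>\<omega>. iexp (\<Sum>i=1..N. u * stint i f \<omega>) \<partial>Q)"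
  proof (rule sq_norm_tendsto_imp_char_tendsto)
    show "prob_space Q" by unfold_locales
    show "(\<lambda>\<omega>. \<Sum>i=1..N. u * J i k \<omega>) \<in> borel_measurable Q" for k
      by (intro borel_measurable_sum borel_measurable_times borel_measurable_const Jm)
    show "(\<lambda>\<omega>. \<Sum>i=1..N. u * stint i f \<omega>) \<in> borel_measurable Q"
      by (intro borel_measurable_sum borel_measurable_times borel_measurable_const stint_measurable f)
    have "(\<lambda>k. sq_norm Q (\<lambda>\<omega>. \<Sum>i=1..N. u * (J i k \<omega> - stint i f \<omega>) + 0 * (J i k \<omega> - stint i f \<omega>))) \<longlonglongrightarrow> 0"
    proof (rule sq_norm_sum_tendsto)
      fix i assume i: "i \<in> {1..N}"
      have m: "(\<lambda>\<omega>. J i k \<omega> - stint i f \<omega>) \<in> borel_measurable Q" for k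
        by (intro borel_measurable_diff Jm[OF i] stint_measurable[OF i f])
      then show "(\<lambda>\<omega>. u * (J i k \<omega> - stint i f \<omega>) + 0 * (J i k \<omega> - stint i f \<omega>)) \<in> borel_measurable Q" for k
        by simp
      show "(\<lambda>k. sq_norm Q (\<lambda>\<omega>. u * (J i k \<omega> - stint i f \<omega>) + 0 * (J i k \<omega> - stint i f \<omega>))) \<longlonglongrightarrow> 0"
        using conv_Q[OF i] by (intro sq_norm_lincomb_tendsto m) (simp_all add: J_def)
    qed simp
    then show "(\<lambda>k. sq_norm Q (\<lambda>\<omega>. (\<Sum>i=1..N. u * J i k \<omega>) - (\<Sum>i=1..N. u * stint i f \<omega>))) \<longlonglongrightarrow> 0"
      by (simp add: sum_subtractf right_diff_distrib)
  qed
  ultimately have "(\<integral>\<omega>. iexp (\<Sum>i=1..N. u * stint i f \<omega>) \<partial>Q) = (\<Prod>i=1..N. of_real (exp (- (u\<^sup>2 * (\<integral>s. (f s)\<^sup>2 \<partial>S)) / 2)))"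
    using LIMSEQ_unique by simp
  then show ?thesis by (simp only: sum_distrib_left prod_constant card_atLeastAtMost diff_Suc_1 One_nat_def diff_Suc_Suc diff_zero)
qed

lemma law_W:
  assumes f: "continuous_on {0..T} f"
  shows "distr Q borel (W f) = gauss (sqrt (nrm2 f / real N))"
proof (rule distr_eq_gaussI)
  show "prob_space Q" by unfold_locales
  show "W f \<in> borel_measurable Q" by (rule W_measurable[OF f])
  fix u
  have n: "0 \<le> nrm2 f / real N" by (simp add: nrm2_def integral_nonneg)
  have "(\<integral>\<omega>. iexp (u * W f \<omega>) \<partial>Q) = (\<integral>\<omega>. iexp ((u / real N) * (\<Sum>i=1..N. stint i f \<omega>)) \<partial>Q)"
    by (simp add: W_def)
  also have "\<dots> = of_real (exp (- ((u / real N)\<^sup>2 * nrm2 f) / 2) ^ N)"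
    by (simp only: char_sum_stint[OF f] of_real_power nrm2_def)
  also have "exp (- ((u / real N)\<^sup>2 * nrm2 f) / 2) ^ N = exp (- (sqrt (nrm2 f / real N) * u)\<^sup>2 / 2)"
    using n N_pos by (simp add: exp_of_nat_mult[symmetric] power_mult_distrib power_divide power2_eq_square field_simps)
  finally show "(\<integral>\<omega>. iexp (u * W f \<omega>) \<partial>Q) = of_real (exp (- (sqrt (nrm2 f / real N) * u)\<^sup>2 / 2))" .
qed

end

section \<open>Orthogonalisation with respect to the Stieltjes measure\<close>

lemma in_model_Suc_iff:
  "J \<in> model f (Suc n) \<longleftrightarrow> (\<exists>s\<in>model f n. \<exists>r. J = (\<lambda>t. s t + r * f (Suc n) t))"
proof
  assume "J \<in> model f (Suc n)"
  then obtain \<theta> where J: "J = (\<lambda>t. \<Sum>j=1..Suc n. \<theta> j * f j t)" by (auto simp: model_def)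
  show "\<exists>s\<in>model f n. \<exists>r. J = (\<lambda>t. s t + r * f (Suc n) t)"
  proof (intro bexI exI)
    show "J = (\<lambda>t. (\<Sum>j=1..n. \<theta> j * f j t) + \<theta> (Suc n) * f (Suc n) t)" by (simp add: J)
    show "(\<lambda>t. \<Sum>j=1..n. \<theta> j * f j t) \<in> model f n" by (auto simp: model_def)
  qed
next
  assume "\<exists>s\<in>model f n. \<exists>r. J = (\<lambda>t. s t + r * f (Suc n) t)"
  then obtain \<theta> r where J: "J = (\<lambda>t. (\<Sum>j=1..n. \<theta> j * f j t) + r * f (Suc n) t)" by (auto simp: model_def)
  define \<theta>' where "\<theta>' = \<theta>(Suc n := r)"
  have "(\<Sum>j=1..n. \<theta>' j * f j t) = (\<Sum>j=1..n. \<theta> j * f j t)" for t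
    by (rule sum.cong) (auto simp: \<theta>'_def)
  then have "J = (\<lambda>t. \<Sum>j=1..Suc n. \<theta>' j * f j t)" by (simp add: J \<theta>'_def)
  then show "J \<in> model f (Suc n)" unfolding model_def by blast
qed

lemma in_model_SucI:
  "s \<in> model f n \<Longrightarrow> J = (\<lambda>t. s t + r * f (Suc n) t) \<Longrightarrow> J \<in> model f (Suc n)"
  unfolding in_model_Suc_iff by (intro bexI[of _ s] exI[of _ r])

lemma model_lincomb:
  assumes "s \<in> model f n" "s' \<in> model f n"
  shows "(\<lambda>t. a * s t + b * s' t) \<in> model f n"
proof -
  obtain \<theta> \<theta>' where "s = (\<lambda>t. \<Sum>j=1..n. \<theta> j * f j t)" "s' = (\<lambda>t. \<Sum>j=1..n. \<theta>' j * f j t)"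
    using assms by (auto simp: model_def)
  then have "(\<lambda>t. a * s t + b * s' t) = (\<lambda>t. \<Sum>j=1..n. (a * \<theta> j + b * \<theta>' j) * f j t)"
    by (simp add: sum_distrib_left sum.distrib distrib_right mult.assoc)
  then show ?thesis
    unfolding model_def by (intro CollectI exI[of _ "\<lambda>j. a * \<theta> j + b * \<theta>' j"])
qed

lemma model_cong: "(\<And>j. 1 \<le> j \<Longrightarrow> j \<le> n \<Longrightarrow> f j = g j) \<Longrightarrow> model f n = model g n"
proof -
  assume "\<And>j. 1 \<le> j \<Longrightarrow> j \<le> n \<Longrightarrow> f j = g j"
  then have "(\<Sum>j=1..n. \<theta> j * f j t) = (\<Sum>j=1..n. \<theta> j * g j t)" for \<theta> t
    by (intro sum.cong) auto
  then show ?thesis by (simp only: model_def)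
qed

context stieltjes_clock
begin

definition L2c :: "(real \<Rightarrow> real) \<Rightarrow> bool" where
  "L2c f \<longleftrightarrow> f \<in> borel_measurable S \<and> integrable S (\<lambda>s. (f s)\<^sup>2)"

definition ip :: "(real \<Rightarrow> real) \<Rightarrow> (real \<Rightarrow> real) \<Rightarrow> real" where
  "ip f g = (\<integral>s. f s * g s \<partial>S)"

lemma ip_commute: "ip f g = ip g f"
  by (simp add: ip_def mult.commute)

lemma nrm2_eq_ip: "nrm2 f = ip f f"
  by (simp add: nrm2_def ip_def power2_eq_square)

lemma nrm2_nonneg: "0 \<le> nrm2 f"
  by (simp add: nrm2_def integral_nonneg)

lemma L2c_integrable: "L2c f \<Longrightarrow> L2c g \<Longrightarrow> integrable S (\<lambda>s. f s * g s)"
  unfolding L2c_def by (intro integrable_mult_of_squares) auto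

lemma L2c_continuous: "continuous_on {0..T} f \<Longrightarrow> L2c f"
  unfolding L2c_def
  by (intro conjI continuous_on_imp_measurable_stieltjes integrable_continuous_S continuous_intros)

lemma L2c_lincomb: "L2c f \<Longrightarrow> L2c g \<Longrightarrow> L2c (\<lambda>s. a * f s + b * g s)"
proof -
  assume f: "L2c f" and g: "L2c g"
  have eq: "(a * f s + b * g s)\<^sup>2 = a\<^sup>2 * (f s)\<^sup>2 + 2 * a * b * (f s * g s) + b\<^sup>2 * (g s)\<^sup>2" for s
    by (simp add: power2_eq_square algebra_simps)
  have "integrable S (\<lambda>s. (a * f s + b * g s)\<^sup>2)"
    unfolding eq using f g L2c_integrable[OF f g]
    by (intro Bochner_Integration.integrable_add integrable_mult_right) (auto simp: L2c_def)
  then show ?thesis using f g by (auto simp: L2c_def)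
qed

lemma ip_lincomb: "L2c f \<Longrightarrow> L2c g \<Longrightarrow> L2c h \<Longrightarrow> ip (\<lambda>s. a * f s + b * g s) h = a * ip f h + b * ip g h"
proof -
  assume "L2c f" "L2c g" "L2c h"
  then have "integrable S (\<lambda>s. f s * h s)" "integrable S (\<lambda>s. g s * h s)" by (auto intro: L2c_integrable)
  then show ?thesis unfolding ip_def by (simp add: distrib_right mult.assoc)
qed

lemma L2c_sum: "finite J \<Longrightarrow> (\<And>j. j \<in> J \<Longrightarrow> L2c (e j)) \<Longrightarrow> L2c (\<lambda>s. \<Sum>j\<in>J. x j * e j s)"
proof (induction J rule: finite_induct)
  case empty
  show ?case by (simp add: L2c_def)
next
  case (insert j J)
  then have "L2c (\<lambda>s. x j * e j s + 1 * (\<Sum>j\<in>J. x j * e j s))" by (intro L2c_lincomb) auto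
  then show ?case using insert by simp
qed

lemma ip_sum: "finite J \<Longrightarrow> (\<And>j. j \<in> J \<Longrightarrow> L2c (e j)) \<Longrightarrow> L2c h \<Longrightarrow>
    ip (\<lambda>s. \<Sum>j\<in>J. x j * e j s) h = (\<Sum>j\<in>J. x j * ip (e j) h)"
proof (induction J rule: finite_induct)
  case empty
  show ?case by (simp add: ip_def)
next
  case (insert j J)
  then have "ip (\<lambda>s. x j * e j s + 1 * (\<Sum>j\<in>J. x j * e j s)) h = x j * ip (e j) h + 1 * ip (\<lambda>s. \<Sum>j\<in>J. x j * e j s) h"
    by (intro ip_lincomb L2c_sum) auto
  then show ?case using insert by simp
qed

lemma nrm2_diff: "L2c f \<Longrightarrow> L2c g \<Longrightarrow> nrm2 (\<lambda>s. f s - g s) = nrm2 f - 2 * ip f g + nrm2 g"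
proof -
  assume f: "L2c f" and g: "L2c g"
  have d: "L2c (\<lambda>s. f s - g s)" using L2c_lincomb[OF f g, of 1 "-1"] by simp
  have l: "ip (\<lambda>s. f s - g s) h = ip f h - ip g h" if "L2c h" for h
    using ip_lincomb[OF f g that, of 1 "-1"] by simp
  have "nrm2 (\<lambda>s. f s - g s) = ip f (\<lambda>s. f s - g s) - ip g (\<lambda>s. f s - g s)"
    unfolding nrm2_eq_ip by (rule l[OF d])
  also have "\<dots> = (ip f f - ip g f) - (ip f g - ip g g)"
    using l[OF f] l[OF g] ip_commute[of f "\<lambda>s. f s - g s"] ip_commute[of g "\<lambda>s. f s - g s"] by simp
  finally show ?thesis using ip_commute[of g f] by (simp add: nrm2_eq_ip)
qed

lemma ip_eq_0_of_nrm2_eq_0: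
  assumes "L2c f" "nrm2 f = 0"
  shows "ip f g = 0"
proof -
  have "AE s in S. (f s)\<^sup>2 = 0"
    using assms by (subst integral_nonneg_eq_0_iff_AE[symmetric]) (auto simp: nrm2_def L2c_def)
  then have "AE s in S. f s * g s = 0" by eventually_elim simp
  then show ?thesis unfolding ip_def by (rule integral_eq_zero_AE)
qed

text \<open>Functions that vanish almost everywhere for the Stieltjes measure survive normalisation with
  norm zero; they are kept so that the indexing of the models does not change.\<close>

definition orthobasis :: "(nat \<Rightarrow> real \<Rightarrow> real) \<Rightarrow> nat \<Rightarrow> bool" where
  "orthobasis e n \<longleftrightarrow> (\<forall>j\<in>{1..n}. continuous_on {0..T} (e j) \<and> (nrm2 (e j) = 0 \<or> nrm2 (e j) = 1)) \<and>
     (\<forall>i\<in>{1..n}. \<forall>j\<in>{1..n}. i \<noteq> j \<longrightarrow> ip (e i) (e j) = 0)"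

lemma Gram_Schmidt:
  assumes "\<And>j. j \<in> {1..n} \<Longrightarrow> continuous_on {0..T} (\<phi> j)"
  shows "\<exists>e. orthobasis e n \<and> (\<forall>m\<le>n. model e m = model \<phi> m)"
  using assms
proof (induction n)
  case 0
  show ?case by (intro exI[of _ \<phi>]) (auto simp: orthobasis_def)
next
  case (Suc n)
  then obtain e where e: "orthobasis e n" "\<And>m. m \<le> n \<Longrightarrow> model e m = model \<phi> m" by auto
  have ec: "continuous_on {0..T} (e j)" "L2c (e j)" if "j \<in> {1..n}" for j
    using e(1) that by (auto simp: orthobasis_def intro: L2c_continuous)
  define f where "f = \<phi> (Suc n)"
  have f: "continuous_on {0..T} f" "L2c f" using Suc.prems by (auto simp: f_def intro: L2c_continuous)
  define p where "p s = (\<Sum>j=1..n. ip f (e j) * e j s)" for s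
  have p: "continuous_on {0..T} p" "L2c p"
    unfolding p_def[abs_def] using ec by (auto intro!: continuous_intros L2c_sum)
  have p_model: "p \<in> model e n" by (auto simp: model_def p_def[abs_def])
  define h where "h s = 1 * f s + (-1) * p s" for s
  have h: "continuous_on {0..T} h" "L2c h"
    unfolding h_def[abs_def] by (intro continuous_intros f(1) p(1), rule L2c_lincomb[OF f(2) p(2)])
  have h_orth: "ip h (e k) = 0" if k: "k \<in> {1..n}" for k
  proof -
    have "ip p (e k) = (\<Sum>j=1..n. ip f (e j) * ip (e j) (e k))"
      unfolding p_def[abs_def] using ec k by (intro ip_sum) auto
    also have "\<dots> = (\<Sum>j=1..n. if j = k then ip f (e k) * ip (e k) (e k) else 0)"
      using e(1) k by (intro sum.cong) (auto simp: orthobasis_def)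
    also have "\<dots> = ip f (e k) * nrm2 (e k)" using k by (simp add: nrm2_eq_ip)
    also have "\<dots> = ip f (e k)"
    proof (cases "nrm2 (e k) = 0")
      case True
      then show ?thesis using ip_eq_0_of_nrm2_eq_0[OF ec(2)[OF k] True, of f] by (simp add: ip_commute)
    next
      case False
      then show ?thesis using e(1) k by (auto simp: orthobasis_def)
    qed
    finally have "ip p (e k) = ip f (e k)" .
    moreover have "ip h (e k) = 1 * ip f (e k) + (-1) * ip p (e k)"
      unfolding h_def[abs_def] by (rule ip_lincomb[OF f(2) p(2) ec(2)[OF k]])
    ultimately show ?thesis by simp
  qed
  define c where "c = (if nrm2 h = 0 then 1 else 1 / sqrt (nrm2 h))"
  have c: "c \<noteq> 0" using nrm2_nonneg[of h] by (auto simp: c_def)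
  define g where "g s = c * h s" for s
  have g_ip: "ip g k = c * ip h k" for k unfolding g_def[abs_def] ip_def by (simp add: mult.assoc)
  have g: "continuous_on {0..T} g" unfolding g_def[abs_def] using h by (intro continuous_intros)
  have g_nrm: "nrm2 g = c\<^sup>2 * nrm2 h"
    unfolding g_def[abs_def] nrm2_def by (simp add: power_mult_distrib)
  have g01: "nrm2 g = 0 \<or> nrm2 g = 1"
  proof (cases "nrm2 h = 0")
    case False
    then have "nrm2 g = 1" unfolding g_nrm c_def using nrm2_nonneg[of h] by (simp add: power_divide)
    then show ?thesis ..
  qed (simp add: g_nrm)
  define e' where "e' = e(Suc n := g)"
  have e'_old: "e' j = e j" if "j \<in> {1..n}" for j using that by (auto simp: e'_def)
  have e'_new: "e' (Suc n) = g" by (simp add: e'_def)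
  have ins: "{1..Suc n} = insert (Suc n) {1..n}" by auto
  have "orthobasis e' (Suc n)"
    unfolding orthobasis_def ins
  proof (intro conjI ballI impI)
    fix j assume "j \<in> insert (Suc n) {1..n}"
    then show "continuous_on {0..T} (e' j)" "nrm2 (e' j) = 0 \<or> nrm2 (e' j) = 1"
      using g g01 e(1) e'_old e'_new by (auto simp: orthobasis_def)
  next
    fix i j assume ij: "i \<in> insert (Suc n) {1..n}" "j \<in> insert (Suc n) {1..n}" "i \<noteq> j"
    have new: "ip (e' (Suc n)) (e' k) = 0 \<and> ip (e' k) (e' (Suc n)) = 0" if "k \<in> {1..n}" for k
      unfolding e'_old[OF that] e'_new using h_orth[OF that] g_ip[of "e k"] ip_commute[of "e k" g] by simp
    consider "i = Suc n" "j \<in> {1..n}" | "j = Suc n" "i \<in> {1..n}" | "i \<in> {1..n}" "j \<in> {1..n}"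
      using ij by blast
    then show "ip (e' i) (e' j) = 0"
    proof cases
      case 3
      then show ?thesis using e(1) ij(3) unfolding e'_old[OF 3(1)] e'_old[OF 3(2)] orthobasis_def by blast
    qed (use new in blast)+
  qed
  moreover have "model e' m = model \<phi> m" if "m \<le> Suc n" for m
  proof (cases "m = Suc n")
    case False
    then have "m \<le> n" using that by simp
    moreover have "model e' m = model e m" using \<open>m \<le> n\<close> by (intro model_cong e'_old) auto
    ultimately show ?thesis using e(2) by simp
  next
    case True
    have e'n: "model e' n = model e n" by (intro model_cong e'_old) auto
    have f_eq: "f s = p s + (1 / c) * g s" for s using c by (simp add: g_def h_def)
    have "J \<in> model e' (Suc n) \<longleftrightarrow> J \<in> model \<phi> (Suc n)" for J
    proof
      assume "J \<in> model e' (Suc n)"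
      then obtain s r where s: "s \<in> model e n" and J: "J = (\<lambda>t. s t + r * g t)"
        unfolding in_model_Suc_iff e'n e'_new by blast
      have "(\<lambda>t. 1 * s t + (- (r * c)) * p t) \<in> model \<phi> n"
        using model_lincomb[OF s p_model] e(2)[of n] by blast
      moreover have "J = (\<lambda>t. (1 * s t + (- (r * c)) * p t) + (r * c) * \<phi> (Suc n) t)"
        by (auto simp: J g_def h_def f_def algebra_simps)
      ultimately show "J \<in> model \<phi> (Suc n)" by (rule in_model_SucI)
    next
      assume "J \<in> model \<phi> (Suc n)"
      then obtain s r where s: "s \<in> model e n" and J: "J = (\<lambda>t. s t + r * f t)"
        unfolding in_model_Suc_iff f_def using e(2)[of n] by blast
      have "(\<lambda>t. 1 * s t + r * p t) \<in> model e' n"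
        unfolding e'n by (rule model_lincomb[OF s p_model])
      moreover have "J = (\<lambda>t. (1 * s t + r * p t) + (r / c) * e' (Suc n) t)"
        by (auto simp: J f_eq distrib_left e'_new)
      ultimately show "J \<in> model e' (Suc n)" by (rule in_model_SucI)
    qed
    then have "model e' (Suc n) = model \<phi> (Suc n)" by blast
    then show ?thesis using True by simp
  qed
  ultimately show ?case by blast
qed

text \<open>The indices of the basis functions that do not vanish almost everywhere.\<close>

definition live :: "(nat \<Rightarrow> real \<Rightarrow> real) \<Rightarrow> nat \<Rightarrow> nat set" where
  "live e m = {j\<in>{1..m}. nrm2 (e j) = 1}"

lemma finite_live [simp]: "finite (live e m)" by (simp add: live_def)

lemma card_live_le: "card (live e m) \<le> m"
proof -
  have "live e m \<subseteq> {1..m}" by (auto simp: live_def)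
  from card_mono[OF _ this] show ?thesis by simp
qed

lemma nrm2_sum_orthonormal:
  assumes "finite J" "\<And>j. j \<in> J \<Longrightarrow> L2c (e j)" "\<And>j. j \<in> J \<Longrightarrow> nrm2 (e j) = 1"
    and "\<And>i j. i \<in> J \<Longrightarrow> j \<in> J \<Longrightarrow> i \<noteq> j \<Longrightarrow> ip (e i) (e j) = 0"
  shows "nrm2 (\<lambda>s. \<Sum>j\<in>J. x j * e j s) = (\<Sum>j\<in>J. (x j)\<^sup>2)"
proof -
  have "nrm2 (\<lambda>s. \<Sum>j\<in>J. x j * e j s) = (\<Sum>j\<in>J. x j * ip (e j) (\<lambda>s. \<Sum>j\<in>J. x j * e j s))"
    unfolding nrm2_eq_ip using assms by (intro ip_sum L2c_sum)
  also have "\<dots> = (\<Sum>j\<in>J. x j * (\<Sum>i\<in>J. x i * ip (e i) (e j)))"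
    using assms by (intro sum.cong refl arg_cong2[where f = "(*)"]) (subst ip_commute, intro ip_sum)
  also have "\<dots> = (\<Sum>j\<in>J. x j * (\<Sum>i\<in>J. if i = j then x j else 0))"
    using assms by (intro sum.cong refl arg_cong2[where f = "(*)"]) (auto simp: nrm2_eq_ip)
  also have "\<dots> = (\<Sum>j\<in>J. (x j)\<^sup>2)" using assms(1) by (simp add: power2_eq_square)
  finally show ?thesis .
qed

end

section \<open>Exponential moments of the noise\<close>

context noisy_copies
begin

lemma nn_exp_W:
  assumes f: "continuous_on {0..T} f"
  shows "(\<integral>\<^sup>+\<omega>. ennreal (exp (u * W f \<omega>)) \<partial>Q) = ennreal (exp (u\<^sup>2 * nrm2 f / (2 * real N)))"
proof -
  have "(\<integral>\<^sup>+\<omega>. ennreal (exp (u * W f \<omega>)) \<partial>Q)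
      = (\<integral>\<^sup>+x. ennreal (exp (u * (sqrt (nrm2 f / real N) * x))) \<partial>std_normal_distribution)"
    by (rule nn_integral_gauss[OF law_W[OF f] W_measurable[OF f], of "\<lambda>x. ennreal (exp (u * x))"]) measurable
  also have "\<dots> = (\<integral>\<^sup>+x. ennreal (exp ((u * sqrt (nrm2 f / real N)) * x)) \<partial>std_normal_distribution)"
    by (simp only: mult.assoc)
  also have "\<dots> = ennreal (exp (u\<^sup>2 * nrm2 f / (2 * real N)))"
    unfolding std_normal_exp_linear using nrm2_nonneg[of f] by (simp add: power_mult_distrib)
  finally show ?thesis .
qed

text \<open>The square in the exponent is linearised by an auxiliary standard Gaussian vector, so that only
  the laws of single combinations of the noise are needed, not their joint law.\<close>

lemma nn_exp_sum_sq:
  fixes J :: "nat set"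
  assumes J: "finite J" and e: "\<And>j. j \<in> J \<Longrightarrow> continuous_on {0..T} (e j)" "\<And>j. j \<in> J \<Longrightarrow> nrm2 (e j) = 1"
    and orth: "\<And>i j. i \<in> J \<Longrightarrow> j \<in> J \<Longrightarrow> i \<noteq> j \<Longrightarrow> ip (e i) (e j) = 0"
    and \<theta>: "0 \<le> \<theta>" "\<theta> < 1/2"
  shows "(\<integral>\<^sup>+\<omega>. ennreal (exp (\<theta> * real N * (\<Sum>j\<in>J. (W (e j) \<omega>)\<^sup>2))) \<partial>Q)
    = ennreal (1 / sqrt (1 - 2 * \<theta>)) ^ card J"
proof -
  define a where "a = sqrt (2 * \<theta> * real N)"
  have a2: "a\<^sup>2 = 2 * \<theta> * real N" using \<theta> by (simp add: a_def)
  interpret G: product_prob_space "\<lambda>_::nat. std_normal_distribution" J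
    by (intro product_prob_space.intro product_prob_space_axioms.intro product_sigma_finite.intro
        prob_space_imp_sigma_finite prob_space_std_normal)
  interpret GJ: finite_product_prob_space "\<lambda>_::nat. std_normal_distribution" J
    by unfold_locales (rule J)
  let ?G = "\<Pi>\<^sub>M j\<in>J. std_normal_distribution"
  interpret pair: pair_sigma_finite ?G Q by unfold_locales
  have Wm [measurable]: "j \<in> J \<Longrightarrow> W (e j) \<in> borel_measurable Q" for j by (rule W_measurable[OF e(1)])
  have ein: "ennreal (exp (\<theta> * real N * (\<Sum>j\<in>J. (W (e j) \<omega>)\<^sup>2)))
      = (\<integral>\<^sup>+g. ennreal (exp (\<Sum>j\<in>J. a * W (e j) \<omega> * g j)) \<partial>?G)" for \<omega>
  proof -
    have "(\<integral>\<^sup>+g. ennreal (exp (\<Sum>j\<in>J. a * W (e j) \<omega> * g j)) \<partial>?G)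
        = (\<integral>\<^sup>+g. (\<Prod>j\<in>J. ennreal (exp (a * W (e j) \<omega> * g j))) \<partial>?G)"
      using J by (simp add: exp_sum prod_ennreal)
    also have "\<dots> = (\<Prod>j\<in>J. \<integral>\<^sup>+x. ennreal (exp (a * W (e j) \<omega> * x)) \<partial>std_normal_distribution)"
      by (rule G.product_nn_integral_prod[OF J, of "\<lambda>j x. ennreal (exp (a * W (e j) \<omega> * x))"]) measurable
    also have "\<dots> = (\<Prod>j\<in>J. ennreal (exp (\<theta> * real N * (W (e j) \<omega>)\<^sup>2)))"
      unfolding std_normal_exp_linear by (simp add: power_mult_distrib a2 mult.assoc)
    also have "\<dots> = ennreal (exp (\<theta> * real N * (\<Sum>j\<in>J. (W (e j) \<omega>)\<^sup>2)))"
      using J by (simp add: prod_ennreal exp_sum[symmetric] sum_distrib_left)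
    finally show ?thesis by simp
  qed
  have "(\<integral>\<^sup>+\<omega>. ennreal (exp (\<theta> * real N * (\<Sum>j\<in>J. (W (e j) \<omega>)\<^sup>2))) \<partial>Q)
      = (\<integral>\<^sup>+\<omega>. \<integral>\<^sup>+g. ennreal (exp (\<Sum>j\<in>J. a * W (e j) \<omega> * g j)) \<partial>?G \<partial>Q)"
    by (simp only: ein)
  also have "\<dots> = (\<integral>\<^sup>+g. \<integral>\<^sup>+\<omega>. ennreal (exp (\<Sum>j\<in>J. a * W (e j) \<omega> * g j)) \<partial>Q \<partial>?G)"
  proof (rule pair.Fubini')
    have "(\<lambda>z. \<Sum>j\<in>J. a * W (e j) (snd z) * fst z j) \<in> borel_measurable (?G \<Otimes>\<^sub>M Q)"
    proof (rule borel_measurable_sum)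
      fix j assume j: "j \<in> J"
      have "(\<lambda>g. g j) \<in> borel_measurable ?G"
        using measurable_component_singleton[OF j, of "\<lambda>_. std_normal_distribution"] by simp
      then have "(\<lambda>z. fst z j) \<in> borel_measurable (?G \<Otimes>\<^sub>M Q)" by (rule measurable_compose[OF measurable_fst])
      moreover have "(\<lambda>z. W (e j) (snd z)) \<in> borel_measurable (?G \<Otimes>\<^sub>M Q)"
        by (rule measurable_compose[OF measurable_snd Wm[OF j]])
      ultimately show "(\<lambda>z. a * W (e j) (snd z) * fst z j) \<in> borel_measurable (?G \<Otimes>\<^sub>M Q)"
        by (intro borel_measurable_times borel_measurable_const)
    qed
    then show "(\<lambda>(g, \<omega>). ennreal (exp (\<Sum>j\<in>J. a * W (e j) \<omega> * g j))) \<in> borel_measurable (?G \<Otimes>\<^sub>M Q)"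
      unfolding split_beta by measurable
  qed
  also have "\<dots> = (\<integral>\<^sup>+g. (\<Prod>j\<in>J. ennreal (exp (\<theta> * (g j)\<^sup>2))) \<partial>?G)"
  proof (rule nn_integral_cong)
    fix g :: "nat \<Rightarrow> real"
    have "(\<Sum>j\<in>J. a * W (e j) \<omega> * g j) = a * W (\<lambda>s. \<Sum>j\<in>J. g j * e j s) \<omega>" for \<omega>
      using J e(1) by (simp add: W_sum sum_distrib_left mult_ac)
    then have "(\<integral>\<^sup>+\<omega>. ennreal (exp (\<Sum>j\<in>J. a * W (e j) \<omega> * g j)) \<partial>Q)
        = ennreal (exp (a\<^sup>2 * nrm2 (\<lambda>s. \<Sum>j\<in>J. g j * e j s) / (2 * real N)))"
      using e(1) by (simp only:) (intro nn_exp_W continuous_intros)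
    also have "nrm2 (\<lambda>s. \<Sum>j\<in>J. g j * e j s) = (\<Sum>j\<in>J. (g j)\<^sup>2)"
      using J e orth by (intro nrm2_sum_orthonormal L2c_continuous)
    also have "a\<^sup>2 * (\<Sum>j\<in>J. (g j)\<^sup>2) / (2 * real N) = (\<Sum>j\<in>J. \<theta> * (g j)\<^sup>2)"
      using N_pos by (simp add: a2 sum_distrib_left[symmetric])
    finally show "(\<integral>\<^sup>+\<omega>. ennreal (exp (\<Sum>j\<in>J. a * W (e j) \<omega> * g j)) \<partial>Q) = (\<Prod>j\<in>J. ennreal (exp (\<theta> * (g j)\<^sup>2)))"
      using J by (simp add: exp_sum prod_ennreal)
  qed
  also have "\<dots> = (\<Prod>j\<in>J. \<integral>\<^sup>+x. ennreal (exp (\<theta> * x\<^sup>2)) \<partial>std_normal_distribution)"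
    by (rule G.product_nn_integral_prod[OF J, of "\<lambda>_ x. ennreal (exp (\<theta> * x\<^sup>2))"]) measurable
  also have "\<dots> = ennreal (1 / sqrt (1 - 2 * \<theta>)) ^ card J"
    unfolding std_normal_exp_square[OF \<theta>(2)] by simp
  finally show ?thesis .
qed

lemma pos_part_le_exp:
  fixes x \<theta> :: real assumes "0 < \<theta>" shows "max 0 x \<le> exp (\<theta> * x) / \<theta>"
proof -
  have "\<theta> * x \<le> exp (\<theta> * x)" using exp_ge_add_one_self[of "\<theta> * x"] by linarith
  then have "x \<le> exp (\<theta> * x) / \<theta>" using assms by (simp add: le_divide_eq mult.commute)
  then show ?thesis using assms by simp
qed

text \<open>A Chernoff bound for the expectation of the excess over a level.\<close>

lemma nn_pos_part_le:
  assumes "0 < \<theta>" "Z \<in> borel_measurable Q"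
    and "(\<integral>\<^sup>+\<omega>. ennreal (exp (\<theta> * Z \<omega>)) \<partial>Q) \<le> ennreal K" "0 \<le> K"
  shows "(\<integral>\<^sup>+\<omega>. ennreal (max 0 (Z \<omega> - t)) \<partial>Q) \<le> ennreal (K * exp (- (\<theta> * t)) / \<theta>)"
proof -
  have [measurable]: "Z \<in> borel_measurable Q" by fact
  have "(\<integral>\<^sup>+\<omega>. ennreal (max 0 (Z \<omega> - t)) \<partial>Q) \<le> (\<integral>\<^sup>+\<omega>. ennreal (exp (- (\<theta> * t)) / \<theta>) * ennreal (exp (\<theta> * Z \<omega>)) \<partial>Q)"
  proof (rule nn_integral_mono)
    fix \<omega>
    have "max 0 (Z \<omega> - t) \<le> exp (\<theta> * (Z \<omega> - t)) / \<theta>" by (rule pos_part_le_exp[OF assms(1)])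
    also have "\<dots> = exp (- (\<theta> * t)) / \<theta> * exp (\<theta> * Z \<omega>)"
      by (simp add: right_diff_distrib exp_diff exp_minus field_simps)
    finally have "ennreal (max 0 (Z \<omega> - t)) \<le> ennreal (exp (- (\<theta> * t)) / \<theta> * exp (\<theta> * Z \<omega>))" by (rule ennreal_leI)
    also have "\<dots> = ennreal (exp (- (\<theta> * t)) / \<theta>) * ennreal (exp (\<theta> * Z \<omega>))"
      by (rule ennreal_mult) (use assms(1) in auto)
    finally show "ennreal (max 0 (Z \<omega> - t)) \<le> ennreal (exp (- (\<theta> * t)) / \<theta>) * ennreal (exp (\<theta> * Z \<omega>))" .
  qed
  also have "\<dots> = ennreal (exp (- (\<theta> * t)) / \<theta>) * (\<integral>\<^sup>+\<omega>. ennreal (exp (\<theta> * Z \<omega>)) \<partial>Q)"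
    by (rule nn_integral_cmult) measurable
  also have "\<dots> \<le> ennreal (exp (- (\<theta> * t)) / \<theta>) * ennreal K" by (rule mult_left_mono[OF assms(3)]) simp
  also have "\<dots> = ennreal (K * exp (- (\<theta> * t)) / \<theta>)"
    using assms by (simp add: ennreal_mult[symmetric] mult.commute)
  finally show ?thesis .
qed

end

section \<open>The estimators in orthonormal coordinates\<close>

text \<open>The constant of both risk bounds: \<open>\<sigma>\<close> is a third of the excess of the penalty over the noise level \<open>1\<close>;
  the three summands stem from the bias and penalty of the competing model and from the geometric
  series that bound the deviations of the variance and of the cross terms; division by \<open>\<rho>\<close> isolates
  the loss of the selected estimator.\<close>

definition oracle_const :: "real \<Rightarrow> real" where
  "oracle_const ccal = (let \<sigma> = (ccal - 1) / 3; \<kappa> = 1 + \<sigma>; \<theta> = \<sigma> / (2 * \<kappa>\<^sup>2);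
      q = exp (- (\<theta> * \<kappa>)) / sqrt (1 - 2 * \<theta>); \<rho> = min (1 / 2) (\<sigma> / \<kappa>)
    in (3 / 2 + 2 / (\<theta> * (1 - q)) + 4 / (1 - exp (- \<sigma> / 4))) / \<rho>)"

lemma is_arg_min_arg_min: "is_arg_min f P x \<Longrightarrow> is_arg_min f P (arg_min f P)"
  unfolding arg_min_def by (rule someI[of "is_arg_min f P"])

lemma ennreal_affine:
  "0 \<le> r \<Longrightarrow> 0 \<le> x \<Longrightarrow> 0 \<le> y \<Longrightarrow> 0 \<le> z \<Longrightarrow>
    ennreal (r * (x + (2 * y + z))) = ennreal r * (ennreal x + (2 * ennreal y + ennreal z))"
  by (simp add: ennreal_mult)

lemma sum_geometric_le:
  fixes q :: real assumes "0 \<le> q" "q < 1"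
  shows "(\<Sum>k=1..n. q ^ k) \<le> 1 / (1 - q)"
proof -
  have "(\<Sum>k=1..n. q ^ k) \<le> (\<Sum>k. q ^ k)"
    using assms by (intro sum_le_suminf summable_geometric) auto
  then show ?thesis using assms by (simp add: suminf_geometric)
qed

text \<open>The exponential moment of a chi-square variable grows per degree of freedom by a factor smaller than
  \<open>exp (\<theta> \<kappa>)\<close>, provided \<open>\<kappa>\<close> exceeds the mean \<open>1\<close>: to first order in \<open>\<theta>\<close> the logarithms are \<open>\<theta>\<close> and
  \<open>\<theta> \<kappa>\<close>, and \<open>\<theta>\<close> is chosen small enough for the second order. This is where a penalty constant larger
  than \<open>1\<close> enters.\<close>

lemma chi_square_rate_less_1:
  fixes \<sigma> :: real assumes "0 < \<sigma>"
  defines "\<kappa> \<equiv> 1 + \<sigma>" and "\<theta> \<equiv> \<sigma> / (2 * (1 + \<sigma>)\<^sup>2)"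
  shows "0 < \<theta>" "\<theta> < 1 / 2" "0 \<le> exp (- (\<theta> * \<kappa>)) / sqrt (1 - 2 * \<theta>)" "exp (- (\<theta> * \<kappa>)) / sqrt (1 - 2 * \<theta>) < 1"
proof -
  have k: "0 < (1 + \<sigma>)\<^sup>2" using assms by simp
  show \<theta>: "0 < \<theta>" using assms k by (simp add: \<theta>_def)
  have "\<sigma> < (1 + \<sigma>)\<^sup>2" using assms by (simp add: power2_eq_square algebra_simps add_pos_pos)
  then show \<theta>2: "\<theta> < 1 / 2" using k by (simp add: \<theta>_def divide_less_eq)
  have pos: "0 < 1 - 2 * \<theta>" using \<theta>2 by simp
  show "0 \<le> exp (- (\<theta> * \<kappa>)) / sqrt (1 - 2 * \<theta>)" using pos by simp
  define x where "x = 2 * \<theta> * \<kappa>"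
  have x: "0 < x" using \<theta> assms by (simp add: x_def)
  have x_eq: "x * \<kappa> = \<sigma>"
    unfolding x_def \<theta>_def \<kappa>_def using assms by (simp add: power2_eq_square divide_simps)
  have "x\<^sup>2 / 2 < x - 2 * \<theta>"
  proof -
    have k0: "0 < \<kappa>" using assms by (simp add: \<kappa>_def)
    have "x - 2 * \<theta> = 2 * \<theta> * \<sigma>" by (simp add: x_def \<kappa>_def algebra_simps)
    also have "\<dots> = 2 * \<theta> * (x * \<kappa>)" by (simp only: x_eq)
    also have "\<dots> = x\<^sup>2" by (simp add: x_def power2_eq_square)
    finally show ?thesis using x by simp
  qed
  moreover have "exp (- x) \<le> 1 - x + x\<^sup>2 / 2" using exp_minus_quadratic_bound[of x] x by linarith
  ultimately have lt: "exp (- x) < 1 - 2 * \<theta>" by linarith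
  have "exp (- (\<theta> * \<kappa>)) = sqrt (exp (- x))"
  proof (rule real_sqrt_unique[symmetric])
    show "(exp (- (\<theta> * \<kappa>)))\<^sup>2 = exp (- x)" by (simp add: x_def exp_double[symmetric])
  qed simp
  also have "\<dots> < sqrt (1 - 2 * \<theta>)" using lt by simp
  finally show "exp (- (\<theta> * \<kappa>)) / sqrt (1 - 2 * \<theta>) < 1" using pos by simp
qed

lemma oracle_const_pos:
  assumes "1 < ccal"
  shows "0 < oracle_const ccal"
proof -
  define \<sigma> where "\<sigma> = (ccal - 1) / 3"
  have \<sigma>: "0 < \<sigma>" using assms by (simp add: \<sigma>_def)
  note r = chi_square_rate_less_1[OF \<sigma>]
  have "exp (- \<sigma> / 4) < 1" using \<sigma> by simp
  moreover have "0 < min (1 / 2) (\<sigma> / (1 + \<sigma>))" using \<sigma> by simp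
  ultimately show ?thesis
    unfolding oracle_const_def Let_def \<sigma>_def[symmetric] using r
    by (intro divide_pos_pos add_pos_nonneg) (auto intro!: mult_nonneg_nonneg less_imp_le)
qed

context stieltjes_clock
begin

lemma orthobasis_L2c: "orthobasis e n \<Longrightarrow> j \<in> {1..n} \<Longrightarrow> L2c (e j)"
  by (auto simp: orthobasis_def intro: L2c_continuous)

lemma sum_live:
  assumes "orthobasis e n" "m \<le> n" "\<And>j. j \<in> {1..m} \<Longrightarrow> nrm2 (e j) = 0 \<Longrightarrow> y j = (0 :: real)"
  shows "(\<Sum>j=1..m. y j) = (\<Sum>j\<in>live e m. y j)"
proof (rule sum.mono_neutral_right)
  show "\<forall>j\<in>{1..m} - live e m. y j = 0"
  proof
    fix j assume j: "j \<in> {1..m} - live e m"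
    then have "j \<in> {1..n}" using assms(2) by auto
    then have "nrm2 (e j) = 0" using assms(1) j by (auto simp: orthobasis_def live_def)
    then show "y j = 0" using assms(3) j by auto
  qed
qed (auto simp: live_def)

lemma nrm2_sum_orthobasis:
  assumes e: "orthobasis e n" and m: "m \<le> n"
  shows "nrm2 (\<lambda>s. \<Sum>j=1..m. x j * e j s) = (\<Sum>j\<in>live e m. (x j)\<^sup>2)"
proof -
  have L: "L2c (e j)" if "j \<in> {1..m}" for j using orthobasis_L2c[OF e, of j] that m by auto
  have "nrm2 (\<lambda>s. \<Sum>j=1..m. x j * e j s) = (\<Sum>j=1..m. x j * ip (e j) (\<lambda>s. \<Sum>j=1..m. x j * e j s))"
    unfolding nrm2_eq_ip using L by (intro ip_sum L2c_sum) auto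
  also have "\<dots> = (\<Sum>j=1..m. x j * (\<Sum>i=1..m. x i * ip (e i) (e j)))"
    using L by (intro sum.cong refl arg_cong2[where f = "(*)"]) (subst ip_commute, intro ip_sum, auto)
  also have "\<dots> = (\<Sum>j=1..m. x j * (\<Sum>i=1..m. if i = j then x j * nrm2 (e j) else 0))"
    using e m by (intro sum.cong refl arg_cong2[where f = "(*)"]) (auto simp: nrm2_eq_ip orthobasis_def)
  also have "\<dots> = (\<Sum>j=1..m. (x j)\<^sup>2 * nrm2 (e j))" by (simp add: power2_eq_square mult.assoc)
  also have "\<dots> = (\<Sum>j\<in>live e m. (x j)\<^sup>2 * nrm2 (e j))" by (rule sum_live[OF e m]) simp
  also have "\<dots> = (\<Sum>j\<in>live e m. (x j)\<^sup>2)" by (intro sum.cong) (auto simp: live_def)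
  finally show ?thesis .
qed

text \<open>The squared distance of \<open>f\<close> to the span of \<open>e 1, \<dots>, e m\<close>.\<close>

definition bias :: "(nat \<Rightarrow> real \<Rightarrow> real) \<Rightarrow> (real \<Rightarrow> real) \<Rightarrow> nat \<Rightarrow> real" where
  "bias e f m = nrm2 f - (\<Sum>j\<in>live e m. (ip (e j) f)\<^sup>2)"

lemma ip_sum_orthobasis:
  assumes e: "orthobasis e n" and m: "m \<le> n" and f: "L2c f"
  shows "ip (\<lambda>s. \<Sum>j=1..m. x j * e j s) f = (\<Sum>j\<in>live e m. x j * ip (e j) f)"
proof -
  have L: "L2c (e j)" if "j \<in> {1..m}" for j using orthobasis_L2c[OF e, of j] that m by auto
  have "ip (\<lambda>s. \<Sum>j=1..m. x j * e j s) f = (\<Sum>j=1..m. x j * ip (e j) f)"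
    using L f by (intro ip_sum) auto
  also have "\<dots> = (\<Sum>j\<in>live e m. x j * ip (e j) f)"
    using L by (intro sum_live[OF e m]) (simp add: ip_eq_0_of_nrm2_eq_0)
  finally show ?thesis .
qed

lemma L2c_model_sum: "orthobasis e n \<Longrightarrow> m \<le> n \<Longrightarrow> L2c (\<lambda>s. \<Sum>j=1..m. x j * e j s)"
  by (intro L2c_sum orthobasis_L2c) auto

lemma nrm2_model_diff:
  assumes e: "orthobasis e n" and m: "m \<le> n" and f: "L2c f"
  shows "nrm2 (\<lambda>s. (\<Sum>j=1..m. x j * e j s) - f s) = bias e f m + (\<Sum>j\<in>live e m. (x j - ip (e j) f)\<^sup>2)"
proof -
  have "nrm2 (\<lambda>s. (\<Sum>j=1..m. x j * e j s) - f s)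
      = (\<Sum>j\<in>live e m. (x j)\<^sup>2) - 2 * (\<Sum>j\<in>live e m. x j * ip (e j) f) + nrm2 f"
    unfolding nrm2_diff[OF L2c_model_sum[OF e m] f] nrm2_sum_orthobasis[OF e m] ip_sum_orthobasis[OF e m f] ..
  also have "\<dots> = bias e f m + (\<Sum>j\<in>live e m. (x j - ip (e j) f)\<^sup>2)"
    by (simp add: bias_def power2_diff sum.distrib sum_subtractf sum_distrib_left mult.assoc)
  finally show ?thesis .
qed

lemma bias_nonneg:
  assumes "orthobasis e n" "m \<le> n" "L2c f"
  shows "0 \<le> bias e f m"
proof -
  have "0 \<le> nrm2 (\<lambda>s. (\<Sum>j=1..m. ip (e j) f * e j s) - f s)" by (rule nrm2_nonneg)
  then show ?thesis unfolding nrm2_model_diff[OF assms] by simp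
qed

lemma bias_le_nrm2_diff:
  assumes "orthobasis e n" "m \<le> n" "L2c f" "J \<in> model e m"
  shows "bias e f m \<le> nrm2 (\<lambda>s. J s - f s)"
proof -
  obtain x where "J = (\<lambda>s. \<Sum>j=1..m. x j * e j s)" using assms(4) by (auto simp: model_def)
  then show ?thesis using nrm2_model_diff[OF assms(1-3), of x] by (simp add: sum_nonneg)
qed

lemma live_mono: "k \<le> m \<Longrightarrow> live e k \<subseteq> live e m"
  by (auto simp: live_def)

lemma sq_norm_S: "L2c f \<Longrightarrow> sq_norm S f = ennreal (nrm2 f)"
  unfolding L2c_def nrm2_def by (simp add: sq_norm_eq_integral)

end

text \<open>The basis \<open>e\<close> orthogonalises \<open>\<phi>\<close> for the Stieltjes measure and spans the same models.\<close>

locale selection = noisy_copies P F M T A Q X N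
  for P :: "'a measure" and F M T A and Q :: "'b measure" and X N +
  fixes \<phi> e :: "nat \<Rightarrow> real \<Rightarrow> real" and J0 :: "real \<Rightarrow> real" and ccal :: real and mN :: nat
  assumes J0: "L2c J0"
    and ccal: "1 < ccal"
    and mN: "mN \<in> {1..N}"
    and basis: "orthobasis e N"
    and models: "\<And>m. m \<le> N \<Longrightarrow> model e m = model \<phi> m"
begin

abbreviation "estim m \<omega> \<equiv> proj_estimator Q N X A T J0 \<phi> m \<omega>"
abbreviation "adaptive \<equiv> adaptive_estimator Q N X A T J0 \<phi> ccal mN"
abbreviation "sel \<omega> \<equiv> selected_dim Q N X A T J0 \<phi> ccal mN \<omega>"
abbreviation "contr J \<omega> \<equiv> contrast Q N X A T J0 J \<omega>"
abbreviation "pen m \<equiv> penalty ccal N m"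
abbreviation "b m \<equiv> bias e J0 m"

definition "a j = ip (e j) J0"
definition "w j \<omega> = W (e j) \<omega>"
definition "var m \<omega> = (\<Sum>j\<in>live e m. (w j \<omega>)\<^sup>2)"
definition "cross m \<omega> = (\<Sum>j\<in>live e m. a j * w j \<omega>)"
definition "good \<omega> \<longleftrightarrow> (\<forall>j\<in>{1..N}. nrm2 (e j) = 0 \<longrightarrow> w j \<omega> = 0)"

lemma e_continuous: "j \<in> {1..N} \<Longrightarrow> continuous_on {0..T} (e j)"
  using basis by (auto simp: orthobasis_def)

lemma w_measurable: "j \<in> {1..N} \<Longrightarrow> w j \<in> borel_measurable Q"
  unfolding w_def[abs_def] by (intro W_measurable e_continuous)

lemma live_subset: "m \<le> N \<Longrightarrow> live e m \<subseteq> {1..N}"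
  by (auto simp: live_def)

lemma var_measurable: "m \<le> N \<Longrightarrow> var m \<in> borel_measurable Q"
  unfolding var_def[abs_def] using live_subset[of m]
  by (intro borel_measurable_sum borel_measurable_power w_measurable) auto

lemma cross_measurable: "m \<le> N \<Longrightarrow> cross m \<in> borel_measurable Q"
  unfolding cross_def[abs_def] using live_subset[of m]
  by (intro borel_measurable_sum borel_measurable_times borel_measurable_const w_measurable) auto

text \<open>On a fixed almost sure event the noise vanishes on every basis function that vanishes almost
  everywhere. There the contrast depends on the live coordinates only, so its minimisers exist, and
  all of them have the same loss.\<close>

lemma AE_good: "AE \<omega> in Q. good \<omega>"
proof -
  have "AE \<omega> in Q. nrm2 (e j) = 0 \<longrightarrow> w j \<omega> = 0" if j: "j \<in> {1..N}" for j
  proof (cases "nrm2 (e j) = 0")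
    case True
    have [measurable]: "W (e j) \<in> borel_measurable Q" by (rule W_measurable[OF e_continuous[OF j]])
    have "sq_norm Q (W (e j)) = ennreal ((sqrt (nrm2 (e j) / real N))\<^sup>2)"
      by (rule sq_norm_gauss[OF law_W[OF e_continuous[OF j]]]) measurable
    then have "(\<integral>\<^sup>+\<omega>. ennreal ((W (e j) \<omega>)\<^sup>2) \<partial>Q) = 0" using True by (simp add: sq_norm_def)
    then have "AE \<omega> in Q. ennreal ((W (e j) \<omega>)\<^sup>2) = 0" by (subst (asm) nn_integral_0_iff_AE) auto
    then show ?thesis by eventually_elim (simp add: w_def)
  qed simp
  then have "AE \<omega> in Q. \<forall>j\<in>{1..N}. nrm2 (e j) = 0 \<longrightarrow> w j \<omega> = 0"
    by (intro AE_finite_allI) auto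
  then show ?thesis by (simp add: good_def)
qed

lemma contrast_eq:
  assumes "continuous_on {0..T} J"
  shows "contr J \<omega> = nrm2 J - 2 * ip J J0 - 2 * W J \<omega>"
proof -
  have "(\<Sum>i=1..N. (\<integral>s. (J s)\<^sup>2 \<partial>S) - 2 * obs_integral Q (X i) A T J0 J \<omega>)
      = real N * (nrm2 J - 2 * ip J J0) - 2 * (\<Sum>i=1..N. stint i J \<omega>)"
    by (simp add: obs_integral_def nrm2_def ip_def sum_subtractf sum.distrib sum_distrib_left algebra_simps)
  then show ?thesis using N_pos by (simp add: contrast_def W_def diff_divide_distrib)
qed

lemma model_sum_continuous: "m \<le> N \<Longrightarrow> continuous_on {0..T} (\<lambda>s. \<Sum>j=1..m. x j * e j s)"
  by (intro continuous_intros e_continuous) auto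

lemma contrast_model:
  assumes "good \<omega>" and m: "m \<le> N"
  shows "contr (\<lambda>s. \<Sum>j=1..m. x j * e j s) \<omega>
    = (\<Sum>j\<in>live e m. (x j - (a j + w j \<omega>))\<^sup>2) - (\<Sum>j\<in>live e m. (a j + w j \<omega>)\<^sup>2)"
proof -
  have "W (\<lambda>s. \<Sum>j=1..m. x j * e j s) \<omega> = (\<Sum>j=1..m. x j * w j \<omega>)"
    unfolding w_def using m by (intro W_sum e_continuous) auto
  also have "\<dots> = (\<Sum>j\<in>live e m. x j * w j \<omega>)"
    using assms by (intro sum_live[OF basis m]) (auto simp: good_def)
  finally have "contr (\<lambda>s. \<Sum>j=1..m. x j * e j s) \<omega>
      = (\<Sum>j\<in>live e m. (x j)\<^sup>2) - 2 * (\<Sum>j\<in>live e m. x j * a j) - 2 * (\<Sum>j\<in>live e m. x j * w j \<omega>)"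
    unfolding contrast_eq[OF model_sum_continuous[OF m]] nrm2_sum_orthobasis[OF basis m]
      ip_sum_orthobasis[OF basis m J0] a_def by simp
  also have "\<dots> = (\<Sum>j\<in>live e m. (x j - (a j + w j \<omega>))\<^sup>2 - (a j + w j \<omega>)\<^sup>2)"
    unfolding sum_distrib_left sum_subtractf[symmetric]
    by (intro sum.cong refl) (simp add: power2_eq_square algebra_simps)
  finally show ?thesis by (simp only: sum_subtractf)
qed

lemma estimator_coordinates:
  assumes g: "good \<omega>" and m: "m \<le> N"
  obtains x where "estim m \<omega> = (\<lambda>s. \<Sum>j=1..m. x j * e j s)" "\<And>j. j \<in> live e m \<Longrightarrow> x j = a j + w j \<omega>"
proof -
  let ?f = "\<lambda>J. contr J \<omega>" and ?P = "\<lambda>J. J \<in> model \<phi> m"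
  let ?J = "\<lambda>x s. \<Sum>j=1..m. x j * e j s"
  define c where "c = (\<Sum>j\<in>live e m. (a j + w j \<omega>)\<^sup>2)"
  have P: "?P J \<longleftrightarrow> (\<exists>x. J = ?J x)" for J
    unfolding models[OF m, symmetric] by (auto simp: model_def)
  let ?b = "?J (\<lambda>j. a j + w j \<omega>)"
  have fb: "?f ?b = - c" unfolding contrast_model[OF g m] c_def by simp
  have "- c \<le> ?f J" if J: "?P J" for J
  proof -
    obtain x where x: "J = ?J x" using iffD1[OF P J] by (rule exE)
    show ?thesis unfolding x contrast_model[OF g m] c_def by (simp add: sum_nonneg)
  qed
  moreover have "?P ?b" by (rule iffD2[OF P exI]) (rule refl)
  ultimately have "is_arg_min ?f ?P ?b" unfolding is_arg_min_linorder fb by simp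
  then have "is_arg_min ?f ?P (estim m \<omega>)" unfolding proj_estimator_def by (rule is_arg_min_arg_min)
  then have est: "?P (estim m \<omega>)" "?f (estim m \<omega>) \<le> - c"
    unfolding is_arg_min_linorder using \<open>?P ?b\<close> fb by auto
  obtain x where x: "estim m \<omega> = ?J x" using iffD1[OF P est(1)] by (rule exE)
  have "(\<Sum>j\<in>live e m. (x j - (a j + w j \<omega>))\<^sup>2) \<le> 0"
    using est(2) unfolding x contrast_model[OF g m] c_def by simp
  then have "(\<Sum>j\<in>live e m. (x j - (a j + w j \<omega>))\<^sup>2) = 0" by (intro antisym sum_nonneg) auto
  then have "x j = a j + w j \<omega>" if "j \<in> live e m" for j
    using that by (simp add: sum_nonneg_eq_0_iff)
  then show ?thesis using that x by blast
qed

lemma estimator_contrast: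
  assumes "good \<omega>" "m \<le> N"
  shows "contr (estim m \<omega>) \<omega> = b m - nrm2 J0 - 2 * cross m \<omega> - var m \<omega>"
proof -
  obtain x where x: "estim m \<omega> = (\<lambda>s. \<Sum>j=1..m. x j * e j s)" "\<And>j. j \<in> live e m \<Longrightarrow> x j = a j + w j \<omega>"
    using estimator_coordinates[OF assms] by blast
  have "contr (estim m \<omega>) \<omega> = - (\<Sum>j\<in>live e m. (a j + w j \<omega>)\<^sup>2)"
    unfolding x(1) contrast_model[OF assms] using x(2) by simp
  then show ?thesis
    by (simp add: bias_def var_def cross_def a_def power2_sum sum.distrib sum_distrib_left mult.assoc)
qed

lemma estimator_loss:
  assumes "good \<omega>" "m \<le> N"
  shows "sq_norm S (\<lambda>t. estim m \<omega> t - J0 t) = ennreal (b m + var m \<omega>)"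
proof -
  obtain x where x: "estim m \<omega> = (\<lambda>s. \<Sum>j=1..m. x j * e j s)" "\<And>j. j \<in> live e m \<Longrightarrow> x j = a j + w j \<omega>"
    using estimator_coordinates[OF assms] by blast
  have L: "L2c (\<lambda>t. estim m \<omega> t - J0 t)"
    unfolding x(1) using L2c_lincomb[OF L2c_model_sum[OF basis assms(2)] J0, of 1 _ "-1"] by simp
  have "nrm2 (\<lambda>t. estim m \<omega> t - J0 t) = b m + var m \<omega>"
    unfolding x(1) nrm2_model_diff[OF basis assms(2) J0] var_def using x(2) by (simp add: a_def)
  then show ?thesis by (simp add: sq_norm_S[OF L])
qed

lemma selected_dim_minimises:
  assumes "good \<omega>"
  defines "mh \<equiv> sel \<omega>"
  shows "mh \<in> {1..mN}"
    and "m \<in> {1..mN} \<Longrightarrow> b mh - 2 * cross mh \<omega> - var mh \<omega> + pen mh \<le> b m - 2 * cross m \<omega> - var m \<omega> + pen m"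
proof -
  let ?f = "\<lambda>m. contr (estim m \<omega>) \<omega> + pen m"
  have fin: "finite (?f ` {1..mN})" "?f ` {1..mN} \<noteq> {}" using mN by auto
  obtain k where k: "k \<in> {1..mN}" "?f k = Min (?f ` {1..mN})" using Min_in[OF fin] by (metis (no_types, lifting) imageE)
  have "is_arg_min ?f (\<lambda>m. m \<in> {1..mN}) k" unfolding is_arg_min_linorder using k fin by auto
  then have arg: "is_arg_min ?f (\<lambda>m. m \<in> {1..mN}) mh" unfolding mh_def selected_dim_def by (rule is_arg_min_arg_min)
  then show mh: "mh \<in> {1..mN}" by (simp add: is_arg_min_linorder)
  assume m: "m \<in> {1..mN}"
  have "?f mh \<le> ?f m" using arg m by (simp add: is_arg_min_linorder)
  then show "b mh - 2 * cross mh \<omega> - var mh \<omega> + pen mh \<le> b m - 2 * cross m \<omega> - var m \<omega> + pen m"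
    using estimator_contrast[OF assms(1), of mh] estimator_contrast[OF assms(1), of m] mh m mN by auto
qed

section \<open>The oracle inequality\<close>

definition "slack = (ccal - 1) / 3"
definition "level = 1 + slack"
definition "rho = min (1 / 2) (slack / level)"

definition "var_excess \<omega> = (\<Sum>k=1..mN. max 0 (var k \<omega> - level * real k / real N))"
definition "cross_excess m \<omega> = (\<Sum>k=1..mN. max 0 (2 * (cross k \<omega> - cross m \<omega>) - \<bar>b k - b m\<bar> / 2 - slack * real k / real N))"

lemma slack_pos: "0 < slack" "0 < level"
  using ccal by (auto simp: slack_def level_def field_simps)

lemma ccal_eq: "1 + 3 * slack = ccal"
  by (simp add: slack_def field_simps)

lemma rho_pos: "0 < rho" "rho \<le> 1 / 2" "rho * level \<le> slack"
proof -
  show "0 < rho" using slack_pos by (simp add: rho_def)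
  show "rho \<le> 1 / 2" by (simp only: rho_def min.cobounded1)
  have "rho \<le> slack / level" by (simp add: rho_def)
  then show "rho * level \<le> slack" using slack_pos by (simp add: le_divide_eq)
qed

text \<open>One third of the penalty beyond the noise level pays for the deviations of the variance terms, one
  third for those of the cross terms, and the last third for the variance in the risk itself. The cross
  terms between two models cost at most half of the difference of their biases.\<close>

lemma oracle_pointwise:
  assumes g: "good \<omega>" and m: "m \<in> {1..mN}"
  defines "mh \<equiv> sel \<omega>"
  shows "rho * (b mh + var mh \<omega>) \<le> 3 / 2 * b m + pen m + 2 * var_excess \<omega> + cross_excess m \<omega>"
proof -
  have mh: "mh \<in> {1..mN}" and min: "b mh - 2 * cross mh \<omega> - var mh \<omega> + pen mh \<le> b m - 2 * cross m \<omega> - var m \<omega> + pen m"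
    unfolding mh_def using selected_dim_minimises[OF g] m by auto
  have b: "0 \<le> b mh" "0 \<le> b m" using mh m mN by (auto intro!: bias_nonneg[OF basis _ J0])
  have vm: "0 \<le> var m \<omega>" by (simp add: var_def sum_nonneg)
  define r where "r = real mh / real N"
  have r: "0 \<le> r" by (simp add: r_def)
  have "max 0 (var mh \<omega> - level * real mh / real N) \<le> var_excess \<omega>"
    unfolding var_excess_def using mh by (intro member_le_sum) auto
  then have v: "var mh \<omega> \<le> level * r + var_excess \<omega>" "0 \<le> var_excess \<omega>" by (auto simp: r_def)
  have "max 0 (2 * (cross mh \<omega> - cross m \<omega>) - \<bar>b mh - b m\<bar> / 2 - slack * real mh / real N) \<le> cross_excess m \<omega>"
    unfolding cross_excess_def using mh
    by (intro member_le_sum[where f = "\<lambda>k. max 0 (2 * (cross k \<omega> - cross m \<omega>) - \<bar>b k - b m\<bar> / 2 - slack * real k / real N)"]) auto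
  then have c: "2 * (cross mh \<omega> - cross m \<omega>) \<le> \<bar>b mh - b m\<bar> / 2 + slack * r + cross_excess m \<omega>" by (auto simp: r_def)
  have abs: "\<bar>b mh - b m\<bar> \<le> b mh + b m" using b by linarith
  have "pen mh = (1 + 3 * slack) * r" unfolding penalty_def r_def ccal_eq ..
  then have p: "pen mh = r + 3 * (slack * r)" by (simp add: algebra_simps)
  have lr: "level * r = r + slack * r" by (simp add: level_def algebra_simps)
  have half: "b mh / 2 + slack * r \<le> 3 / 2 * b m + pen m + var_excess \<omega> + cross_excess m \<omega>"
    using min v c abs p lr vm by argo
  have "rho * (b mh + var mh \<omega>) \<le> rho * (b mh + (level * r + var_excess \<omega>))"
    using rho_pos v by (intro mult_left_mono) auto
  also have "\<dots> = rho * b mh + (rho * level) * r + rho * var_excess \<omega>" by (simp add: algebra_simps)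
  also have "\<dots> \<le> 1 / 2 * b mh + slack * r + 1 * var_excess \<omega>"
    using rho_pos b r v by (intro add_mono mult_right_mono) auto
  finally show ?thesis using half by simp
qed

text \<open>The difference of two cross terms is the noise of the difference of the two projections of \<^term>\<open>J0\<close>,
  whose squared norm is the difference of the biases.\<close>

lemma cross_increment:
  assumes "k \<le> N" "m \<le> N"
  obtains h s where "continuous_on {0..T} h" "\<And>\<omega>. cross k \<omega> - cross m \<omega> = s * W h \<omega>" "s\<^sup>2 = 1" "nrm2 h = \<bar>b k - b m\<bar>"
proof -
  have le: "\<exists>h. continuous_on {0..T} h \<and> (\<forall>\<omega>. cross k \<omega> - cross m \<omega> = W h \<omega>) \<and> nrm2 h = \<bar>b k - b m\<bar>"
    if mk: "m \<le> k" and kN: "k \<le> N" for k m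
  proof (intro exI conjI allI)
    let ?D = "live e k - live e m"
    let ?h = "\<lambda>s. \<Sum>j\<in>?D. a j * e j s"
    have sub: "live e m \<subseteq> live e k" by (rule live_mono[OF mk])
    have D: "j \<in> {1..N}" "nrm2 (e j) = 1" if "j \<in> ?D" for j using that kN by (auto simp: live_def)
    show "continuous_on {0..T} ?h" using D by (intro continuous_intros e_continuous) auto
    have "W ?h \<omega> = (\<Sum>j\<in>?D. a j * w j \<omega>)" for \<omega>
      unfolding w_def using D by (intro W_sum e_continuous) auto
    then show "cross k \<omega> - cross m \<omega> = W ?h \<omega>" for \<omega>
      unfolding cross_def by (simp add: sum_diff[OF finite_live sub])
    have "nrm2 ?h = (\<Sum>j\<in>?D. (a j)\<^sup>2)"
    proof (rule nrm2_sum_orthonormal)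
      show "ip (e i) (e j) = 0" if "i \<in> ?D" "j \<in> ?D" "i \<noteq> j" for i j
        using basis D(1)[OF that(1)] D(1)[OF that(2)] that(3) by (simp add: orthobasis_def)
    qed (use D in \<open>auto intro: orthobasis_L2c[OF basis]\<close>)
    moreover have "b m - b k = (\<Sum>j\<in>?D. (a j)\<^sup>2)"
      by (simp add: bias_def a_def sum_diff[OF finite_live sub])
    ultimately show "nrm2 ?h = \<bar>b k - b m\<bar>"
      using sum_nonneg[of ?D "\<lambda>j. (a j)\<^sup>2"] by simp
  qed
  show ?thesis
  proof (cases "m \<le> k")
    case True
    then obtain h where "continuous_on {0..T} h" "\<forall>\<omega>. cross k \<omega> - cross m \<omega> = W h \<omega>" "nrm2 h = \<bar>b k - b m\<bar>"
      using le assms by blast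
    then show ?thesis using that[of h 1] by simp
  next
    case False
    then obtain h where h: "continuous_on {0..T} h" "\<forall>\<omega>. cross m \<omega> - cross k \<omega> = W h \<omega>" "nrm2 h = \<bar>b m - b k\<bar>"
      using le[of k m] assms by auto
    have "cross k \<omega> - cross m \<omega> = (-1) * W h \<omega>" for \<omega> using h(2)[rule_format, of \<omega>] by simp
    then show ?thesis using that[of h "-1"] h by (simp add: abs_minus_commute)
  qed
qed

text \<open>At the exponent \<open>N/4\<close> the Gaussian exponential moment of the doubled cross term is exactly compensated by
  half of the bias difference.\<close>

lemma nn_cross_excess:
  assumes m: "m \<le> N"
  shows "(\<integral>\<^sup>+\<omega>. ennreal (cross_excess m \<omega>) \<partial>Q) \<le> ennreal (4 / (1 - exp (- slack / 4)) / real N)"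
proof -
  define q where "q = exp (- slack / 4)"
  have q: "0 \<le> q" "q < 1" using slack_pos by (auto simp: q_def)
  let ?Z = "\<lambda>k \<omega>. 2 * (cross k \<omega> - cross m \<omega>) - \<bar>b k - b m\<bar> / 2"
  have Zm: "?Z k \<in> borel_measurable Q" if "k \<le> N" for k
    using cross_measurable[OF that] cross_measurable[OF m] by measurable
  have N: "0 < real N" using N_pos by simp
  have summand_le: "(\<integral>\<^sup>+\<omega>. ennreal (max 0 (?Z k \<omega> - slack * real k / real N)) \<partial>Q) \<le> ennreal (4 / real N * q ^ k)"
    if k: "k \<le> N" for k
  proof -
    obtain h s where h: "continuous_on {0..T} h" "\<And>\<omega>. cross k \<omega> - cross m \<omega> = s * W h \<omega>" "s\<^sup>2 = 1" "nrm2 h = \<bar>b k - b m\<bar>"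
      using cross_increment[OF k m] by blast
    define d where "d = \<bar>b k - b m\<bar>"
    have "(\<integral>\<^sup>+\<omega>. ennreal (exp (real N / 4 * ?Z k \<omega>)) \<partial>Q)
        = (\<integral>\<^sup>+\<omega>. ennreal (exp (- (real N * d / 8))) * ennreal (exp ((real N / 2 * s) * W h \<omega>)) \<partial>Q)"
      by (intro nn_integral_cong) (simp add: h(2) d_def ennreal_mult[symmetric] mult_exp_exp algebra_simps)
    also have "\<dots> = ennreal (exp (- (real N * d / 8))) * (\<integral>\<^sup>+\<omega>. ennreal (exp ((real N / 2 * s) * W h \<omega>)) \<partial>Q)"
      using W_measurable[OF h(1)] by (intro nn_integral_cmult) measurable
    also have "\<dots> = ennreal (exp (- (real N * d / 8))) * ennreal (exp ((real N / 2 * s)\<^sup>2 * d / (2 * real N)))"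
      by (simp only: nn_exp_W[OF h(1)] h(4) d_def)
    also have "(real N / 2 * s)\<^sup>2 * d / (2 * real N) = real N * d / 8"
      using N h(3) by (simp add: power_mult_distrib power_divide power2_eq_square[of "real N"])
    also have "ennreal (exp (- (real N * d / 8))) * ennreal (exp (real N * d / 8)) = ennreal 1"
      by (simp add: ennreal_mult[symmetric] mult_exp_exp)
    finally have "(\<integral>\<^sup>+\<omega>. ennreal (exp (real N / 4 * ?Z k \<omega>)) \<partial>Q) \<le> ennreal 1" by simp
    from nn_pos_part_le[OF _ Zm[OF k] this, of "slack * real k / real N"]
    have "(\<integral>\<^sup>+\<omega>. ennreal (max 0 (?Z k \<omega> - slack * real k / real N)) \<partial>Q)
        \<le> ennreal (1 * exp (- (real N / 4 * (slack * real k / real N))) / (real N / 4))" using N by simp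
    also have "1 * exp (- (real N / 4 * (slack * real k / real N))) / (real N / 4) = 4 / real N * q ^ k"
      using N by (simp add: q_def exp_of_nat_mult[symmetric] field_simps)
    finally show ?thesis .
  qed
  have "(\<integral>\<^sup>+\<omega>. ennreal (cross_excess m \<omega>) \<partial>Q) = (\<integral>\<^sup>+\<omega>. (\<Sum>k=1..mN. ennreal (max 0 (?Z k \<omega> - slack * real k / real N))) \<partial>Q)"
    unfolding cross_excess_def by (intro nn_integral_cong sum_ennreal[symmetric]) (rule max.cobounded1)
  also have "\<dots> = (\<Sum>k=1..mN. \<integral>\<^sup>+\<omega>. ennreal (max 0 (?Z k \<omega> - slack * real k / real N)) \<partial>Q)"
  proof (rule nn_integral_sum)
    fix k assume "k \<in> {1..mN}"
    then have [measurable]: "?Z k \<in> borel_measurable Q" using mN by (intro Zm) auto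
    show "(\<lambda>\<omega>. ennreal (max 0 (?Z k \<omega> - slack * real k / real N))) \<in> borel_measurable Q" by measurable
  qed
  also have "\<dots> \<le> (\<Sum>k=1..mN. ennreal (4 / real N * q ^ k))"
    using mN by (intro sum_mono summand_le) auto
  also have "\<dots> = ennreal (4 / real N * (\<Sum>k=1..mN. q ^ k))"
    using q by (subst sum_ennreal) (auto simp: sum_distrib_left)
  also have "\<dots> \<le> ennreal (4 / real N * (1 / (1 - q)))"
    by (intro ennreal_leI mult_left_mono sum_geometric_le q) simp
  finally show ?thesis by (simp add: q_def field_simps)
qed

lemma nn_var_excess:
  fixes \<theta> q :: real
  defines "\<theta> \<equiv> slack / (2 * level\<^sup>2)" and "q \<equiv> exp (- (slack / (2 * level\<^sup>2) * level)) / sqrt (1 - 2 * (slack / (2 * level\<^sup>2)))"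
  shows "(\<integral>\<^sup>+\<omega>. ennreal (var_excess \<omega>) \<partial>Q) \<le> ennreal (1 / (\<theta> * (1 - q)) / real N)"
proof -
  have \<theta>: "0 < \<theta>" "\<theta> < 1 / 2" and q: "0 \<le> q" "q < 1"
    using chi_square_rate_less_1[OF slack_pos(1)] unfolding \<theta>_def q_def level_def by auto
  have q_eq: "q = exp (- (\<theta> * level)) / sqrt (1 - 2 * \<theta>)" by (simp add: q_def \<theta>_def)
  have N: "0 < real N" using N_pos by simp
  have root: "1 \<le> 1 / sqrt (1 - 2 * \<theta>)" using \<theta> by simp
  have summand_le: "(\<integral>\<^sup>+\<omega>. ennreal (max 0 (var k \<omega> - level * real k / real N)) \<partial>Q) \<le> ennreal (1 / (\<theta> * real N) * q ^ k)"
    if k: "k \<le> N" for k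
  proof -
    have "(\<integral>\<^sup>+\<omega>. ennreal (exp (\<theta> * real N * var k \<omega>)) \<partial>Q) = ennreal (1 / sqrt (1 - 2 * \<theta>)) ^ card (live e k)"
      unfolding var_def w_def
    proof (rule nn_exp_sum_sq)
      fix j assume j: "j \<in> live e k"
      then have jN: "j \<in> {1..N}" using live_subset[OF k] by blast
      then show "continuous_on {0..T} (e j)" by (rule e_continuous)
      show "nrm2 (e j) = 1" using j by (simp add: live_def)
      fix i assume "i \<in> live e k" "i \<noteq> j"
      moreover from this have "i \<in> {1..N}" using live_subset[OF k] by blast
      ultimately show "ip (e i) (e j) = 0" using jN basis unfolding orthobasis_def by blast
    qed (use \<theta> in auto)
    also have "\<dots> \<le> ennreal ((1 / sqrt (1 - 2 * \<theta>)) ^ k)"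
      using root card_live_le[of e k] \<theta> by (subst ennreal_power) (auto intro!: ennreal_leI power_increasing)
    finally have "(\<integral>\<^sup>+\<omega>. ennreal (exp (\<theta> * real N * var k \<omega>)) \<partial>Q) \<le> ennreal ((1 / sqrt (1 - 2 * \<theta>)) ^ k)" .
    from nn_pos_part_le[OF _ var_measurable[OF k] this, of "level * real k / real N"]
    have "(\<integral>\<^sup>+\<omega>. ennreal (max 0 (var k \<omega> - level * real k / real N)) \<partial>Q)
        \<le> ennreal ((1 / sqrt (1 - 2 * \<theta>)) ^ k * exp (- (\<theta> * real N * (level * real k / real N))) / (\<theta> * real N))"
      using N \<theta> by simp
    also have "exp (- (\<theta> * real N * (level * real k / real N))) = exp (- (\<theta> * level)) ^ k"
      using N by (simp add: exp_of_nat_mult[symmetric] mult_ac)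
    also have "(1 / sqrt (1 - 2 * \<theta>)) ^ k * exp (- (\<theta> * level)) ^ k / (\<theta> * real N) = 1 / (\<theta> * real N) * q ^ k"
      by (simp add: q_eq power_mult_distrib[symmetric])
    finally show ?thesis .
  qed
  have "(\<integral>\<^sup>+\<omega>. ennreal (var_excess \<omega>) \<partial>Q) = (\<integral>\<^sup>+\<omega>. (\<Sum>k=1..mN. ennreal (max 0 (var k \<omega> - level * real k / real N))) \<partial>Q)"
    unfolding var_excess_def by (intro nn_integral_cong sum_ennreal[symmetric]) (rule max.cobounded1)
  also have "\<dots> = (\<Sum>k=1..mN. \<integral>\<^sup>+\<omega>. ennreal (max 0 (var k \<omega> - level * real k / real N)) \<partial>Q)"
  proof (rule nn_integral_sum)
    fix k assume "k \<in> {1..mN}"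
    then have [measurable]: "var k \<in> borel_measurable Q" using mN by (intro var_measurable) auto
    show "(\<lambda>\<omega>. ennreal (max 0 (var k \<omega> - level * real k / real N))) \<in> borel_measurable Q" by measurable
  qed
  also have "\<dots> \<le> (\<Sum>k=1..mN. ennreal (1 / (\<theta> * real N) * q ^ k))"
    using mN by (intro sum_mono summand_le) auto
  also have "\<dots> = ennreal (1 / (\<theta> * real N) * (\<Sum>k=1..mN. q ^ k))"
    using q \<theta> by (subst sum_ennreal) (auto simp: sum_distrib_left)
  also have "\<dots> \<le> ennreal (1 / (\<theta> * real N) * (1 / (1 - q)))"
    using \<theta> by (intro ennreal_leI mult_left_mono sum_geometric_le q) simp
  finally show ?thesis by (simp add: mult_ac)
qed

lemma oracle_const_eq:
  "oracle_const ccal = (3 / 2 + 2 * (1 / (slack / (2 * level\<^sup>2) * (1 - exp (- (slack / (2 * level\<^sup>2) * level)) / sqrt (1 - 2 * (slack / (2 * level\<^sup>2))))))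
     + 4 / (1 - exp (- slack / 4))) / rho"
  unfolding oracle_const_def Let_def rho_def level_def slack_def by simp

text \<open>Losses are compared outcome by outcome with a measurable bound, so no measurability in the outcome has
  to be known for them. The factor \<^term>\<open>r\<close> makes the inequality apply to the loss in Lebesgue
  measure as well.\<close>

lemma oracle_inequality:
  assumes m: "m \<in> {1..mN}" and r: "0 \<le> r"
    and L: "\<And>\<omega>. good \<omega> \<Longrightarrow> L \<omega> \<le> ennreal r * sq_norm S (\<lambda>t. adaptive \<omega> t - J0 t)"
  shows "(\<integral>\<^sup>+\<omega>. L \<omega> \<partial>Q) \<le> ennreal (oracle_const ccal * r * (b m + pen m + 1 / real N))"
proof -
  define \<theta> where "\<theta> = slack / (2 * level\<^sup>2)"
  define q where "q = exp (- (slack / (2 * level\<^sup>2) * level)) / sqrt (1 - 2 * (slack / (2 * level\<^sup>2)))"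
  define K1 where "K1 = 1 / (\<theta> * (1 - q))"
  define K2 where "K2 = 4 / (1 - exp (- slack / 4))"
  have \<theta>: "0 < \<theta>" "0 \<le> q" "q < 1"
    using chi_square_rate_less_1[OF slack_pos(1)] unfolding \<theta>_def q_def level_def by auto
  have K: "0 \<le> K1" "0 \<le> K2" using \<theta> slack_pos by (auto simp: K1_def K2_def)
  have const: "oracle_const ccal = (3 / 2 + 2 * K1 + K2) / rho"
    unfolding oracle_const_eq K1_def K2_def \<theta>_def q_def by simp
  have mN': "m \<le> N" using m mN by auto
  have b: "0 \<le> b m" by (rule bias_nonneg[OF basis mN' J0])
  have p: "0 \<le> pen m" using ccal by (simp add: penalty_def)
  have N: "0 < real N" using N_pos by simp
  have vm: "var_excess \<in> borel_measurable Q"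
  proof -
    have "(\<lambda>\<omega>. max 0 (var k \<omega> - level * real k / real N)) \<in> borel_measurable Q" if "k \<in> {1..mN}" for k
    proof -
      have [measurable]: "var k \<in> borel_measurable Q" using that mN by (intro var_measurable) auto
      show ?thesis by measurable
    qed
    then show ?thesis unfolding var_excess_def[abs_def] by (rule borel_measurable_sum)
  qed
  have cm: "cross_excess m \<in> borel_measurable Q"
  proof -
    have "(\<lambda>\<omega>. max 0 (2 * (cross k \<omega> - cross m \<omega>) - \<bar>b k - b m\<bar> / 2 - slack * real k / real N)) \<in> borel_measurable Q" if "k \<in> {1..mN}" for k
    proof -
      have [measurable]: "cross k \<in> borel_measurable Q" "cross m \<in> borel_measurable Q"
        using that mN mN' by (auto intro!: cross_measurable)
      show ?thesis by measurable
    qed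
    then show ?thesis unfolding cross_excess_def[abs_def] by (rule borel_measurable_sum)
  qed
  have nn: "0 \<le> var_excess \<omega>" "0 \<le> cross_excess m \<omega>" for \<omega>
    by (auto simp: var_excess_def cross_excess_def intro!: sum_nonneg)
  define D where "D = 3 / 2 * b m + pen m"
  have D: "0 \<le> D" using b p by (simp add: D_def)
  have "(\<integral>\<^sup>+\<omega>. L \<omega> \<partial>Q)
      \<le> (\<integral>\<^sup>+\<omega>. ennreal (r / rho) * (ennreal D + (2 * ennreal (var_excess \<omega>) + ennreal (cross_excess m \<omega>))) \<partial>Q)"
  proof (rule nn_integral_mono_AE, use AE_good in eventually_elim)
    fix \<omega> assume g: "good \<omega>"
    let ?mh = "sel \<omega>"
    have mh: "?mh \<le> N" using selected_dim_minimises(1)[OF g] mN by auto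
    have "L \<omega> \<le> ennreal r * sq_norm S (\<lambda>t. adaptive \<omega> t - J0 t)"
      by (rule L[OF g])
    also have "\<dots> = ennreal r * ennreal (b ?mh + var ?mh \<omega>)"
      unfolding adaptive_estimator_def by (simp only: estimator_loss[OF g mh])
    also have "\<dots> \<le> ennreal r * ennreal (1 / rho * (D + (2 * var_excess \<omega> + cross_excess m \<omega>)))"
      using oracle_pointwise[OF g m] rho_pos
      by (intro mult_left_mono ennreal_leI) (auto simp: D_def le_divide_eq mult.commute)
    also have "\<dots> = ennreal (r / rho * (D + (2 * var_excess \<omega> + cross_excess m \<omega>)))"
      using nn[of \<omega>] D rho_pos r by (subst ennreal_mult[symmetric]) auto
    also have "\<dots> = ennreal (r / rho) * (ennreal D + (2 * ennreal (var_excess \<omega>) + ennreal (cross_excess m \<omega>)))"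
      using nn[of \<omega>] D rho_pos r by (intro ennreal_affine) auto
    finally show "L \<omega> \<le> ennreal (r / rho) * (ennreal D + (2 * ennreal (var_excess \<omega>) + ennreal (cross_excess m \<omega>)))" .
  qed
  also have "\<dots> = ennreal (r / rho) * (ennreal D + (2 * (\<integral>\<^sup>+\<omega>. ennreal (var_excess \<omega>) \<partial>Q) + (\<integral>\<^sup>+\<omega>. ennreal (cross_excess m \<omega>) \<partial>Q)))"
    using vm cm by (simp add: nn_integral_cmult nn_integral_add Q.emeasure_space_1)
  also have "\<dots> \<le> ennreal (r / rho) * (ennreal D + (2 * ennreal (K1 / real N) + ennreal (K2 / real N)))"
    using nn_var_excess nn_cross_excess[OF mN'] unfolding K1_def K2_def \<theta>_def q_def
    by (intro mult_left_mono add_mono order.refl) auto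
  also have "\<dots> = ennreal (r / rho * (D + (2 * (K1 / real N) + K2 / real N)))"
    using K D rho_pos r by (intro ennreal_affine[symmetric]) auto
  also have "\<dots> \<le> ennreal (oracle_const ccal * r * (b m + pen m + 1 / real N))"
  proof (rule ennreal_leI)
    define y where "y = 1 / real N"
    have y: "0 \<le> y" by (simp add: y_def)
    have "D + (2 * (K1 / real N) + K2 / real N) = 3 / 2 * b m + pen m + (2 * K1 + K2) * y"
      by (simp add: D_def y_def add_divide_distrib)
    also have "\<dots> \<le> (3 / 2 + 2 * K1 + K2) * b m + (3 / 2 + 2 * K1 + K2) * pen m + (3 / 2 + 2 * K1 + K2) * y"
    proof -
      have "3 / 2 * b m \<le> (3 / 2 + 2 * K1 + K2) * b m" "(2 * K1 + K2) * y \<le> (3 / 2 + 2 * K1 + K2) * y"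
        using K b y by (intro mult_right_mono; linarith)+
      moreover have "1 * pen m \<le> (3 / 2 + 2 * K1 + K2) * pen m"
        using K p by (intro mult_right_mono; linarith)
      ultimately show ?thesis by linarith
    qed
    also have "\<dots> = (3 / 2 + 2 * K1 + K2) * (b m + pen m + y)" by (simp add: distrib_left)
    finally have "r / rho * (D + (2 * (K1 / real N) + K2 / real N)) \<le> r / rho * ((3 / 2 + 2 * K1 + K2) * (b m + pen m + y))"
      using rho_pos r by (intro mult_left_mono) auto
    then show "r / rho * (D + (2 * (K1 / real N) + K2 / real N)) \<le> oracle_const ccal * r * (b m + pen m + 1 / real N)"
      by (simp add: const y_def mult_ac)
  qed
  finally show ?thesis .
qed

lemma estimator_continuous: "good \<omega> \<Longrightarrow> m \<le> N \<Longrightarrow> continuous_on {0..T} (estim m \<omega>)"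
  using estimator_coordinates[of \<omega> m] model_sum_continuous[of m] by metis

lemma bias_le_risk:
  assumes "m \<le> N"
  shows "ennreal (b m) \<le> risk Q S (estim m) J0"
proof -
  have "ennreal (b m) = (\<integral>\<^sup>+\<omega>. ennreal (b m) \<partial>Q)" by (simp add: Q.emeasure_space_1)
  also have "\<dots> \<le> risk Q S (estim m) J0"
    unfolding risk_def
  proof (rule nn_integral_mono_AE, use AE_good in eventually_elim)
    fix \<omega> assume "good \<omega>"
    have "0 \<le> var m \<omega>" by (simp add: var_def sum_nonneg)
    then show "ennreal (b m) \<le> sq_norm S (\<lambda>t. estim m \<omega> t - J0 t)"
      unfolding estimator_loss[OF \<open>good \<omega>\<close> assms] by (intro ennreal_leI) simp
  qed
  finally show ?thesis .
qed

end

section \<open>Quadratic variations with a density\<close>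

context stieltjes_clock
begin

lemma emeasure_Aext_greaterThan: "emeasure (interval_measure Aext) {x<..} = ennreal (A T - Aext x)"
proof (rule tendsto_unique[OF sequentially_bot])
  have rc: "continuous (at_right a) Aext" for a
    using Aext_cont by (auto simp: continuous_on_eq_continuous_within intro: continuous_within_subset)
  have "(\<lambda>n. emeasure (interval_measure Aext) {x<..x + real n}) \<longlonglongrightarrow> emeasure (interval_measure Aext) (\<Union>n. {x<..x + real n})"
    by (rule Lim_emeasure_incseq) (auto simp: incseq_def)
  also have "(\<Union>n. {x<..x + real n}) = {x<..}"
  proof safe
    fix y assume "x < y"
    obtain n :: nat where "y - x \<le> real n" using real_arch_simple by blast
    then show "y \<in> (\<Union>n. {x<..x + real n})" using \<open>x < y\<close> by (auto intro!: exI[of _ n])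
  qed auto
  finally show "(\<lambda>n. emeasure (interval_measure Aext) {x<..x + real n}) \<longlonglongrightarrow> emeasure (interval_measure Aext) {x<..}" .
  show "(\<lambda>n. emeasure (interval_measure Aext) {x<..x + real n}) \<longlonglongrightarrow> ennreal (A T - Aext x)"
  proof (rule tendsto_eventually)
    obtain n0 :: nat where n0: "T - x \<le> real n0" using real_arch_simple by blast
    show "\<forall>\<^sub>F n in sequentially. emeasure (interval_measure Aext) {x<..x + real n} = ennreal (A T - Aext x)"
      using eventually_ge_at_top[of n0]
    proof eventually_elim
      fix n assume "n0 \<le> n"
      then have "T \<le> x + real n" using n0 by linarith
      then have "Aext (x + real n) = A T" using T_pos by (simp add: Aext_def)
      then show "emeasure (interval_measure Aext) {x<..x + real n} = ennreal (A T - Aext x)"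
        using emeasure_interval_measure_Ioc[of x "x + real n" Aext, OF _ Aext_mono rc] by simp
    qed
  qed
qed

abbreviation "wproj \<mu> \<phi> m f \<equiv> orth_proj (leb_on T) (weighted_model T \<mu> \<phi> m) (\<lambda>s. sqrt (\<mu> s) * f s)"

context
  fixes \<mu> \<nu> :: "real \<Rightarrow> real"
  assumes dens: "is_density T A \<mu> \<nu>"
begin

text \<open>The density with the value \<open>0\<close> outside \<open>(0,T]\<close>, where \<open>\<mu>\<close> is unconstrained.\<close>

definition pos_density :: "real \<Rightarrow> real" where
  "pos_density s = indicator {0<..T} s * \<mu> s"

lemma \<mu>_pos: "t \<in> {0<..T} \<Longrightarrow> 0 < \<mu> t"
  using dens by (auto simp: is_density_def)

lemma pos_density_nonneg: "0 \<le> pos_density s"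
  using \<mu>_pos[of s] by (auto simp: pos_density_def indicator_def)

lemma \<mu>_integrable: "t \<in> {0..T} \<Longrightarrow> integrable lborel (\<lambda>s. indicator {0<..t} s * \<mu> s)"
  using dens by (auto simp: is_density_def set_integrable_def)

lemma \<mu>_integral: "t \<in> {0..T} \<Longrightarrow> (\<integral>s. indicator {0<..t} s * \<mu> s \<partial>lborel) = A t"
  using dens by (auto simp: is_density_def set_lebesgue_integral_def)

lemma pos_density_measurable [measurable]: "pos_density \<in> borel_measurable borel"
  using borel_measurable_integrable[OF \<mu>_integrable[of T]] T_pos
  by (simp add: pos_density_def[abs_def])

lemma interval_measure_eq_density: "interval_measure Aext = density lborel (\<lambda>s. ennreal (pos_density s))"
proof (rule measure_eqI_lessThan)
  show "emeasure (interval_measure Aext) {x<..} < \<infinity>" for x by (simp add: emeasure_Aext_greaterThan)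
  fix x :: real
  define y where "y = max 0 (min T x)"
  have y: "y \<in> {0..T}" using T_pos by (auto simp: y_def)
  have eq: "pos_density s * indicator {x<..} s = indicator {0<..T} s * \<mu> s - indicator {0<..y} s * \<mu> s" for s
    using T_pos by (auto simp: pos_density_def y_def indicator_def max_def min_def)
  have T: "T \<in> {0..T}" using T_pos by simp
  have "emeasure (density lborel (\<lambda>s. ennreal (pos_density s))) {x<..} = (\<integral>\<^sup>+s. ennreal (pos_density s) * indicator {x<..} s \<partial>lborel)"
    by (rule emeasure_density) measurable
  also have "\<dots> = (\<integral>\<^sup>+s. ennreal (pos_density s * indicator {x<..} s) \<partial>lborel)"
    by (intro nn_integral_cong) (auto simp: indicator_def)
  also have "\<dots> = ennreal (\<integral>s. pos_density s * indicator {x<..} s \<partial>lborel)"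
  proof (rule nn_integral_eq_integral)
    show "integrable lborel (\<lambda>s. pos_density s * indicator {x<..} s)"
      unfolding eq using \<mu>_integrable[OF T] \<mu>_integrable[OF y] by (rule Bochner_Integration.integrable_diff)
  qed (simp add: pos_density_nonneg)
  also have "(\<integral>s. pos_density s * indicator {x<..} s \<partial>lborel) = A T - A y"
    unfolding eq using \<mu>_integrable[OF T] \<mu>_integrable[OF y] \<mu>_integral[OF T] \<mu>_integral[OF y] by simp
  finally show "emeasure (interval_measure Aext) {x<..} = emeasure (density lborel (\<lambda>s. ennreal (pos_density s))) {x<..}"
    by (simp add: emeasure_Aext_greaterThan Aext_def y_def)
qed simp_all

lemma sets_leb_on: "sets (leb_on T) = sets (restrict_space borel {0..T})"
  unfolding leb_on_def by (intro sets_restrict_space_cong) simp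

lemma space_leb_on: "space (leb_on T) = {0..T}"
  by (simp add: leb_on_def space_restrict_space)

lemma measurable_leb_on_iff: "f \<in> borel_measurable (leb_on T) \<longleftrightarrow> f \<in> borel_measurable S"
  by (simp add: measurable_cong_sets[OF sets_leb_on refl] measurable_cong_sets[OF sets_stieltjes refl])

lemma pos_density_measurable_leb: "pos_density \<in> borel_measurable (leb_on T)"
  unfolding measurable_leb_on_iff by (rule borel_imp_measurable_stieltjes) measurable

lemma S_eq_density: "S = density (leb_on T) (\<lambda>s. ennreal (pos_density s))"
proof (rule measure_eqI)
  show "sets S = sets (density (leb_on T) (\<lambda>s. ennreal (pos_density s)))"
    by (simp add: sets_leb_on sets_stieltjes)
  fix B assume B: "B \<in> sets S"
  then have sub: "B \<subseteq> {0..T}" and Bb: "B \<in> sets borel"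
    unfolding sets_stieltjes by (auto simp: sets_restrict_space_iff)
  have [measurable]: "pos_density \<in> borel_measurable (leb_on T)" by (rule pos_density_measurable_leb)
  have "emeasure S B = emeasure (density lborel (\<lambda>s. ennreal (pos_density s))) B"
    unfolding S_eq using sub by (subst emeasure_restrict_space) (auto simp: interval_measure_eq_density)
  also have "\<dots> = (\<integral>\<^sup>+s. ennreal (pos_density s) * indicator B s \<partial>lborel)"
    using Bb by (subst emeasure_density) auto
  also have "\<dots> = (\<integral>\<^sup>+s. ennreal (pos_density s) * indicator B s * indicator {0..T} s \<partial>lborel)"
    using sub by (intro nn_integral_cong) (auto simp: indicator_def)
  also have "\<dots> = (\<integral>\<^sup>+s. ennreal (pos_density s) * indicator B s \<partial>leb_on T)"
    unfolding leb_on_def by (subst nn_integral_restrict_space) auto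
  also have "\<dots> = emeasure (density (leb_on T) (\<lambda>s. ennreal (pos_density s))) B"
    using B by (subst emeasure_density) (auto simp: sets_leb_on sets_stieltjes)
  finally show "emeasure S B = emeasure (density (leb_on T) (\<lambda>s. ennreal (pos_density s))) B" .
qed

lemma sqrt_pos_density_mult_measurable:
  assumes "f \<in> borel_measurable S"
  shows "(\<lambda>t. sqrt (pos_density t) * f t) \<in> borel_measurable (leb_on T)"
proof -
  have [measurable]: "f \<in> borel_measurable (leb_on T)" "pos_density \<in> borel_measurable (leb_on T)"
    using assms pos_density_measurable_leb by (simp_all only: measurable_leb_on_iff)
  show ?thesis by measurable
qed

lemma AE_leb_pos: "AE t in leb_on T. t \<in> {0<..T}"
proof -
  have "AE t in lborel. t \<noteq> (0::real)" by (rule AE_lborel_singleton)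
  then show ?thesis unfolding leb_on_def
    by (subst AE_restrict_space_iff) (auto elim!: eventually_mono)
qed

lemma sq_norm_S_eq_leb:
  assumes "f \<in> borel_measurable S"
  shows "sq_norm S f = sq_norm (leb_on T) (\<lambda>t. sqrt (pos_density t) * f t)"
proof -
  have f: "f \<in> borel_measurable (leb_on T)" using assms by (simp add: measurable_leb_on_iff)
  have "sq_norm S f = (\<integral>\<^sup>+t. ennreal (pos_density t) * ennreal ((f t)\<^sup>2) \<partial>leb_on T)"
    unfolding sq_norm_def by (subst S_eq_density, rule nn_integral_density) (use f pos_density_measurable_leb in auto)
  also have "\<dots> = sq_norm (leb_on T) (\<lambda>t. sqrt (pos_density t) * f t)"
    unfolding sq_norm_def
    by (intro nn_integral_cong) (simp add: power_mult_distrib pos_density_nonneg ennreal_mult)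
  finally show ?thesis .
qed

lemma sup_norm_\<nu>: "t \<in> {0<..T} \<Longrightarrow> 1 \<le> sup_norm T \<nu> * \<mu> t" "0 \<le> sup_norm T \<nu>"
proof -
  have "continuous_on {0..T} \<nu>" using dens by (auto simp: is_density_def)
  from continuous_on_bounded[OF this] obtain K where K: "\<And>t. t \<in> {0..T} \<Longrightarrow> \<bar>\<nu> t\<bar> \<le> K" by blast
  have bdd: "bdd_above ((\<lambda>t. \<bar>\<nu> t\<bar>) ` {0..T})" using K by (auto intro!: bdd_aboveI[of _ K])
  have le: "\<bar>\<nu> t\<bar> \<le> sup_norm T \<nu>" if "t \<in> {0..T}" for t
    unfolding sup_norm_def using that bdd by (rule cSUP_upper)
  show "0 \<le> sup_norm T \<nu>" using le[of 0] T_pos by (simp add: order.trans[OF abs_ge_zero])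
  assume t: "t \<in> {0<..T}"
  then have "\<nu> t = 1 / \<mu> t" using dens by (auto simp: is_density_def)
  then have "1 = \<nu> t * \<mu> t" using \<mu>_pos[OF t] by simp
  also have "\<dots> \<le> sup_norm T \<nu> * \<mu> t"
    using le[of t] t \<mu>_pos[OF t] by (intro mult_right_mono) auto
  finally show "1 \<le> sup_norm T \<nu> * \<mu> t" .
qed

lemma sq_norm_leb_le:
  assumes f: "f \<in> borel_measurable S"
  shows "sq_norm (leb_on T) f \<le> ennreal (sup_norm T \<nu>) * sq_norm S f"
proof -
  note m = sqrt_pos_density_mult_measurable[OF f]
  have "sq_norm (leb_on T) f \<le> (\<integral>\<^sup>+t. ennreal (sup_norm T \<nu>) * ennreal ((sqrt (pos_density t) * f t)\<^sup>2) \<partial>leb_on T)"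
    unfolding sq_norm_def
  proof (rule nn_integral_mono_AE, use AE_leb_pos in eventually_elim)
    fix t assume t: "t \<in> {0<..T}"
    have "1 * (f t)\<^sup>2 \<le> (sup_norm T \<nu> * \<mu> t) * (f t)\<^sup>2"
      by (intro mult_right_mono sup_norm_\<nu>(1)[OF t]) simp
    also have "\<dots> = sup_norm T \<nu> * (sqrt (pos_density t) * f t)\<^sup>2"
      using t \<mu>_pos[OF t] by (simp add: power_mult_distrib pos_density_def mult.assoc)
    finally show "ennreal ((f t)\<^sup>2) \<le> ennreal (sup_norm T \<nu>) * ennreal ((sqrt (pos_density t) * f t)\<^sup>2)"
      using sup_norm_\<nu>(2) by (simp add: ennreal_mult[symmetric] ennreal_leI)
  qed
  also have "\<dots> = ennreal (sup_norm T \<nu>) * sq_norm (leb_on T) (\<lambda>t. sqrt (pos_density t) * f t)"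
    unfolding sq_norm_def by (intro nn_integral_cmult measurable_compose[OF borel_measurable_power[OF m] measurable_ennreal])
  finally show ?thesis by (simp only: sq_norm_S_eq_leb[OF f])
qed

text \<open>Multiplication by the square root of the density is an isometry that carries the models and the
  projections for the Stieltjes measure to those for Lebesgue measure.\<close>

lemma orth_proj_in_weighted_model:
  assumes e: "orthobasis e n" and m: "m \<le> n" and f: "L2c f" and model: "model e m = model \<phi> m"
  shows "wproj \<mu> \<phi> m f \<in> weighted_model T \<mu> \<phi> m"
proof -
  let ?V = "weighted_model T \<mu> \<phi> m" and ?f = "\<lambda>s. sqrt (\<mu> s) * f s"
  let ?P = "\<lambda>p. p \<in> ?V \<and> (\<forall>v\<in>?V. (\<integral>x. (?f x - p x) * v x \<partial>leb_on T) = 0)"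
  define J where "J s = (\<Sum>j=1..m. ip (e j) f * e j s)" for s
  have JL: "L2c J" unfolding J_def[abs_def] by (rule L2c_model_sum[OF e m])
  have J_model: "J \<in> model \<phi> m" unfolding model[symmetric] by (auto simp: model_def J_def[abs_def])
  define p where "p s = sqrt (pos_density s) * J s" for s
  have pV: "p \<in> ?V"
    unfolding weighted_model_def
  proof (intro CollectI conjI bexI[of _ J] ballI J_model)
    have "p \<in> borel_measurable (leb_on T)"
      unfolding p_def[abs_def] using JL by (intro sqrt_pos_density_mult_measurable) (simp add: L2c_def)
    moreover have "sq_norm (leb_on T) p = sq_norm S J"
      unfolding p_def[abs_def] using JL by (subst sq_norm_S_eq_leb) (auto simp: L2c_def)
    ultimately show "p \<in> L2_fun (leb_on T)" unfolding L2_fun_def using sq_norm_S[OF JL] by simp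
    show "p t = sqrt (\<mu> t) * J t" if "t \<in> {0<..T}" for t using that by (simp add: p_def pos_density_def)
  qed
  have orth: "(\<integral>x. (?f x - p x) * v x \<partial>leb_on T) = 0" if v: "v \<in> ?V" for v
  proof -
    obtain \<psi> where \<psi>: "\<psi> \<in> model \<phi> m" "\<And>t. t \<in> {0<..T} \<Longrightarrow> v t = sqrt (\<mu> t) * \<psi> t"
      and vm: "v \<in> borel_measurable (leb_on T)"
      using v by (auto simp: weighted_model_def L2_fun_def)
    obtain y where y: "\<psi> = (\<lambda>s. \<Sum>j=1..m. y j * e j s)" using \<psi>(1) unfolding model[symmetric] by (auto simp: model_def)
    have \<psi>L: "L2c \<psi>" unfolding y by (rule L2c_model_sum[OF e m])
    define g where "g s = 1 * f s + (-1) * J s" for s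
    have gL: "L2c g" unfolding g_def[abs_def] by (rule L2c_lincomb[OF f JL])
    have "ip g (e k) = 0" if k: "k \<in> live e m" for k
    proof -
      have kn: "k \<in> {1..n}" "k \<in> {1..m}" "nrm2 (e k) = 1" using k m by (auto simp: live_def)
      have ek: "L2c (e k)" by (rule orthobasis_L2c[OF e kn(1)])
      have "ip J (e k) = (\<Sum>j\<in>live e m. ip (e j) f * ip (e j) (e k))"
        unfolding J_def[abs_def] by (rule ip_sum_orthobasis[OF e m ek])
      also have "\<dots> = (\<Sum>j\<in>live e m. if j = k then ip (e k) f else 0)"
        using e kn m by (intro sum.cong) (auto simp: orthobasis_def live_def nrm2_eq_ip)
      also have "\<dots> = ip (e k) f" using k by simp
      finally have "ip J (e k) = ip f (e k)" by (simp add: ip_commute)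
      then show ?thesis unfolding g_def[abs_def] using ip_lincomb[OF f JL ek, of 1 "-1"] by simp
    qed
    then have "ip \<psi> g = 0"
      unfolding y ip_sum_orthobasis[OF e m gL] by (intro sum.neutral) (simp add: ip_commute)
    also have "ip \<psi> g = (\<integral>x. pos_density x *\<^sub>R (\<psi> x * g x) \<partial>leb_on T)"
      unfolding ip_def
      by (subst S_eq_density, rule integral_density)
         (use \<psi>L gL pos_density_measurable_leb pos_density_nonneg in \<open>auto simp: L2c_def measurable_leb_on_iff\<close>)
    also have "\<dots> = (\<integral>x. (?f x - p x) * v x \<partial>leb_on T)"
    proof (rule integral_cong_AE)
      show AE: "AE x in leb_on T. pos_density x *\<^sub>R (\<psi> x * g x) = (?f x - p x) * v x"
        using AE_leb_pos
      proof eventually_elim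
        fix x assume x: "x \<in> {0<..T}"
        have "\<mu> x = sqrt (\<mu> x) * sqrt (\<mu> x)" using \<mu>_pos[OF x] by simp
        then show "pos_density x *\<^sub>R (\<psi> x * g x) = (?f x - p x) * v x"
          using x \<psi>(2)[OF x] by (simp add: p_def pos_density_def g_def algebra_simps)
      qed
      show m1: "(\<lambda>x. pos_density x *\<^sub>R (\<psi> x * g x)) \<in> borel_measurable (leb_on T)"
        using \<psi>L gL pos_density_measurable_leb by (auto simp: L2c_def measurable_leb_on_iff)
      have "?f \<in> borel_measurable (leb_on T)"
      proof -
        (* sqrt \<mu> may take any value at 0, so it is measurable because a point is *)
        have "(\<lambda>t. if t = 0 then sqrt (\<mu> 0) else sqrt (pos_density t)) \<in> borel_measurable borel"
          by measurable
        then have "(\<lambda>t. if t = 0 then sqrt (\<mu> 0) else sqrt (pos_density t)) \<in> borel_measurable (leb_on T)"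
          unfolding measurable_leb_on_iff by (rule borel_imp_measurable_stieltjes)
        then have "(\<lambda>t. (if t = 0 then sqrt (\<mu> 0) else sqrt (pos_density t)) * f t) \<in> borel_measurable (leb_on T)"
          using f by (intro borel_measurable_times) (auto simp: L2c_def measurable_leb_on_iff)
        then show ?thesis
          by (rule measurable_cong[THEN iffD1, rotated]) (auto simp: space_leb_on pos_density_def)
      qed
      moreover have "p \<in> borel_measurable (leb_on T)" using pV by (auto simp: weighted_model_def L2_fun_def)
      ultimately show "(\<lambda>x. (?f x - p x) * v x) \<in> borel_measurable (leb_on T)"
        using vm by (rule borel_measurable_times[OF borel_measurable_diff])
    qed
    finally show ?thesis by simp
  qed
  have "?P (SOME p. ?P p)" by (rule someI[of ?P p]) (use pV orth in blast)
  then show ?thesis unfolding orth_proj_def by blast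
qed

lemma bias_le_weighted_projection:
  assumes e: "orthobasis e n" and m: "m \<le> n" and f: "L2c f" and model: "model e m = model \<phi> m"
  shows "ennreal (bias e f m)
    \<le> sq_norm (leb_on T) (\<lambda>t. wproj \<mu> \<phi> m f t - sqrt (\<mu> t) * f t)"
proof -
  let ?p = "wproj \<mu> \<phi> m f"
  obtain \<psi> where \<psi>: "\<psi> \<in> model \<phi> m" "\<And>t. t \<in> {0<..T} \<Longrightarrow> ?p t = sqrt (\<mu> t) * \<psi> t"
    using orth_proj_in_weighted_model[OF assms] by (auto simp: weighted_model_def)
  then obtain y where y: "\<psi> = (\<lambda>s. \<Sum>j=1..m. y j * e j s)" unfolding model[symmetric] by (auto simp: model_def)
  have L: "L2c (\<lambda>s. \<psi> s - f s)"
    using L2c_lincomb[OF L2c_model_sum[OF e m] f, of 1 y "-1"] by (simp add: y)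
  have "ennreal (bias e f m) \<le> ennreal (nrm2 (\<lambda>s. \<psi> s - f s))"
    by (intro ennreal_leI bias_le_nrm2_diff[OF e m f]) (use \<psi>(1) model in simp)
  also have "\<dots> = sq_norm S (\<lambda>s. \<psi> s - f s)" by (rule sq_norm_S[OF L, symmetric])
  also have "\<dots> = sq_norm (leb_on T) (\<lambda>t. sqrt (pos_density t) * (\<psi> t - f t))"
    using L by (intro sq_norm_S_eq_leb) (simp add: L2c_def)
  also have "\<dots> = sq_norm (leb_on T) (\<lambda>t. ?p t - sqrt (\<mu> t) * f t)"
    unfolding sq_norm_def
  proof (rule nn_integral_cong_AE, use AE_leb_pos in eventually_elim)
    fix t assume t: "t \<in> {0<..T}"
    show "ennreal ((sqrt (pos_density t) * (\<psi> t - f t))\<^sup>2) = ennreal ((?p t - sqrt (\<mu> t) * f t)\<^sup>2)"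
      unfolding \<psi>(2)[OF t] using t by (simp add: pos_density_def right_diff_distrib)
  qed
  finally show ?thesis .
qed

end

end

section \<open>Risk bounds for the adaptive estimator\<close>

lemma MIN_bound:
  fixes f :: "nat \<Rightarrow> ennreal"
  assumes "n \<ge> 1" "\<And>m. m \<in> {1..n} \<Longrightarrow> L \<le> c * (f m + d)"
  shows "L \<le> c * ((MIN m\<in>{1..n}. f m) + d)"
proof -
  have "Min (f ` {1..n}) \<in> f ` {1..n}" using assms(1) by (intro Min_in) auto
  then show ?thesis using assms(2) by auto
qed

context selection
begin

lemma oracle_inequality_risk:
  "risk Q S (adaptive) J0
    \<le> ennreal (oracle_const ccal) *
      ((MIN m\<in>{1..mN}. risk Q S (estim m) J0 + ennreal (pen m)) + ennreal (1 / real N))"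
proof (rule MIN_bound)
  show "1 \<le> mN" using mN by simp
  fix m assume m: "m \<in> {1..mN}"
  then have mN': "m \<le> N" using mN by auto
  have nn: "0 \<le> b m" "0 \<le> pen m" using bias_nonneg[OF basis mN' J0] ccal by (auto simp: penalty_def)
  have "risk Q S (adaptive) J0 \<le> ennreal (oracle_const ccal * 1 * (b m + pen m + 1 / real N))"
    unfolding risk_def by (rule oracle_inequality[OF m]) simp_all
  also have "\<dots> = ennreal (oracle_const ccal) * (ennreal (b m) + ennreal (pen m) + ennreal (1 / real N))"
    using nn oracle_const_pos[OF ccal] by (simp add: ennreal_mult)
  also have "\<dots> \<le> ennreal (oracle_const ccal) * (risk Q S (estim m) J0 + ennreal (pen m) + ennreal (1 / real N))"
    by (intro mult_left_mono add_right_mono bias_le_risk[OF mN']) simp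
  finally show "risk Q S (adaptive) J0
    \<le> ennreal (oracle_const ccal) * (risk Q S (estim m) J0 + ennreal (pen m) + ennreal (1 / real N))" .
qed

lemma oracle_inequality_density:
  assumes dens: "is_density T A \<mu> \<nu>"
  shows "risk Q (leb_on T) (adaptive) J0
    \<le> ennreal (oracle_const ccal * sup_norm T \<nu>) *
      ((MIN m\<in>{1..mN}. sq_norm (leb_on T)
          (\<lambda>t. wproj \<mu> \<phi> m J0 t - sqrt (\<mu> t) * J0 t)
        + ennreal ((2 + ccal) * (real m / real N))) + ennreal (1 / real N))"
proof (rule MIN_bound)
  show "1 \<le> mN" using mN by simp
  fix m assume m: "m \<in> {1..mN}"
  then have mN': "m \<le> N" using mN by auto
  have nn: "0 \<le> b m" "0 \<le> pen m" using bias_nonneg[OF basis mN' J0] ccal by (auto simp: penalty_def)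
  note \<nu> = sup_norm_\<nu>(2)[OF dens]
  have "risk Q (leb_on T) (adaptive) J0
      \<le> ennreal (oracle_const ccal * sup_norm T \<nu> * (b m + pen m + 1 / real N))"
    unfolding risk_def
  proof (rule oracle_inequality[OF m \<nu>])
    fix \<omega> assume g: "good \<omega>"
    have "sel \<omega> \<le> N" using selected_dim_minimises(1)[OF g] mN by auto
    then have "continuous_on {0..T} (adaptive \<omega>)"
      unfolding adaptive_estimator_def by (rule estimator_continuous[OF g])
    then have "adaptive \<omega> \<in> borel_measurable S"
      by (rule continuous_on_imp_measurable_stieltjes)
    then show "sq_norm (leb_on T) (\<lambda>t. adaptive \<omega> t - J0 t)
      \<le> ennreal (sup_norm T \<nu>) * sq_norm S (\<lambda>t. adaptive \<omega> t - J0 t)"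
      using J0 by (intro sq_norm_leb_le[OF dens] borel_measurable_diff) (auto simp: L2c_def)
  qed
  also have "\<dots> = ennreal (oracle_const ccal * sup_norm T \<nu>) * (ennreal (b m) + ennreal (pen m) + ennreal (1 / real N))"
    using nn oracle_const_pos[OF ccal] \<nu> by (simp add: ennreal_mult)
  also have "\<dots> \<le> ennreal (oracle_const ccal * sup_norm T \<nu>) * (sq_norm (leb_on T)
          (\<lambda>t. wproj \<mu> \<phi> m J0 t - sqrt (\<mu> t) * J0 t)
        + ennreal ((2 + ccal) * (real m / real N)) + ennreal (1 / real N))"
  proof (intro mult_left_mono add_mono order.refl)
    show "ennreal (b m) \<le> sq_norm (leb_on T)
          (\<lambda>t. wproj \<mu> \<phi> m J0 t - sqrt (\<mu> t) * J0 t)"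
      by (rule bias_le_weighted_projection[OF dens basis mN' J0 models[OF mN']])
    show "ennreal (pen m) \<le> ennreal ((2 + ccal) * (real m / real N))"
      unfolding penalty_def by (intro ennreal_leI mult_right_mono) auto
  qed simp
  finally show "risk Q (leb_on T) (adaptive) J0
    \<le> ennreal (oracle_const ccal * sup_norm T \<nu>) * (sq_norm (leb_on T)
          (\<lambda>t. wproj \<mu> \<phi> m J0 t - sqrt (\<mu> t) * J0 t)
        + ennreal ((2 + ccal) * (real m / real N)) + ennreal (1 / real N))" .
qed

end

theorem theorem4:
  fixes P :: "'a measure" and F :: "real \<Rightarrow> 'a measure" and M :: "real \<Rightarrow> 'a \<Rightarrow> real"
    and T :: real and A J0 :: "real \<Rightarrow> real" and ccal :: real
  assumes "0 < T"
    and "prob_space P"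
    and "cont_sq_int_martingale P F T M"
    and "AE \<omega> in P. M 0 \<omega> = 0"
    and "\<not> (AE \<omega> in P. \<forall>t\<in>{0..T}. M t \<omega> = 0)"
    and "quadratic_variation P F T M (\<lambda>t \<omega>. A t)"
    and "J0 \<in> L2_fun (stieltjes A T)"
    and "1 < ccal"
  shows "\<exists>c::real. 0 < c \<and>
    (\<forall>(N::nat) (\<phi> :: nat \<Rightarrow> real \<Rightarrow> real) (mN::nat)
       (Q :: 'b measure) (X :: nat \<Rightarrow> real \<Rightarrow> 'b \<Rightarrow> real).
       1 \<le> N \<and>
       (\<forall>j\<in>{1..N}. continuous_on {0..T} (\<phi> j)) \<and>
       (\<forall>j\<in>{1..N}. \<forall>k\<in>{1..N}.
          (\<integral>t. \<phi> j t * \<phi> k t \<partial>leb_on T) = (if j = k then 1 else 0)) \<and>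
       (\<forall>m\<in>{1..N}. \<forall>m'\<in>{1..N}. m' < m \<longrightarrow> model \<phi> m' \<subseteq> model \<phi> m) \<and>
       mN \<in> {1..N} \<and>
       prob_space Q \<and> independent_copies P T M N Q X
     \<longrightarrow>
       risk Q (stieltjes A T) (adaptive_estimator Q N X A T J0 \<phi> ccal mN) J0
         \<le> ennreal c *
            ((MIN m\<in>{1..mN}.
                risk Q (stieltjes A T) (proj_estimator Q N X A T J0 \<phi> m) J0
                + ennreal (penalty ccal N m))
             + ennreal (1 / real N))
       \<and>
       (\<forall>\<mu> \<nu> :: real \<Rightarrow> real. is_density T A \<mu> \<nu> \<longrightarrow>
          risk Q (leb_on T) (adaptive_estimator Q N X A T J0 \<phi> ccal mN) J0
            \<le> ennreal (c * sup_norm T \<nu>) *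
               ((MIN m\<in>{1..mN}.
                   sq_norm (leb_on T)
                     (\<lambda>t. orth_proj (leb_on T) (weighted_model T \<mu> \<phi> m)
                             (\<lambda>s. sqrt (\<mu> s) * J0 s) t
                           - sqrt (\<mu> t) * J0 t)
                   + ennreal ((2 + ccal) * (real m / real N)))
                + ennreal (1 / real N))))"
proof -
  let ?c = "oracle_const ccal"
  interpret P: prob_space P by fact
  interpret det_qv_martingale P F M T A
    using assms by unfold_locales auto
  have J0: "L2c J0"
    using assms(7) by (auto simp: L2_fun_def L2c_def intro: integrable_square_of_sq_norm)
  have c_pos: "0 < ?c" by (rule oracle_const_pos[OF assms(8)])
  have main: "risk Q (stieltjes A T) (adaptive_estimator Q N X A T J0 \<phi> ccal mN) J0
         \<le> ennreal ?c *
            ((MIN m\<in>{1..mN}.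
                risk Q (stieltjes A T) (proj_estimator Q N X A T J0 \<phi> m) J0
                + ennreal (penalty ccal N m))
             + ennreal (1 / real N))
       \<and>
       (\<forall>\<mu> \<nu> :: real \<Rightarrow> real. is_density T A \<mu> \<nu> \<longrightarrow>
          risk Q (leb_on T) (adaptive_estimator Q N X A T J0 \<phi> ccal mN) J0
            \<le> ennreal (?c * sup_norm T \<nu>) *
               ((MIN m\<in>{1..mN}.
                   sq_norm (leb_on T)
                     (\<lambda>t. orth_proj (leb_on T) (weighted_model T \<mu> \<phi> m)
                             (\<lambda>s. sqrt (\<mu> s) * J0 s) t
                           - sqrt (\<mu> t) * J0 t)
                   + ennreal ((2 + ccal) * (real m / real N)))
                + ennreal (1 / real N)))"
    if N: "1 \<le> N" and \<phi>: "\<forall>j\<in>{1..N}. continuous_on {0..T} (\<phi> j)" and mN: "mN \<in> {1..N}"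
      and Q: "prob_space Q" and copies: "independent_copies P T M N Q X"
    for N mN \<phi> and Q :: "'b measure" and X
  proof -
    obtain e where e: "orthobasis e N" "\<forall>m\<le>N. model e m = model \<phi> m"
      using Gram_Schmidt[of N \<phi>] \<phi> by blast
    interpret Q: prob_space Q by fact
    interpret selection P F M T A Q X N \<phi> e J0 ccal mN
      by unfold_locales (use N copies J0 assms(8) mN e in auto)
    show ?thesis using oracle_inequality_risk oracle_inequality_density by blast
  qed
  show ?thesis
    by (rule exI[of _ ?c], rule conjI[OF c_pos], intro allI impI, elim conjE, rule main)
qed


end
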